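(* (i) There is a set $E\subset\mathbb{D}\setminus\mathbb{R}$ of zero Hausdorff dimension, such that if $\mathbf{a}=(a_i)_{i\in\Lambda}$ with not all of the $a_i$ equal, $p\in\mathbb{P}_\Lambda$, and $\lambda\in\mathbb{D}\setminus(E\cup\mathbb{R})$, then there are $C,\gamma>0$ (depending on $\lambda,\mathbf{a},p$) such that $$(\ast)\qquad |\widehat{\nu_{\lambda,\mathbf{a}}^p}(\xi)|\le C\,|\xi|^{-\gamma}\quad\text{for all }\xi\in\mathbb{C}\setminus\{0\}.$$ More precisely, fix $\varepsilon>0$ and a region $H=H_{b_1,b_2,\eta}:=\{z\in\mathbb{C}: b_1\le|z|\le b_2,\ \operatorname{Im}(z)>\eta\}$ with $1<b_1<b_2$ and $\eta>0$. Then there exist $\gamma,C>0$ and a set $\mathcal{E}\subset H$ with $\dim_H(\mathcal{E})<\varepsilon$, such that $(\ast)$ holds for all $\lambda$ such that $\lambda^{-1}\in H\setminus\mathcal{E}$. (ii) Given $\lambda\in\mathbb{D}\setminus\mathbb{R}$, there is a set $E\subset\mathbb{C}$ of zero Hausdorff dimension, such that whenever $\#\Lambda\ge3$, $p\in\mathbb{P}_\Lambda$ and $\mathbf{a}=(a_i)_{i\in\Lambda}$ satisfies $(a_k-a_i)/(a_j-a_i)\notin E$ for some distinct $i,j,k\in\Lambda$, there are $C,\gamma>0$ (depending on $\lambda,\mathbf{a},p$) such that $$|\widehat{\nu_{\lambda,\mathbf{a}}^p}(\xi)|\le C\,|\xi|^{-\gamma}\quad\text{for all }\xi\in\mathbb{C}\setminus\{0\}.$$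 (iii) For any $k\in\mathbb{N}$, $\eta>0$, $p\in\mathbb{P}_\Lambda$, and $\mathbf{a}=(a_i)_{i\in\Lambda}$ with all $a_i$ different, $$\lim_{\delta\to0}\dim_H\bigl(\{\lambda\in\mathbb{C}\setminus\mathbb{R}:\ |\lambda|\in(1-\delta,1),\ |\operatorname{Im}(\lambda)|>\eta\text{ and }\nu_{\lambda,\mathbf{a}}^p\notin C^k\}\bigr)=0.$$
   Context: $\mathbb{D}$ is the open unit disk in $\mathbb{C}$ and $\dim_H$ is Hausdorff dimension. $\Lambda$ denotes a finite index set, $\mathbf{a}=(a_i)_{i\in\Lambda}\in\mathbb{C}^\Lambda$, and $\mathbb{P}_\Lambda$ is the open simplex of probability vectors $p=(p_i)_{i\in\Lambda}$ with all $p_i>0$. For $\lambda\in\mathbb{D}$, $\nu_{\lambda,\mathbf{a}}^p$ is the unique Borel probability measure on $\mathbb{C}$ satisfying $\nu_{\lambda,\mathbf{a}}^p=\sum_{i\in\Lambda}p_i\,f_i\nu_{\lambda,\mathbf{a}}^p$, where $f_i(z)=\lambda z+a_i$ and $g\mu(A)=\mu(g^{-1}A)$ is the push-forward. The Fourier transform is $\widehat{\mu}(\xi)=\int_{\mathbb{C}}e^{2\pi i\operatorname{Re}(z\overline{\xi})}\,d\mu(z)$. For a function space $\mathcal{F}$, $\mu\in\mathcal{F}$ means that $\mu$ is absolutely continuous with respect to Lebesgue measure on $\mathbb{C}$ and its Radon–Nikodym derivative is in $\mathcal{F}$; here $C^k$ is the space of $k$ times continuously differentiable functions on $\mathbb{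C}\cong\mathbb{R}^2$.
   Formalization: In the "more precisely" part of (i), C may depend on λ (γ stays uniform on H∖𝓔), since a C uniform in λ is impossible when H contains a complex Pisot number in its interior; in (iii), #Λ≥2 is assumed, since for one point ν is a point mass; in (ii), a_j≠a_i is explicit. *)

theory Defs
  imports "HOL-Probability.Probability"
begin

(* The weight diam(U)^s of a covering set. The empty set weighs 0 for every s, and a nonempty
   set weighs 1 for s = 0 (in Isabelle 0 powr 0 = 0). *)
definition hausdorff_weight :: "real \<Rightarrow> 'a::metric_space set \<Rightarrow> ennreal" where
  "hausdorff_weight s U =
     (if U = {} then 0 else if s = 0 then 1 else ennreal (diameter U powr s))"

(* Covering sets are required to be bounded because diameter is unspecified
   for unbounded sets. *)
definition hausdorff_premeasure :: "real \<Rightarrow> real \<Rightarrow> 'a::metric_space set \<Rightarrow> ennreal" where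
  "hausdorff_premeasure s \<delta> A =
     (INF U \<in> {U :: nat \<Rightarrow> 'a set. (\<forall>i. bounded (U i) \<and> diameter (U i) \<le> \<delta>) \<and> A \<subseteq> (\<Union>i. U i)}.
        \<Sum>i. hausdorff_weight s (U i))"

definition hausdorff_measure :: "real \<Rightarrow> 'a::metric_space set \<Rightarrow> ennreal" where
  "hausdorff_measure s A = (SUP \<delta> \<in> {0<..}. hausdorff_premeasure s \<delta> A)"

definition hausdorff_dim :: "'a::metric_space set \<Rightarrow> ennreal" where
  "hausdorff_dim A = Inf {ennreal s | s. 0 \<le> s \<and> hausdorff_measure s A = 0}"

(* Only the values of p on the index set matter. *)
definition prob_vectors :: "'i set \<Rightarrow> ('i \<Rightarrow> real) set" where
  "prob_vectors \<Lambda> = {p. (\<forall>i\<in>\<Lambda>. 0 < p i) \<and> (\<Sum>i\<in>\<Lambda>. p i) = 1}"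

definition is_self_similar_measure ::
    "'i set \<Rightarrow> complex \<Rightarrow> ('i \<Rightarrow> complex) \<Rightarrow> ('i \<Rightarrow> real) \<Rightarrow> complex measure \<Rightarrow> bool" where
  "is_self_similar_measure \<Lambda> lam a p \<mu> \<longleftrightarrow>
     prob_space \<mu> \<and> sets \<mu> = sets borel \<and>
     (\<forall>A\<in>sets borel.
        emeasure \<mu> A = (\<Sum>i\<in>\<Lambda>. ennreal (p i) * emeasure (distr \<mu> borel (\<lambda>z. lam * z + a i)) A))"

(* Meaningful when \<Lambda> is finite, p is in prob_vectors \<Lambda> and norm lam < 1: exactly one measure
   then has the defining property. *)
definition self_similar_measure ::
    "'i set \<Rightarrow> complex \<Rightarrow> ('i \<Rightarrow> complex) \<Rightarrow> ('i \<Rightarrow> real) \<Rightarrow> complex measure" where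
  "self_similar_measure \<Lambda> lam a p = (THE \<mu>. is_self_similar_measure \<Lambda> lam a p \<mu>)"

definition fourier :: "complex measure \<Rightarrow> complex \<Rightarrow> complex" where
  "fourier \<mu> \<xi> = (\<integral>z. exp (2 * of_real pi * \<i> * of_real (Re (z * cnj \<xi>))) \<partial>\<mu>)"

definition fourier_decay :: "complex measure \<Rightarrow> real \<Rightarrow> real \<Rightarrow> bool" where
  "fourier_decay \<mu> C \<gamma> \<longleftrightarrow> (\<forall>\<xi>. \<xi> \<noteq> 0 \<longrightarrow> norm (fourier \<mu> \<xi>) \<le> C * norm \<xi> powr (- \<gamma>))"

definition region_H :: "real \<Rightarrow> real \<Rightarrow> real \<Rightarrow> complex set" where
  "region_H b1 b2 \<eta> = {z. b1 \<le> norm z \<and> norm z \<le> b2 \<and> Im z > \<eta>}"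

(* C^k over the reals: for a finite-dimensional domain, a differentiable f is C^(n+1) iff all
   its directional derivatives are C^n. *)
primrec C_k :: "nat \<Rightarrow> ('a::euclidean_space \<Rightarrow> 'b::real_normed_vector) \<Rightarrow> bool" where
  "C_k 0 f \<longleftrightarrow> continuous_on UNIV f"
| "C_k (Suc n) f \<longleftrightarrow>
     (\<forall>x. f differentiable (at x)) \<and> (\<forall>v. C_k n (\<lambda>x. frechet_derivative f (at x) v))"

(* The Radon-Nikodym derivative is only determined almost everywhere. The condition 0 \<le> f is
   needed because ennreal truncates negative numbers to 0. *)
definition has_C_k_density :: "nat \<Rightarrow> complex measure \<Rightarrow> bool" where
  "has_C_k_density k \<mu> \<longleftrightarrow>
     absolutely_continuous lborel \<mu> \<and>
     (\<exists>f :: complex \<Rightarrow> real. (\<forall>z. 0 \<le> f z) \<and> C_k k f \<and>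
        (AE z in lborel. RN_deriv lborel \<mu> z = ennreal (f z)))"

end

theory Submission
  imports Defs
begin

text \<open>
  By self-similarity \<open>fourier \<mu> \<xi>\<close> is the infinite product of the values of a trigonometric polynomial
  along the orbit \<open>cnj lam ^ n * \<xi>\<close>. A factor is bounded away from 1 whenever the real part of the
  corresponding point of an orbit \<open>\<theta> ^ n * t\<close>, \<open>\<theta> = 1 / lam\<close>, is away from the integers, so power decay
  holds as soon as this happens with positive frequency in \<open>n\<close>. The Erdos-Kahane argument bounds the
  exceptional parameters: \<open>Re (\<theta> ^ n * t)\<close> satisfies a second order linear recurrence, so the nearest
  integers to four consecutive terms leave boundedly many choices for the next nearest integer, and
  only one if all five terms are close to integers. Hence there are few sequences of
  nearest integers with rare deviations, and the first \<open>N\<close> of them determine \<open>\<theta>\<close> up to an error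
  exponentially small in \<open>N\<close>. For fixed \<open>\<theta>\<close> the same argument applies to the pair of sequences given by
  \<open>t\<close> and \<open>u * t\<close>, with \<open>u\<close> the ratio of differences of translations.

  For smoothness near the unit circle, the measure for \<open>lam\<close> is a convolution of \<open>m\<close> rescaled copies of the
  measure for \<open>lam ^ m\<close>; choosing \<open>m\<close> with \<open>lam ^ m\<close> in a fixed annulus multiplies a uniform decay exponent
  by \<open>m\<close>, which tends to infinity as \<open>norm lam\<close> tends to 1.
\<close>

section \<open>Fourier inversion in the plane\<close>

text \<open>The Erdos-Kahane argument balances two exponential rates. At most (1 + small)^N codes of
  length N, up to a constant, have deviation frequency below \<delta>, and each confines the
  parameter to a set of diameter O(\<beta>^N) with \<beta> < 1. For every s > 0 a small enough
  \<delta> makes the s-weights of these covers summable, so \<delta> shrinks with s. A fixed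
  \<delta> thus gives small positive dimension with a uniform exponent; dimension zero needs all
  \<delta> at once, and the exponent then depends on the parameter.

  The obstacle is that the starting vector t is arbitrary and may change with N. Codes therefore
  belong to pairs, of which only the first component has to be localised. For bases, the recurrence
  coefficients solve a linear system built from the orbit, with determinant |z|^2 (Im \<theta>)^2: a
  lower bound on Im \<theta> keeps it solvable, and growth of the orbit makes the solution
  exponentially accurate without any knowledge of t.

  Fourier inversion serves twice: for the uniqueness that gives the description operator in
  \<open>self_similar_measure\<close> its value, and for densities.\<close>

lemma measurable_Complex [measurable]:
  assumes [measurable]: "f \<in> borel_measurable M" "g \<in> borel_measurable M"
  shows "(\<lambda>x. Complex (f x) (g x)) \<in> borel_measurable M"
  unfolding Complex_eq by measurable

text \<open>Lets one-dimensional facts enter through Fubini: the characteristic function of the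
  normal distribution and the integrability of 1 / (1 + x^2).\<close>

lemma lborel_complex: "(lborel :: complex measure) = distr (lborel \<Otimes>\<^sub>M lborel) borel (\<lambda>(x, y). Complex x y)"
proof (rule lborel_eqI)
  fix l u :: complex assume le: "\<And>b. b \<in> Basis \<Longrightarrow> l \<bullet> b \<le> u \<bullet> b"
  have "Re l \<le> Re u" "Im l \<le> Im u"
    using le[of 1] le[of \<i>] by (auto simp: Basis_complex_def inner_complex_def)
  moreover have "(\<lambda>(x, y). Complex x y) -` box l u = {Re l<..<Re u} \<times> {Im l<..<Im u}"
    by (auto simp: box_def Basis_complex_def inner_complex_def)
  moreover have "(\<Prod>b\<in>Basis. (u - l) \<bullet> b) = (Re u - Re l) * (Im u - Im l)"
    by (auto simp: Basis_complex_def inner_complex_def)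
  ultimately show "emeasure (distr (lborel \<Otimes>\<^sub>M lborel) borel (\<lambda>(x, y). Complex x y)) (box l u) =
      ennreal (\<Prod>b\<in>Basis. (u - l) \<bullet> b)"
    by (subst emeasure_distr)
      (auto simp: space_pair_measure lborel.emeasure_pair_measure_Times simp flip: ennreal_mult)
qed simp

section \<open>The planar Gaussian and the characters of the plane\<close>

definition gauss2_density :: "complex \<Rightarrow> real" where
  "gauss2_density z = exp (- (norm z)\<^sup>2 / 2) / (2 * pi)"

definition gauss2 :: "complex measure" where
  "gauss2 = density lborel gauss2_density"

lemma measurable_gauss2_density [measurable]: "gauss2_density \<in> borel_measurable borel"
  unfolding gauss2_density_def by measurable

lemma sets_gauss2 [simp, measurable_cong]: "sets gauss2 = sets borel"
  by (simp add: gauss2_def)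

lemma gauss2_density_nonneg: "0 \<le> gauss2_density z"
  by (simp add: gauss2_density_def)

lemma gauss2_eq_distr:
  "gauss2 = distr (std_normal_distribution \<Otimes>\<^sub>M std_normal_distribution) borel (\<lambda>(x, y). Complex x y)"
proof -
  interpret N: prob_space std_normal_distribution
    by (rule prob_space_normal_density) simp
  have "gauss2_density (Complex x y) = std_normal_density x * std_normal_density y" for x y
  proof -
    have "exp (- (x\<^sup>2 + y\<^sup>2) / 2) = exp (- x\<^sup>2 / 2) * exp (- y\<^sup>2 / 2)"
      by (simp add: add_divide_distrib diff_divide_distrib flip: exp_add)
    then show ?thesis
      by (simp add: gauss2_density_def std_normal_density_def cmod_def)
  qed
  then have "density (lborel \<Otimes>\<^sub>M lborel) ((\<lambda>z. ennreal (gauss2_density z)) \<circ> (\<lambda>(x, y). Complex x y)) =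
      density (lborel \<Otimes>\<^sub>M lborel) (\<lambda>(x, y). ennreal (std_normal_density x) * ennreal (std_normal_density y))"
    by (intro arg_cong2[of _ _ _ _ density]) (auto simp: fun_eq_iff ennreal_mult)
  then have "distr (density (lborel \<Otimes>\<^sub>M lborel) ((\<lambda>z. ennreal (gauss2_density z)) \<circ> (\<lambda>(x, y). Complex x y)))
       borel (\<lambda>(x, y). Complex x y) =
     distr (std_normal_distribution \<Otimes>\<^sub>M std_normal_distribution) borel (\<lambda>(x, y). Complex x y)"
    by (subst pair_measure_density)
      (auto intro: N.sigma_finite_measure_axioms lborel.sigma_finite_measure_axioms)
  then show ?thesis
    unfolding gauss2_def by (subst lborel_complex) (simp add: density_distr comp_def)
qed

lemma prob_space_gauss2: "prob_space gauss2"
proof -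
  interpret N: prob_space std_normal_distribution
    by (rule prob_space_normal_density) simp
  interpret P: pair_prob_space std_normal_distribution std_normal_distribution ..
  show ?thesis unfolding gauss2_eq_distr by (rule P.prob_space_distr) simp
qed

definition wave :: "complex \<Rightarrow> complex \<Rightarrow> complex" where
  "wave z \<xi> = exp (2 * of_real pi * \<i> * of_real (Re (z * cnj \<xi>)))"

lemma fourier_wave: "fourier \<mu> \<xi> = (\<integral>z. wave z \<xi> \<partial>\<mu>)"
  by (simp add: fourier_def wave_def)

lemma norm_wave [simp]: "norm (wave z \<xi>) = 1"
  by (simp add: wave_def)

lemma wave_0 [simp]: "wave 0 \<xi> = 1" "wave z 0 = 1"
  by (simp_all add: wave_def)

lemma wave_add: "wave (z + w) \<xi> = wave z \<xi> * wave w \<xi>"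
  by (simp add: wave_def exp_add[symmetric] algebra_simps)

lemma wave_mult: "wave (w * z) \<xi> = wave z (cnj w * \<xi>)"
  by (simp add: wave_def algebra_simps)

text \<open>The pairing \<open>Re (z * cnj \<xi>)\<close> is the real inner product, hence symmetric
  and compatible with real scaling. The exchange turns an integral over frequencies into the Fourier
  transform of \<open>gauss2\<close>.\<close>

lemma wave_scale: "wave w (\<xi> / of_real s) = wave \<xi> (w / of_real s)"
  by (simp add: wave_def mult.commute add.commute)

lemma wave_iexp: "wave z \<xi> = iexp (2 * pi * Re (z * cnj \<xi>))"
  by (simp add: wave_def mult_ac)

lemma measurable_wave [measurable]:
  assumes [measurable]: "f \<in> borel_measurable M" "g \<in> borel_measurable M"
  shows "(\<lambda>x. wave (f x) (g x)) \<in> borel_measurable M"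
proof -
  have [measurable]: "cnj \<in> borel_measurable borel"
    by (intro borel_measurable_continuous_onI continuous_intros)
  show ?thesis unfolding wave_def by measurable
qed

lemma continuous_wave: "continuous_on UNIV (\<lambda>\<xi>. wave z \<xi>)"
  unfolding wave_def by (intro continuous_intros)

lemma (in finite_measure) integrable_wave:
  assumes [measurable]: "f \<in> borel_measurable M" "g \<in> borel_measurable M"
  shows "integrable M (\<lambda>x. wave (f x) (g x))"
  by (rule integrable_const_bound[where B = 1]) auto

lemma fourier_gauss2: "fourier gauss2 \<xi> = of_real (exp (- 2 * pi\<^sup>2 * (norm \<xi>)\<^sup>2))"
proof -
  let ?N = std_normal_distribution
  interpret N: prob_space ?N
    by (rule prob_space_normal_density) simp
  interpret P: pair_prob_space ?N ?N ..
  have w: "wave (Complex x y) \<xi> = iexp (2 * pi * Re \<xi> * x) * iexp (2 * pi * Im \<xi> * y)" for x y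
    by (simp add: wave_def exp_add[symmetric] algebra_simps)
  have "fourier gauss2 \<xi> = (\<integral>p. wave (Complex (fst p) (snd p)) \<xi> \<partial>(?N \<Otimes>\<^sub>M ?N))"
    unfolding fourier_wave gauss2_eq_distr by (subst integral_distr) (auto simp: case_prod_unfold)
  also have "\<dots> = (\<integral>x. (\<integral>y. wave (Complex x y) \<xi> \<partial>?N) \<partial>?N)"
    by (subst P.integral_fst'[symmetric]) (auto intro!: P.P.integrable_wave)
  also have "\<dots> = char ?N (2 * pi * Re \<xi>) * char ?N (2 * pi * Im \<xi>)"
    unfolding w char_def by simp
  also have "\<dots> = of_real (exp (- 2 * pi\<^sup>2 * (norm \<xi>)\<^sup>2))"
    unfolding char_std_normal_distribution of_real_mult[symmetric] exp_add[symmetric]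
    by (simp add: cmod_def power_mult_distrib algebra_simps)
  finally show ?thesis .
qed

lemma measurable_fourier [measurable]:
  assumes "prob_space \<mu>" and [measurable_cong]: "sets \<mu> = sets borel"
  shows "fourier \<mu> \<in> borel_measurable borel"
proof -
  interpret prob_space \<mu> by fact
  show ?thesis unfolding fourier_wave[abs_def] by measurable
qed

lemma norm_fourier_le_1:
  assumes "prob_space \<mu>" and [measurable_cong]: "sets \<mu> = sets borel"
  shows "norm (fourier \<mu> \<xi>) \<le> 1"
proof -
  interpret prob_space \<mu> by fact
  have "norm (fourier \<mu> \<xi>) \<le> (\<integral>z. norm (wave z \<xi>) \<partial>\<mu>)"
    unfolding fourier_wave by (rule integral_norm_bound)
  then show ?thesis by (simp add: prob_space)
qed

text \<open>Gaussian smoothing of \<open>\<mu>\<close> at scale \<open>s\<close>, up to normalisation.\<close>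

definition smoothed :: "complex measure \<Rightarrow> real \<Rightarrow> complex \<Rightarrow> real" where
  "smoothed \<mu> s z = (\<integral>w. exp (- 2 * pi\<^sup>2 * (norm ((w - z) / of_real s))\<^sup>2) \<partial>\<mu>)"

text \<open>Fubini for \<open>wave (w - z) (\<xi> / s)\<close> under \<mu> in w and the Gaussian in
  \<xi>: one order of integration gives the smoothing, the other an expression in
  \<open>fourier \<mu>\<close> alone.\<close>

lemma smoothed_eq_fourier:
  assumes "prob_space \<mu>" and [measurable_cong]: "sets \<mu> = sets borel"
  shows "of_real (smoothed \<mu> s z) =
    (\<integral>\<xi>. fourier \<mu> (\<xi> / of_real s) * wave (- z) (\<xi> / of_real s) \<partial>gauss2)"
proof -
  interpret M: prob_space \<mu> by fact
  interpret G: prob_space gauss2 by (rule prob_space_gauss2)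
  interpret P: pair_prob_space \<mu> gauss2 ..
  have "(\<integral>\<xi>. fourier \<mu> (\<xi> / of_real s) * wave (- z) (\<xi> / of_real s) \<partial>gauss2) =
      (\<integral>\<xi>. (\<integral>w. wave (w - z) (\<xi> / of_real s) \<partial>\<mu>) \<partial>gauss2)"
    by (intro Bochner_Integration.integral_cong refl)
      (simp add: fourier_wave wave_add[symmetric] del: uminus_add_conv_diff flip: integral_mult_left_zero)
  also have "\<dots> = (\<integral>w. (\<integral>\<xi>. wave (w - z) (\<xi> / of_real s) \<partial>gauss2) \<partial>\<mu>)"
    by (rule P.Fubini_integral) (auto intro!: P.P.integrable_wave simp: case_prod_unfold)
  also have "\<dots> = (\<integral>w. fourier gauss2 ((w - z) / of_real s) \<partial>\<mu>)"
    unfolding fourier_wave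
    by (intro Bochner_Integration.integral_cong refl wave_scale)
  also have "\<dots> = of_real (smoothed \<mu> s z)"
    unfolding fourier_gauss2 smoothed_def
    by (rule integral_of_real) (auto intro!: M.integrable_const_bound[where B = 1])
  finally show ?thesis ..
qed

section \<open>Recovering a measure from its Gaussian smoothings\<close>

lemma integral_lborel_affine:
  fixes g :: "complex \<Rightarrow> 'b::{banach, second_countable_topology}"
  assumes [measurable]: "g \<in> borel_measurable borel" and c: "c \<noteq> 0"
  shows "(\<integral>z. g z \<partial>lborel) = c\<^sup>2 *\<^sub>R (\<integral>y. g (t + of_real c * y) \<partial>lborel)"
  by (subst lborel_affine[OF c, of t])
    (simp add: integral_density integral_distr scaleR_conv_of_real)

text \<open>Bounded support gives integrability for Lebesgue measure, the range [0, 1] a dominating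
  constant for probability measures, and the class still approximates indicators of bounded open
  sets from below.\<close>

definition test_function :: "(complex \<Rightarrow> real) \<Rightarrow> bool" where
  "test_function h \<longleftrightarrow> continuous_on UNIV h \<and> (\<forall>z. 0 \<le> h z \<and> h z \<le> 1) \<and> bounded {z. h z \<noteq> 0}"

lemma test_function_measurable [measurable_dest]:
  "test_function h \<Longrightarrow> h \<in> borel_measurable borel"
  by (auto simp: test_function_def intro: borel_measurable_continuous_onI)

lemma test_function_bounds: "test_function h \<Longrightarrow> 0 \<le> h z" "test_function h \<Longrightarrow> h z \<le> 1"
  by (auto simp: test_function_def)

lemma test_function_integrable_mult:
  fixes f :: "complex \<Rightarrow> real"
  assumes h: "test_function h" and [measurable]: "f \<in> borel_measurable borel" and f: "\<And>z. \<bar>f z\<bar> \<le> B"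
  shows "integrable lborel (\<lambda>z. h z * f z)"
proof -
  have [measurable]: "h \<in> borel_measurable borel" using h by measurable
  obtain R where R: "\<And>z. h z \<noteq> 0 \<Longrightarrow> norm z \<le> R"
    using h unfolding test_function_def bounded_iff by auto
  show ?thesis
  proof (rule Bochner_Integration.integrable_bound)
    show "integrable lborel (\<lambda>z::complex. B * indicat_real (cball 0 R) z)"
      by (intro integrable_mult_right integrable_real_indicator) (auto simp: emeasure_bounded_finite[unfolded infinity_ennreal_def])
    have "0 \<le> B" using f[of 0] by linarith
    have "norm (h z * f z) \<le> norm (B * indicat_real (cball 0 R) z)" for z
    proof (cases "h z = 0")
      case False
      have "\<bar>h z\<bar> * \<bar>f z\<bar> \<le> 1 * B"
        using f test_function_bounds[OF h] by (intro mult_mono) auto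
      then show ?thesis using R[OF False] \<open>0 \<le> B\<close> by (simp add: abs_mult)
    qed simp
    then show "AE z in lborel. norm (h z * f z) \<le> norm (B * indicat_real (cball 0 R) z)" by simp
  qed measurable
qed

lemma integral_test_smoothed:
  assumes "prob_space \<mu>" and [measurable_cong]: "sets \<mu> = sets borel"
    and h: "test_function h" and s: "0 < s"
  shows "(\<integral>z. h z * smoothed \<mu> s z \<partial>lborel) =
    s\<^sup>2 / (2 * pi) * (\<integral>w. (\<integral>y. h (w + of_real (s / (2 * pi)) * y) \<partial>gauss2) \<partial>\<mu>)"
proof -
  interpret M: prob_space \<mu> by fact
  interpret P: pair_sigma_finite lborel \<mu> ..
  have [measurable]: "h \<in> borel_measurable borel" using h by measurable
  let ?g = "\<lambda>z w. exp (- 2 * pi\<^sup>2 * (norm ((w - z) / complex_of_real s))\<^sup>2)"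
  let ?c = "s / (2 * pi)"
  have hint: "integrable lborel h"
    using test_function_integrable_mult[OF h, of "\<lambda>_. 1" 1] by simp
  have "integrable (lborel \<Otimes>\<^sub>M \<mu>) (\<lambda>(z, w). h z)"
    by (intro P.Fubini_integrable) (use hint in \<open>auto simp: M.prob_space\<close>)
  then have int: "integrable (lborel \<Otimes>\<^sub>M \<mu>) (\<lambda>(z, w). h z * ?g z w)"
    by (rule Bochner_Integration.integrable_bound)
      (auto simp: abs_mult test_function_bounds[OF h] intro!: AE_I2 mult_left_le)
  have "(\<integral>z. h z * smoothed \<mu> s z \<partial>lborel) = (\<integral>z. (\<integral>w. h z * ?g z w \<partial>\<mu>) \<partial>lborel)"
    unfolding smoothed_def by simp
  also have "\<dots> = (\<integral>w. (\<integral>z. h z * ?g z w \<partial>lborel) \<partial>\<mu>)"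
    by (rule P.Fubini_integral[symmetric, OF int])
  also have "\<dots> = (\<integral>w. s\<^sup>2 / (2 * pi) * (\<integral>y. h (w + of_real ?c * y) \<partial>gauss2) \<partial>\<mu>)"
  proof (intro Bochner_Integration.integral_cong refl)
    fix w
    \<comment> \<open>The scale s / (2 pi) turns the kernel exp(-2 pi^2 |.|^2 / s^2) into the
      standard Gaussian exp(-|y|^2 / 2). The Jacobian is its square, and the factor 2 pi normalises
      the density.\<close>
    have "?g (w + of_real ?c * y) w = 2 * pi * gauss2_density y" for y
      using s by (simp add: gauss2_density_def norm_mult norm_divide power_mult_distrib power_divide)
    then have "(\<integral>z. h z * ?g z w \<partial>lborel) =
        ?c\<^sup>2 * (\<integral>y. h (w + of_real ?c * y) * (2 * pi * gauss2_density y) \<partial>lborel)"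
      using s by (subst integral_lborel_affine[of _ ?c w]) auto
    also have "(\<integral>y. h (w + of_real ?c * y) * (2 * pi * gauss2_density y) \<partial>lborel) =
        2 * pi * (\<integral>y. gauss2_density y *\<^sub>R h (w + of_real ?c * y) \<partial>lborel)"
      by (subst integral_mult_right_zero[symmetric]) (simp add: mult_ac)
    also have "(\<integral>y. gauss2_density y *\<^sub>R h (w + of_real ?c * y) \<partial>lborel) = (\<integral>y. h (w + of_real ?c * y) \<partial>gauss2)"
      unfolding gauss2_def by (subst integral_density) (auto simp: gauss2_density_nonneg)
    finally show "(\<integral>z. h z * ?g z w \<partial>lborel) = s\<^sup>2 / (2 * pi) * (\<integral>y. h (w + of_real ?c * y) \<partial>gauss2)"
      by (simp add: power2_eq_square field_simps)
  qed
  finally show ?thesis by simp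
qed

text \<open>The normalised kernel is a Gaussian of width proportional to \<open>s n\<close>, an
  approximate identity. Continuity of \<open>h\<close> gives pointwise convergence of the inner
  integral, and the bound 1 dominates both integrals.\<close>

lemma smoothed_tendsto:
  assumes "prob_space \<mu>" and [measurable_cong]: "sets \<mu> = sets borel"
    and h: "test_function h" and s: "\<And>n. 0 < s n" "s \<longlonglongrightarrow> 0"
  shows "(\<lambda>n. (\<integral>z. h z * (smoothed \<mu> (s n) z * (2 * pi) / (s n)\<^sup>2) \<partial>lborel)) \<longlonglongrightarrow> (\<integral>w. h w \<partial>\<mu>)"
proof -
  interpret M: prob_space \<mu> by fact
  interpret G: prob_space gauss2 by (rule prob_space_gauss2)
  have [measurable]: "h \<in> borel_measurable borel" using h by measurable
  have cont: "isCont h z" for z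
    using h by (auto simp: test_function_def continuous_on_eq_continuous_at)
  have "(\<integral>z. h z * (smoothed \<mu> (s n) z * (2 * pi) / (s n)\<^sup>2) \<partial>lborel) =
     (\<integral>w. (\<integral>y. h (w + of_real (s n / (2 * pi)) * y) \<partial>gauss2) \<partial>\<mu>)" for n
  proof -
    have "(\<integral>z. h z * (smoothed \<mu> (s n) z * (2 * pi) / (s n)\<^sup>2) \<partial>lborel) =
       2 * pi / (s n)\<^sup>2 * (\<integral>z. h z * smoothed \<mu> (s n) z \<partial>lborel)"
      by (subst integral_mult_right_zero[symmetric]) (simp add: mult_ac)
    then show ?thesis
      using s(1)[of n] unfolding integral_test_smoothed[OF assms(1,2) h s(1)] by simp
  qed
  moreover have "(\<lambda>n. \<integral>w. (\<integral>y. h (w + of_real (s n / (2 * pi)) * y) \<partial>gauss2) \<partial>\<mu>) \<longlonglongrightarrow> (\<integral>w. h w \<partial>\<mu>)"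
  proof (rule integral_dominated_convergence[where w = "\<lambda>_. 1"])
    show "AE w in \<mu>. (\<lambda>n. \<integral>y. h (w + of_real (s n / (2 * pi)) * y) \<partial>gauss2) \<longlonglongrightarrow> h w"
    proof (rule AE_I2)
      fix w
      have "(\<lambda>n. \<integral>y. h (w + of_real (s n / (2 * pi)) * y) \<partial>gauss2) \<longlonglongrightarrow> (\<integral>y. h w \<partial>gauss2)"
      proof (rule integral_dominated_convergence[where w = "\<lambda>_. 1"])
        have "(\<lambda>n. w + of_real (s n / (2 * pi)) * y) \<longlonglongrightarrow> w" for y
          by (rule tendsto_eq_intros s refl | simp)+
        then have "(\<lambda>n. h (w + of_real (s n / (2 * pi)) * y)) \<longlonglongrightarrow> h w" for y
          by (rule isCont_tendsto_compose[OF cont])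
        then show "AE y in gauss2. (\<lambda>n. h (w + of_real (s n / (2 * pi)) * y)) \<longlonglongrightarrow> h w" by simp
      qed (auto simp: test_function_bounds[OF h])
      then show "(\<lambda>n. \<integral>y. h (w + of_real (s n / (2 * pi)) * y) \<partial>gauss2) \<longlonglongrightarrow> h w"
        by (simp add: G.prob_space)
    qed
    fix n
    have "norm (\<integral>y. h (w + of_real (s n / (2 * pi)) * y) \<partial>gauss2) \<le> 1" for w
    proof -
      have "(\<integral>y. norm (h (w + of_real (s n / (2 * pi)) * y)) \<partial>gauss2) \<le> 1"
        by (rule G.integral_le_const)
          (auto simp: test_function_bounds[OF h] intro!: G.integrable_const_bound[where B = 1])
      then show ?thesis by (rule order_trans[OF integral_norm_bound])
    qed
    then show "AE w in \<mu>. norm (\<integral>y. h (w + of_real (s n / (2 * pi)) * y) \<partial>gauss2) \<le> 1" by simp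
  qed auto
  ultimately show ?thesis by simp
qed

text \<open>Bounded open sets form an intersection-stable generator, and the indicator of such a set
  U is the increasing limit of the test functions min(1, n dist(z, -U)). Finiteness on balls
  supplies the exhaustion.\<close>

lemma measure_eqI_test_functions:
  fixes M N :: "complex measure"
  assumes sets [measurable_cong]: "sets M = sets borel" "sets N = sets borel"
    and eq: "\<And>h. test_function h \<Longrightarrow> (\<integral>\<^sup>+z. ennreal (h z) \<partial>M) = (\<integral>\<^sup>+z. ennreal (h z) \<partial>N)"
    and fin: "\<And>r. emeasure M (ball 0 r) \<noteq> \<infinity>"
  shows "M = N"
proof (rule measure_eqI_generator_eq[where E = "{U. open U \<and> bounded U}" and \<Omega> = UNIV and A = "\<lambda>n. ball 0 (real n)"])
  show "Int_stable {U :: complex set. open U \<and> bounded U}"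
    by (auto simp: Int_stable_def intro: bounded_Int)
  have "sets borel = sigma_sets UNIV {U :: complex set. open U \<and> bounded U}"
  proof -
    have "U \<in> sigma_sets UNIV {U :: complex set. open U \<and> bounded U}" if "open U" for U :: "complex set"
    proof -
      have "U = (\<Union>n::nat. U \<inter> ball 0 (real n))"
        using reals_Archimedean2 by (auto simp: dist_norm)
      moreover have "(\<Union>n::nat. U \<inter> ball 0 (real n)) \<in> sigma_sets UNIV {U :: complex set. open U \<and> bounded U}"
        using that by (intro sigma_sets.Union sigma_sets.Basic) auto
      ultimately show ?thesis by simp
    qed
    then have "sigma_sets UNIV {U :: complex set. open U \<and> bounded U} = sigma_sets UNIV {U. open U}"
      by (intro sigma_sets_eqI) auto
    then show ?thesis by (simp add: borel_def)
  qed
  then show "sets M = sigma_sets UNIV {U. open U \<and> bounded U}"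
    "sets N = sigma_sets UNIV {U. open U \<and> bounded U}" using sets by auto
  show "emeasure M U = emeasure N U" if "U \<in> {U. open U \<and> bounded U}" for U
  proof -
    have U: "open U" "bounded U" using that by auto
    \<comment> \<open>\<open>infdist\<close> to the empty set is 0 by convention, so positivity
      inside U requires a nonempty complement.\<close>
    have ne: "- U \<noteq> {}" using U not_bounded_UNIV by (metis Compl_UNIV_eq double_complement)
    define h where "h n z = min 1 (real n * infdist z (- U))" for n :: nat and z
    have pos: "0 < infdist z (- U) \<longleftrightarrow> z \<in> U" for z
      using in_closed_iff_infdist_zero[of "- U" z] U ne infdist_nonneg[of z "- U"] by force
    then have zero: "infdist z (- U) = 0" if "z \<notin> U" for z
      using that infdist_nonneg[of z "- U"] by force
    have "{z. h n z \<noteq> 0} \<subseteq> U" for n proof -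
      have "h n z = 0" if "z \<notin> U" for z using zero[OF that] by (simp add: h_def)
      then show ?thesis by blast
    qed
    then have test: "test_function (h n)" for n
      unfolding test_function_def using bounded_subset[OF U(2)]
      by (auto simp: h_def infdist_nonneg intro!: continuous_intros)
    then have [measurable]: "h n \<in> borel_measurable borel" for n by measurable
    have "incseq (\<lambda>n z. ennreal (h n z))"
      unfolding incseq_def le_fun_def h_def
      by (intro allI impI ennreal_leI min.mono mult_right_mono infdist_nonneg) auto
    moreover have sup: "(SUP n. ennreal (h n z)) = indicator U z" for z
    proof (cases "z \<in> U")
      case True
      then obtain n :: nat where "1 < real n * infdist z (- U)"
        using pos[of z] reals_Archimedean3 by blast
      then have "h n z = 1" by (simp add: h_def)
      moreover have "h m z \<le> 1" for m by (simp add: h_def)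
      ultimately show ?thesis using True
        by (intro antisym SUP_least) (auto intro!: SUP_upper2[of n] simp: ennreal_le_1)
    next
      case False
      then show ?thesis using zero[of z] by (simp add: h_def)
    qed
    ultimately have lim: "emeasure K U = (SUP n. \<integral>\<^sup>+z. ennreal (h n z) \<partial>K)"
      if "sets K = sets borel" for K
    proof -
      have [measurable_cong]: "sets K = sets borel" by fact
      have "emeasure K U = (\<integral>\<^sup>+z. (SUP n. ennreal (h n z)) \<partial>K)"
        unfolding sup using U that by simp
      also have "\<dots> = (SUP n. \<integral>\<^sup>+z. ennreal (h n z) \<partial>K)"
        by (rule nn_integral_monotone_convergence_SUP) (fact, measurable)
      finally show ?thesis .
    qed
    show ?thesis unfolding lim[OF sets(1)] lim[OF sets(2)] using eq[OF test] by simp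
  qed
  show "(\<Union>n::nat. ball (0::complex) (real n)) = UNIV"
    using reals_Archimedean2 by (auto simp: dist_norm)
qed (use fin in \<open>auto intro: bounded_ball\<close>)

text \<open>Equal transforms give equal smoothings at every scale; letting the scale tend to 0
  identifies the integrals of all test functions.\<close>

lemma fourier_unique:
  assumes \<mu>: "prob_space \<mu>" "sets \<mu> = sets borel" and \<nu>: "prob_space \<nu>" "sets \<nu> = sets borel"
    and eq: "fourier \<mu> = fourier \<nu>"
  shows "\<mu> = \<nu>"
proof (rule measure_eqI_test_functions[OF \<mu>(2) \<nu>(2)])
  interpret M: prob_space \<mu> by fact
  interpret N: prob_space \<nu> by fact
  note [measurable_cong] = \<mu>(2) \<nu>(2)
  show "emeasure \<mu> (ball 0 r) \<noteq> \<infinity>" for r by simp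
  fix h assume h: "test_function h"
  then have [measurable]: "h \<in> borel_measurable borel" by measurable
  define s where "s n = 1 / real (Suc n)" for n
  have s: "\<And>n. 0 < s n" "s \<longlonglongrightarrow> 0"
    unfolding s_def using LIMSEQ_inverse_real_of_nat by (auto simp: inverse_eq_divide)
  have "complex_of_real (smoothed \<mu> t z) = of_real (smoothed \<nu> t z)" for t z
    unfolding smoothed_eq_fourier[OF \<mu>] smoothed_eq_fourier[OF \<nu>] eq ..
  then have "smoothed \<mu> = smoothed \<nu>" by (auto simp: fun_eq_iff)
  then have "(\<integral>w. h w \<partial>\<mu>) = (\<integral>w. h w \<partial>\<nu>)"
    using LIMSEQ_unique[OF smoothed_tendsto[OF \<mu> h s]] smoothed_tendsto[OF \<nu> h s] by simp
  moreover have "integrable \<mu> h" "integrable \<nu> h"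
    by (auto intro!: M.integrable_const_bound[where B = 1] N.integrable_const_bound[where B = 1]
      simp: test_function_bounds[OF h])
  ultimately show "(\<integral>\<^sup>+z. ennreal (h z) \<partial>\<mu>) = (\<integral>\<^sup>+z. ennreal (h z) \<partial>\<nu>)"
    by (simp add: nn_integral_eq_integral test_function_bounds[OF h])
qed

text \<open>The inversion integral damped by a Gaussian is the normalised smoothing
  \<open>Q n\<close>, which is nonnegative. Integrability of the transform allows the damping to be
  removed, so nonnegativity passes to \<open>f\<close> at every point and not merely almost
  everywhere.\<close>

lemma fourier_inversion:
  assumes \<mu>: "prob_space \<mu>" "sets \<mu> = sets borel" and int: "integrable lborel (fourier \<mu>)"
  defines "f \<equiv> \<lambda>z. Re (\<integral>\<xi>. fourier \<mu> \<xi> * wave (- z) \<xi> \<partial>lborel)"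
  shows "0 \<le> f z" "\<mu> = density lborel f"
proof -
  interpret M: prob_space \<mu> by fact
  note [measurable_cong] = \<mu>(2)
  have [measurable]: "fourier \<mu> \<in> borel_measurable borel" by (rule measurable_fourier[OF \<mu>])
  define I where "I = (\<integral>\<xi>. norm (fourier \<mu> \<xi>) \<partial>lborel)"
  define s where "s n = 1 / real (Suc n)" for n
  have s: "\<And>n. 0 < s n" "s \<longlonglongrightarrow> 0"
    unfolding s_def using LIMSEQ_inverse_real_of_nat by (auto simp: inverse_eq_divide)
  define Q where "Q n z = smoothed \<mu> (s n) z * (2 * pi) / (s n)\<^sup>2" for n z
  have Q_nonneg: "0 \<le> Q n z" for n z
    unfolding Q_def smoothed_def by (intro divide_nonneg_nonneg mult_nonneg_nonneg integral_nonneg_AE) auto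
  have Q_eq: "of_real (Q n z) =
      (\<integral>\<xi>. fourier \<mu> \<xi> * wave (- z) \<xi> * of_real (exp (- (norm (of_real (s n) * \<xi>))\<^sup>2 / 2)) \<partial>lborel)" for n z
  proof -
    have "complex_of_real (smoothed \<mu> (s n) z) =
        (\<integral>\<xi>. gauss2_density \<xi> *\<^sub>R (fourier \<mu> (\<xi> / of_real (s n)) * wave (- z) (\<xi> / of_real (s n))) \<partial>lborel)"
      unfolding smoothed_eq_fourier[OF \<mu>] gauss2_def
      by (subst integral_density) (auto simp: gauss2_density_nonneg)
    also have "\<dots> = of_real ((s n)\<^sup>2) * (\<integral>\<xi>. gauss2_density (of_real (s n) * \<xi>) *\<^sub>R
        (fourier \<mu> \<xi> * wave (- z) \<xi>) \<partial>lborel)"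
      using s(1)[of n] by (subst integral_lborel_affine[of _ "s n" 0]) (auto simp: scaleR_conv_of_real)
    finally have "complex_of_real (Q n z) = (2 * pi) * (\<integral>\<xi>. gauss2_density (of_real (s n) * \<xi>) *\<^sub>R
        (fourier \<mu> \<xi> * wave (- z) \<xi>) \<partial>lborel)"
      using s(1)[of n] by (simp add: Q_def field_simps)
    also have "\<dots> = (\<integral>\<xi>. (2 * pi) * gauss2_density (of_real (s n) * \<xi>) *\<^sub>R
        (fourier \<mu> \<xi> * wave (- z) \<xi>) \<partial>lborel)"
      by (subst integral_mult_right_zero[symmetric]) (simp add: mult.assoc)
    also have "\<dots> = (\<integral>\<xi>. fourier \<mu> \<xi> * wave (- z) \<xi> * of_real (exp (- (norm (of_real (s n) * \<xi>))\<^sup>2 / 2)) \<partial>lborel)"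
      by (intro Bochner_Integration.integral_cong refl) (simp add: gauss2_density_def scaleR_conv_of_real)
    finally show ?thesis .
  qed
  have intw: "integrable lborel (\<lambda>\<xi>. fourier \<mu> \<xi> * wave (- z) \<xi>)" for z
    by (rule Bochner_Integration.integrable_bound[OF int]) (auto simp: norm_mult)
  have lim: "(\<lambda>n. complex_of_real (Q n z)) \<longlonglongrightarrow> (\<integral>\<xi>. fourier \<mu> \<xi> * wave (- z) \<xi> \<partial>lborel)" for z
    unfolding Q_eq
  proof (rule integral_dominated_convergence[where w = "\<lambda>\<xi>. norm (fourier \<mu> \<xi>)"])
    have "(\<lambda>n. exp (- (norm (of_real (s n) * \<xi>))\<^sup>2 / 2)) \<longlonglongrightarrow> 1" for \<xi> :: complex
      by (rule tendsto_eq_intros s refl | simp)+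
    then have "(\<lambda>n. fourier \<mu> \<xi> * wave (- z) \<xi> * of_real (exp (- (norm (of_real (s n) * \<xi>))\<^sup>2 / 2)))
        \<longlonglongrightarrow> fourier \<mu> \<xi> * wave (- z) \<xi> * of_real 1" for \<xi>
      by (intro tendsto_intros)
    then show "AE \<xi> in lborel. (\<lambda>n. fourier \<mu> \<xi> * wave (- z) \<xi> * of_real (exp (- (norm (of_real (s n) * \<xi>))\<^sup>2 / 2)))
        \<longlonglongrightarrow> fourier \<mu> \<xi> * wave (- z) \<xi>" by simp
    fix n
    show "AE \<xi> in lborel. norm (fourier \<mu> \<xi> * wave (- z) \<xi> * of_real (exp (- (norm (of_real (s n) * \<xi>))\<^sup>2 / 2)))
        \<le> norm (fourier \<mu> \<xi>)"
      by (auto simp: norm_mult intro!: AE_I2 mult_left_le)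
  qed (use int in auto)
  then have limf: "(\<lambda>n. Q n z) \<longlonglongrightarrow> f z" for z
    unfolding f_def using tendsto_Re by fastforce
  show f_nonneg: "0 \<le> f z" for z
    by (rule LIMSEQ_le_const[OF limf]) (use Q_nonneg in auto)
  have f_le: "\<bar>f z\<bar> \<le> I" for z
    unfolding f_def I_def
    by (rule order_trans[OF abs_Re_le_cmod]) (rule order_trans[OF integral_norm_bound], simp add: norm_mult)
  have Q_le: "\<bar>Q n z\<bar> \<le> I" for n z
  proof -
    have "norm (complex_of_real (Q n z)) \<le> (\<integral>\<xi>. norm (fourier \<mu> \<xi>) \<partial>lborel)"
      unfolding Q_eq
      by (rule order_trans[OF integral_norm_bound], intro integral_mono_AE')
        (use int in \<open>auto simp: norm_mult intro!: mult_left_le AE_I2\<close>)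
    then show ?thesis by (simp add: I_def)
  qed
  have [measurable]: "f \<in> borel_measurable borel"
    unfolding f_def by measurable
  have [measurable]: "Q n \<in> borel_measurable borel" for n
    unfolding Q_def smoothed_def by measurable
  show "\<mu> = density lborel f"
  proof (rule measure_eqI_test_functions[OF \<mu>(2)])
    fix h assume h: "test_function h"
    then have [measurable]: "h \<in> borel_measurable borel" by measurable
    have "(\<lambda>n. (\<integral>z. h z * Q n z \<partial>lborel)) \<longlonglongrightarrow> (\<integral>z. h z * f z \<partial>lborel)"
    proof (rule integral_dominated_convergence[where w = "\<lambda>z. h z * I"])
      show "integrable lborel (\<lambda>z. h z * I)"
        by (rule test_function_integrable_mult[OF h, of _ "\<bar>I\<bar>"]) auto
      show "AE z in lborel. (\<lambda>n. h z * Q n z) \<longlonglongrightarrow> h z * f z"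
        by (intro AE_I2 tendsto_intros limf)
      show "AE z in lborel. norm (h z * Q n z) \<le> h z * I" for n
        using Q_le by (auto simp: abs_mult test_function_bounds[OF h] intro!: AE_I2 mult_left_mono)
    qed measurable
    then have eq: "(\<integral>z. h z * f z \<partial>lborel) = (\<integral>z. h z \<partial>\<mu>)"
      using smoothed_tendsto[OF \<mu> h s] unfolding Q_def by (rule LIMSEQ_unique)
    have "(\<integral>\<^sup>+z. ennreal (h z) \<partial>density lborel f) = (\<integral>\<^sup>+z. ennreal (h z * f z) \<partial>lborel)"
      by (subst nn_integral_density) (auto simp: f_nonneg test_function_bounds[OF h] ennreal_mult mult.commute)
    also have "\<dots> = ennreal (\<integral>z. h z * f z \<partial>lborel)"
      by (intro nn_integral_eq_integral test_function_integrable_mult[OF h _ f_le])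
        (auto simp: f_nonneg test_function_bounds[OF h])
    also have "\<dots> = ennreal (\<integral>z. h z \<partial>\<mu>)" by (simp add: eq)
    also have "\<dots> = (\<integral>\<^sup>+z. ennreal (h z) \<partial>\<mu>)"
      by (intro nn_integral_eq_integral[symmetric] M.integrable_const_bound[where B = 1])
        (auto simp: test_function_bounds[OF h])
    finally show "(\<integral>\<^sup>+z. ennreal (h z) \<partial>\<mu>) = (\<integral>\<^sup>+z. ennreal (h z) \<partial>density lborel f)" ..
  qed auto
qed

text \<open>A directional derivative is again an inverse Fourier integral, with an extra linear
  factor in \<xi> that uses up one weight. The exponent k + 1 leaves a second moment for the last
  derivative, where the Taylor remainder is estimated.\<close>

lemma C_k_inverse_fourier:
  fixes G :: "complex \<Rightarrow> complex"
  assumes [measurable]: "G \<in> borel_measurable borel"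
    and "integrable lborel (\<lambda>\<xi>. (1 + norm \<xi>) ^ (k + 1) * norm (G \<xi>))"
  shows "C_k k (\<lambda>z. Re (\<integral>\<xi>. G \<xi> * wave (- z) \<xi> \<partial>lborel))"
  using assms
proof (induction k arbitrary: G)
  case (0 G)
  note [measurable] = "0.prems"(1)
  have le1: "norm (G \<xi>) \<le> (1 + norm \<xi>) * norm (G \<xi>)" for \<xi>
    by (simp add: algebra_simps)
  have int: "integrable lborel (\<lambda>\<xi>. norm (G \<xi>))"
    by (rule Bochner_Integration.integrable_bound[OF "0.prems"(2)]) (use le1 in \<open>auto simp: abs_mult\<close>)
  have "continuous_on UNIV (\<lambda>z. \<integral>\<xi>. G \<xi> * wave (- z) \<xi> \<partial>lborel)"
  proof (rule continuous_on_sequentiallyI)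
    fix u :: "nat \<Rightarrow> complex" and a assume u: "u \<longlonglongrightarrow> a"
    show "(\<lambda>n. \<integral>\<xi>. G \<xi> * wave (- u n) \<xi> \<partial>lborel) \<longlonglongrightarrow> (\<integral>\<xi>. G \<xi> * wave (- a) \<xi> \<partial>lborel)"
    proof (rule integral_dominated_convergence[where w = "\<lambda>\<xi>. norm (G \<xi>)"])
      show "AE \<xi> in lborel. (\<lambda>n. G \<xi> * wave (- u n) \<xi>) \<longlonglongrightarrow> G \<xi> * wave (- a) \<xi>"
        unfolding wave_def by (intro AE_I2 tendsto_intros u)
    qed (use int in \<open>auto simp: norm_mult\<close>)
  qed
  then show ?case by (auto intro!: continuous_intros)
next
  case (Suc k G)
  note [measurable] = "Suc.prems"(1)
  let ?W = "\<lambda>j \<xi>. (1 + norm \<xi>) ^ j * norm (G \<xi>)"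
  have int: "integrable lborel (?W j)" if "j \<le> k + 2" for j
  proof (rule Bochner_Integration.integrable_bound[OF "Suc.prems"(2)])
    have "?W j \<xi> \<le> ?W (Suc k + 1) \<xi>" for \<xi>
      using that by (intro mult_right_mono power_increasing) auto
    then show "AE \<xi> in lborel. norm (?W j \<xi>) \<le> norm (?W (Suc k + 1) \<xi>)" by (simp add: abs_mult)
  qed measurable
  let ?F = "\<lambda>z. (\<integral>\<xi>. G \<xi> * wave (- z) \<xi> \<partial>lborel)"
  define G' where "G' v \<xi> = G \<xi> * (\<i> * of_real (- 2 * pi * Re (v * cnj \<xi>)))" for v \<xi>
  have [measurable]: "cnj \<in> borel_measurable borel"
    by (intro borel_measurable_continuous_onI continuous_intros)
  have [measurable]: "G' v \<in> borel_measurable borel" for v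
    unfolding G'_def by measurable
  have theta: "\<bar>- 2 * pi * Re (v * cnj \<xi>)\<bar> \<le> 2 * pi * norm v * (1 + norm \<xi>)" for v \<xi>
  proof -
    have "\<bar>Re (v * cnj \<xi>)\<bar> \<le> norm (v * cnj \<xi>)" by (rule abs_Re_le_cmod)
    also have "\<dots> \<le> norm v * (1 + norm \<xi>)" by (simp add: norm_mult mult_left_mono)
    finally show ?thesis by (simp add: abs_mult)
  qed
  have normG': "norm (G' v \<xi>) \<le> 2 * pi * norm v * ?W 1 \<xi>" for v \<xi>
    using mult_right_mono[OF theta[of v \<xi>], of "norm (G \<xi>)"]
    unfolding G'_def norm_mult norm_of_real norm_ii by (simp only: mult_ac) simp
  have intG': "integrable lborel (\<lambda>\<xi>. G' v \<xi> * wave (- z) \<xi>)" for v z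
    by (rule Bochner_Integration.integrable_bound[of _ "\<lambda>\<xi>. 2 * pi * norm v * ?W 1 \<xi>"])
      (use int[of 1] normG' in \<open>auto simp: norm_mult abs_mult\<close>)
  have intG: "integrable lborel (\<lambda>\<xi>. G \<xi> * wave (- z) \<xi>)" for z
    by (rule Bochner_Integration.integrable_bound[OF int[of 0]]) (auto simp: norm_mult)
  let ?D = "\<lambda>z v. (\<integral>\<xi>. G' v \<xi> * wave (- z) \<xi> \<partial>lborel)"
  have lin: "bounded_linear (?D z)" for z
  proof
    show "?D z (u + v) = ?D z u + ?D z v" for u v
    proof -
      have "G' (u + v) \<xi> * wave (- z) \<xi> = G' u \<xi> * wave (- z) \<xi> + G' v \<xi> * wave (- z) \<xi>" for \<xi>
        by (simp add: G'_def algebra_simps)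
      then show ?thesis using intG' by simp
    qed
    show "?D z (r *\<^sub>R v) = r *\<^sub>R ?D z v" for r v
      by (subst Bochner_Integration.integral_scaleR_right[symmetric])
        (auto intro!: Bochner_Integration.integral_cong simp: G'_def algebra_simps scaleR_conv_of_real)
    show "\<exists>K. \<forall>v. norm (?D z v) \<le> norm v * K"
    proof (intro exI allI)
      fix v
      have "norm (?D z v) \<le> (\<integral>\<xi>. 2 * pi * norm v * ?W 1 \<xi> \<partial>lborel)"
        by (rule order_trans[OF integral_norm_bound], intro integral_mono_AE')
          (use int[of 1] normG' in \<open>auto simp: norm_mult\<close>)
      also have "\<dots> = norm v * (2 * pi * (\<integral>\<xi>. ?W 1 \<xi> \<partial>lborel))" by simp
      finally show "norm (?D z v) \<le> norm v * (2 * pi * (\<integral>\<xi>. ?W 1 \<xi> \<partial>lborel))" .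
    qed
  qed
  define K where "K = 2 * pi\<^sup>2 * (\<integral>\<xi>. ?W 2 \<xi> \<partial>lborel)"
  \<comment> \<open>Differentiation under the integral is done by the explicit bound |exp(i t) - 1 -
    i t| <= t^2 / 2, with t linear in y - z, so the remainder is quadratic uniformly in the base
    point.\<close>
  have rem: "norm (?F y - ?F z - ?D z (y - z)) \<le> K * (norm (y - z))\<^sup>2" for y z
  proof -
    define v where "v = y - z"
    have pt: "norm (G \<xi> * wave (- y) \<xi> - G \<xi> * wave (- z) \<xi> - G' v \<xi> * wave (- z) \<xi>)
        \<le> 2 * pi\<^sup>2 * (norm v)\<^sup>2 * ?W 2 \<xi>" for \<xi>
    proof -
      let ?t = "- 2 * pi * Re (v * cnj \<xi>)"
      have "- y = - z + - v" by (simp add: v_def)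
      then have "wave (- y) \<xi> = wave (- z) \<xi> * iexp ?t"
        by (simp only: wave_add) (simp add: wave_iexp algebra_simps)
      then have "G \<xi> * wave (- y) \<xi> - G \<xi> * wave (- z) \<xi> - G' v \<xi> * wave (- z) \<xi>
          = G \<xi> * wave (- z) \<xi> * (iexp ?t - (\<Sum>k\<le>1. (\<i> * of_real ?t) ^ k / fact k))"
        by (simp add: G'_def algebra_simps)
      then have "norm (G \<xi> * wave (- y) \<xi> - G \<xi> * wave (- z) \<xi> - G' v \<xi> * wave (- z) \<xi>)
          \<le> norm (G \<xi>) * (\<bar>?t\<bar> ^ Suc 1 / fact (Suc 1))"
        using iexp_approx1[of ?t 1] by (simp add: norm_mult mult_left_mono)
      also have "\<dots> \<le> norm (G \<xi>) * ((2 * pi * norm v * (1 + norm \<xi>)) ^ 2 / 2)"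
        unfolding Suc_1 fact_2 by (intro mult_left_mono divide_right_mono power_mono theta) auto
      also have "\<dots> = 2 * pi\<^sup>2 * (norm v)\<^sup>2 * ?W 2 \<xi>" by (simp add: power_mult_distrib)
      finally show ?thesis .
    qed
    have "?F y - ?F z - ?D z v = (\<integral>\<xi>. G \<xi> * wave (- y) \<xi> - G \<xi> * wave (- z) \<xi> - G' v \<xi> * wave (- z) \<xi> \<partial>lborel)"
      using intG intG' by simp
    also have "norm \<dots> \<le> (\<integral>\<xi>. 2 * pi\<^sup>2 * (norm v)\<^sup>2 * ?W 2 \<xi> \<partial>lborel)"
      by (rule order_trans[OF integral_norm_bound], intro integral_mono_AE')
        (use int[of 2] pt in auto)
    also have "\<dots> = K * (norm v)\<^sup>2" by (simp add: K_def)
    finally show ?thesis by (simp add: v_def)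
  qed
  have der: "(?F has_derivative ?D z) (at z)" for z
  proof (rule has_derivativeI_sandwich[of 1 _ _ _ _ "\<lambda>y. K * norm (y - z)"])
    show "norm (?F y - ?F z - ?D z (y - z)) / norm (y - z) \<le> K * norm (y - z)" if "y \<noteq> z" for y
      using rem[of y z] that by (simp add: divide_le_eq power2_eq_square mult.assoc)
    have "((\<lambda>y. K * norm (y - z)) \<longlongrightarrow> K * norm (z - z)) (at z)" by (intro tendsto_intros)
    then show "((\<lambda>y. K * norm (y - z)) \<longlongrightarrow> 0) (at z)" by simp
  qed (use lin in auto)
  have derRe: "((\<lambda>z. Re (?F z)) has_derivative (\<lambda>v. Re (?D z v))) (at z)" for z
    by (rule bounded_linear.has_derivative[OF bounded_linear_Re der])
  have "C_k k (\<lambda>z. Re (?D z v))" for v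
  proof (rule Suc.IH)
    show "integrable lborel (\<lambda>\<xi>. (1 + norm \<xi>) ^ (k + 1) * norm (G' v \<xi>))"
    proof (rule Bochner_Integration.integrable_bound[of _ "\<lambda>\<xi>. 2 * pi * norm v * ?W (k + 2) \<xi>"])
      have "(1 + norm \<xi>) ^ (k + 1) * (2 * pi * norm v * ?W 1 \<xi>) = 2 * pi * norm v * ?W (k + 2) \<xi>" for \<xi>
        by (simp only: power_add power_one_right power2_eq_square mult_ac)
      then have "(1 + norm \<xi>) ^ (k + 1) * norm (G' v \<xi>) \<le> 2 * pi * norm v * ?W (k + 2) \<xi>" for \<xi>
        using mult_left_mono[OF normG'[of v \<xi>], of "(1 + norm \<xi>) ^ (k + 1)"] by (metis add_nonneg_nonneg norm_ge_zero zero_le_one zero_le_power)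
      then show "AE \<xi> in lborel. norm ((1 + norm \<xi>) ^ (k + 1) * norm (G' v \<xi>))
          \<le> norm (2 * pi * norm v * ?W (k + 2) \<xi>)" by (simp add: abs_mult)
    qed (use int[of "k + 2"] in auto)
  qed measurable
  then show ?case
    using derRe by (auto simp: differentiable_def frechet_derivative_at[OF derRe, symmetric])
qed

lemma integrable_inverse_1_plus_square_complex:
  "integrable lborel (\<lambda>\<xi>. inverse (1 + (Re \<xi>)\<^sup>2) * inverse (1 + (Im \<xi>)\<^sup>2))"
proof -
  have "einterval (-\<infinity>) \<infinity> = UNIV" by (auto simp: einterval_def)
  then have i: "integrable lborel (\<lambda>x::real. inverse (1 + x\<^sup>2))"
    using integrable_inverse_1_plus_square by (simp add: set_integrable_def)
  have "integrable (lborel \<Otimes>\<^sub>M lborel) (\<lambda>(x::real, y::real). inverse (1 + x\<^sup>2) * inverse (1 + y\<^sup>2))"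
    by (intro lborel_pair.Fubini_integrable) (use i in \<open>auto simp: abs_mult\<close>)
  then show ?thesis
    by (subst lborel_complex, subst integrable_distr_eq) (auto simp: case_prod_unfold)
qed

text \<open>The threshold k + 5 consists of the k + 1 weights for k derivatives and four more
  powers, which pay for the integrable majorant 1 / ((1 + Re^2) (1 + Im^2)).\<close>

lemma fourier_decay_imp_C_k_density:
  assumes \<mu>: "prob_space \<mu>" "sets \<mu> = sets borel"
    and C: "0 \<le> C" and decay: "fourier_decay \<mu> C \<gamma>" and \<gamma>: "real k + 5 \<le> \<gamma>"
  shows "has_C_k_density k \<mu>"
proof -
  have [measurable]: "fourier \<mu> \<in> borel_measurable borel" by (rule measurable_fourier[OF \<mu>])
  \<comment> \<open>The decay estimate is of no use near 0, where the trivial bound 1 replaces it;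
    in both ranges 1 + |\<xi>| is at most 2 max(1, |\<xi>|), whence the power of 2.\<close>
  define B where "B = 2 ^ (k + 5) * (C + 1)"
  have bound: "(1 + norm \<xi>) ^ (k + 5) * norm (fourier \<mu> \<xi>) \<le> B" for \<xi>
  proof (cases "norm \<xi> \<le> 1")
    case True
    then have "(1 + norm \<xi>) ^ (k + 5) * norm (fourier \<mu> \<xi>) \<le> 2 ^ (k + 5) * 1"
      by (intro mult_mono power_mono norm_fourier_le_1[OF \<mu>]) auto
    also have "\<dots> \<le> B" using C by (simp add: B_def)
    finally show ?thesis .
  next
    case False
    then have "\<xi> \<noteq> 0" by auto
    then have "norm (fourier \<mu> \<xi>) \<le> C * norm \<xi> powr (- \<gamma>)"
      using decay unfolding fourier_decay_def by blast
    also have "\<dots> \<le> C * norm \<xi> powr (- real (k + 5))"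
      using False \<gamma> C by (intro mult_left_mono powr_mono) auto
    finally have "(1 + norm \<xi>) ^ (k + 5) * norm (fourier \<mu> \<xi>) \<le>
        (2 * norm \<xi>) ^ (k + 5) * (C * norm \<xi> powr (- real (k + 5)))"
      using False by (intro mult_mono power_mono) auto
    also have "norm \<xi> powr (- real (k + 5)) = inverse (norm \<xi> ^ (k + 5))"
      using \<open>\<xi> \<noteq> 0\<close> unfolding powr_minus by (subst powr_realpow) auto
    also have "(2 * norm \<xi>) ^ (k + 5) * (C * inverse (norm \<xi> ^ (k + 5))) = 2 ^ (k + 5) * C"
      using \<open>\<xi> \<noteq> 0\<close> by (simp add: power_mult_distrib field_simps)
    also have "\<dots> \<le> B" by (simp add: B_def)
    finally show ?thesis .
  qed
  have int: "integrable lborel (\<lambda>\<xi>. (1 + norm \<xi>) ^ (k + 1) * norm (fourier \<mu> \<xi>))"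
  proof (rule Bochner_Integration.integrable_bound)
    show "integrable lborel (\<lambda>\<xi>. B * (inverse (1 + (Re \<xi>)\<^sup>2) * inverse (1 + (Im \<xi>)\<^sup>2)))"
      by (intro integrable_mult_right integrable_inverse_1_plus_square_complex)
    have "(1 + norm \<xi>) ^ (k + 1) * norm (fourier \<mu> \<xi>) \<le> B * (inverse (1 + (Re \<xi>)\<^sup>2) * inverse (1 + (Im \<xi>)\<^sup>2))" for \<xi>
    proof -
      have sq: "1 + x\<^sup>2 \<le> (1 + norm \<xi>)\<^sup>2" if "\<bar>x\<bar> \<le> norm \<xi>" for x
        using power_mono[OF that, of 2] by (simp add: power2_sum add_increasing2)
      have "(1 + (Re \<xi>)\<^sup>2) * (1 + (Im \<xi>)\<^sup>2) \<le> (1 + norm \<xi>)\<^sup>2 * (1 + norm \<xi>)\<^sup>2"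
        by (intro mult_mono sq abs_Re_le_cmod abs_Im_le_cmod) auto
      also have "\<dots> = (1 + norm \<xi>) ^ 4" by (simp flip: power_add)
      finally have "(1 + norm \<xi>) ^ (k + 1) * norm (fourier \<mu> \<xi>) * ((1 + (Re \<xi>)\<^sup>2) * (1 + (Im \<xi>)\<^sup>2))
          \<le> (1 + norm \<xi>) ^ (k + 1) * norm (fourier \<mu> \<xi>) * (1 + norm \<xi>) ^ 4"
        by (intro mult_left_mono) auto
      also have "\<dots> = (1 + norm \<xi>) ^ (k + 5) * norm (fourier \<mu> \<xi>)"
        by (simp add: power_add eval_nat_numeral mult_ac)
      also note bound
      finally have "(1 + norm \<xi>) ^ (k + 1) * norm (fourier \<mu> \<xi>) \<le> B / ((1 + (Re \<xi>)\<^sup>2) * (1 + (Im \<xi>)\<^sup>2))"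
        by (subst pos_le_divide_eq) (auto intro!: mult_pos_pos add_pos_nonneg)
      then show ?thesis by (simp add: divide_inverse)
    qed
    then show "AE \<xi> in lborel. norm ((1 + norm \<xi>) ^ (k + 1) * norm (fourier \<mu> \<xi>)) \<le>
        norm (B * (inverse (1 + (Re \<xi>)\<^sup>2) * inverse (1 + (Im \<xi>)\<^sup>2)))"
      using C by (intro AE_I2) (simp add: abs_mult B_def)
  qed measurable
  have intF: "integrable lborel (fourier \<mu>)"
  proof (rule Bochner_Integration.integrable_bound[OF int])
    have "1 * norm (fourier \<mu> \<xi>) \<le> (1 + norm \<xi>) ^ (k + 1) * norm (fourier \<mu> \<xi>)" for \<xi>
      by (intro mult_right_mono one_le_power) auto
    then show "AE \<xi> in lborel. norm (fourier \<mu> \<xi>) \<le> norm ((1 + norm \<xi>) ^ (k + 1) * norm (fourier \<mu> \<xi>))"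
      by (simp add: abs_mult)
  qed measurable
  define f where "f = (\<lambda>z. Re (\<integral>\<xi>. fourier \<mu> \<xi> * wave (- z) \<xi> \<partial>lborel))"
  have f: "\<And>z. 0 \<le> f z" "\<mu> = density lborel f"
    unfolding f_def using fourier_inversion[OF \<mu> intF] by auto
  have [measurable]: "f \<in> borel_measurable borel" unfolding f_def by measurable
  have "C_k k f" unfolding f_def by (rule C_k_inverse_fourier[OF _ int]) measurable
  moreover have "absolutely_continuous lborel \<mu>"
    unfolding f(2) by (rule absolutely_continuousI_density) measurable
  moreover have "AE z in lborel. ennreal (f z) = RN_deriv lborel \<mu> z"
    by (rule sigma_finite_measure.RN_deriv_unique[OF sigma_finite_lborel, OF _ f(2)[symmetric]]) measurable
  then have "AE z in lborel. RN_deriv lborel \<mu> z = ennreal (f z)"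
    by (rule eventually_mono) simp
  ultimately show ?thesis unfolding has_C_k_density_def using f(1) by blast
qed

section \<open>Self-similar measures and their Fourier transforms\<close>

locale ifs_weights =
  fixes \<Lambda> :: "'i set" and lam :: complex and a :: "'i \<Rightarrow> complex" and p :: "'i \<Rightarrow> real"
  assumes finite_index: "finite \<Lambda>" and weights: "p \<in> prob_vectors \<Lambda>" and contracting: "norm lam < 1"
begin

text \<open>The weights are arbitrary off \<Lambda> and have to be cut off there. As a
  \<open>pmf\<close> they can be fed into product measures and stream spaces.\<close>

definition index_pmf :: "'i pmf" where
  "index_pmf = embed_pmf (\<lambda>i. if i \<in> \<Lambda> then p i else 0)"

lemma p_pos: "i \<in> \<Lambda> \<Longrightarrow> 0 < p i" and sum_p: "(\<Sum>i\<in>\<Lambda>. p i) = 1"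
  using weights by (auto simp: prob_vectors_def)

lemma pmf_index: "pmf index_pmf i = (if i \<in> \<Lambda> then p i else 0)"
proof -
  have "(\<integral>\<^sup>+i. ennreal (if i \<in> \<Lambda> then p i else 0) \<partial>count_space UNIV) = (\<Sum>i\<in>\<Lambda>. ennreal (p i))"
    using finite_index p_pos by (subst nn_integral_count_space'[of \<Lambda>]) auto
  also have "\<dots> = 1" using p_pos sum_p by (simp add: less_imp_le)
  finally show ?thesis
    unfolding index_pmf_def using p_pos by (subst pmf_embed_pmf) (auto simp: less_imp_le)
qed

lemma set_index_pmf: "set_pmf index_pmf = \<Lambda>"
  using p_pos by (force simp: set_pmf_eq pmf_index split: if_splits)

lemma measurable_on_index [measurable]: "f \<in> borel_measurable (measure_pmf index_pmf)"
  by simp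

lemma emeasure_mixture:
  assumes "prob_space \<mu>" and [measurable_cong]: "sets \<mu> = sets borel" and [measurable]: "A \<in> sets borel"
  shows "emeasure (distr (measure_pmf index_pmf \<Otimes>\<^sub>M \<mu>) borel (\<lambda>(i, z). lam * z + a i)) A =
    (\<integral>\<^sup>+i. (\<integral>\<^sup>+z. indicator A (lam * z + a i) \<partial>\<mu>) \<partial>measure_pmf index_pmf)"
proof -
  interpret M: prob_space \<mu> by fact
  let ?\<nu> = "distr (measure_pmf index_pmf \<Otimes>\<^sub>M \<mu>) borel (\<lambda>(i, z). lam * z + a i)"
  have "emeasure ?\<nu> A = (\<integral>\<^sup>+z. indicator A z \<partial>?\<nu>)" by simp
  also have "\<dots> = (\<integral>\<^sup>+x. indicator A (case x of (i, z) \<Rightarrow> lam * z + a i) \<partial>(measure_pmf index_pmf \<Otimes>\<^sub>M \<mu>))"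
    by (rule nn_integral_distr) measurable
  also have "\<dots> = (\<integral>\<^sup>+i. (\<integral>\<^sup>+z. indicator A (lam * z + a i) \<partial>\<mu>) \<partial>measure_pmf index_pmf)"
    by (subst M.nn_integral_fst[symmetric]) auto
  finally show ?thesis .
qed

text \<open>The finite mixture of push-forwards is a single push-forward of the product of the index
  distribution with \<mu>, so that Fubini handles the sum over indices.\<close>

lemma is_self_similar_iff_distr:
  "is_self_similar_measure \<Lambda> lam a p \<mu> \<longleftrightarrow> prob_space \<mu> \<and> sets \<mu> = sets borel \<and>
     \<mu> = distr (measure_pmf index_pmf \<Otimes>\<^sub>M \<mu>) borel (\<lambda>(i, z). lam * z + a i)"
proof -
  have "emeasure (distr (measure_pmf index_pmf \<Otimes>\<^sub>M \<mu>) borel (\<lambda>(i, z). lam * z + a i)) A =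
      (\<Sum>i\<in>\<Lambda>. ennreal (p i) * emeasure (distr \<mu> borel (\<lambda>z. lam * z + a i)) A)"
    if "prob_space \<mu>" and [measurable_cong]: "sets \<mu> = sets borel" and [measurable]: "A \<in> sets borel" for A
  proof -
    interpret M: prob_space \<mu> by fact
    have "(\<integral>\<^sup>+z. indicator A (lam * z + a i) \<partial>\<mu>) = emeasure (distr \<mu> borel (\<lambda>z. lam * z + a i)) A" for i
    proof -
      have "(\<integral>\<^sup>+z. indicator A z \<partial>distr \<mu> borel (\<lambda>z. lam * z + a i)) = (\<integral>\<^sup>+z. indicator A (lam * z + a i) \<partial>\<mu>)"
        by (rule nn_integral_distr) measurable
      then show ?thesis by simp
    qed
    then have "emeasure (distr (measure_pmf index_pmf \<Otimes>\<^sub>M \<mu>) borel (\<lambda>(i, z). lam * z + a i)) A =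
        (\<integral>\<^sup>+i. emeasure (distr \<mu> borel (\<lambda>z. lam * z + a i)) A \<partial>measure_pmf index_pmf)"
      by (simp add: emeasure_mixture[OF that])
    also have "\<dots> = (\<Sum>i\<in>\<Lambda>. emeasure (distr \<mu> borel (\<lambda>z. lam * z + a i)) A * ennreal (pmf index_pmf i))"
      by (subst nn_integral_measure_pmf_finite) (auto simp: set_index_pmf finite_index)
    also have "\<dots> = (\<Sum>i\<in>\<Lambda>. ennreal (p i) * emeasure (distr \<mu> borel (\<lambda>z. lam * z + a i)) A)"
      by (intro sum.cong refl) (simp add: pmf_index mult.commute)
    finally show ?thesis .
  qed
  note eq = this
  show ?thesis
  proof (cases "prob_space \<mu> \<and> sets \<mu> = sets borel")
    case True
    then have "\<mu> = distr (measure_pmf index_pmf \<Otimes>\<^sub>M \<mu>) borel (\<lambda>(i, z). lam * z + a i) \<longleftrightarrow>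
        (\<forall>A\<in>sets borel. emeasure \<mu> A = (\<Sum>i\<in>\<Lambda>. ennreal (p i) * emeasure (distr \<mu> borel (\<lambda>z. lam * z + a i)) A))"
      using eq by (metis (no_types, lifting) measure_eqI sets_distr)
    then show ?thesis using True unfolding is_self_similar_measure_def by blast
  qed (auto simp: is_self_similar_measure_def)
qed

text \<open>The self-similar measure is the law of this series in independent digits with distribution \<open>p\<close>.\<close>

definition digit :: "'i \<Rightarrow> complex" where
  "digit i = (if i \<in> \<Lambda> then a i else 0)"

definition coding :: "'i stream \<Rightarrow> complex" where
  "coding \<omega> = (\<Sum>n. lam ^ n * digit (\<omega> !! n))"

lemma measurable_coding [measurable]: "coding \<in> borel_measurable (stream_space (measure_pmf index_pmf))"
proof -
  have [measurable]: "(\<lambda>\<omega>. \<omega> !! n) \<in> stream_space (measure_pmf index_pmf) \<rightarrow>\<^sub>M measure_pmf index_pmf" for n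
    by (rule measurable_snth)
  show ?thesis unfolding coding_def[abs_def] by measurable
qed

text \<open>The value 0 of \<open>digit\<close> off \<Lambda> bounds all digits at once: the series
  converges for every stream, and no null set has to be carried along.\<close>

lemma summable_coding: "summable (\<lambda>n. lam ^ n * digit (\<omega> !! n))"
proof (rule summable_norm_cancel, rule summable_comparison_test')
  show "summable (\<lambda>n. norm lam ^ n * (\<Sum>i\<in>\<Lambda>. norm (a i)))"
    using contracting by (intro summable_mult2 summable_geometric) auto
  have "norm (digit i) \<le> (\<Sum>i\<in>\<Lambda>. norm (a i))" for i
    using finite_index by (cases "i \<in> \<Lambda>") (auto simp: digit_def sum_nonneg intro!: member_le_sum)
  then show "norm (norm (lam ^ n * digit (\<omega> !! n))) \<le> norm lam ^ n * (\<Sum>i\<in>\<Lambda>. norm (a i))" for n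
    by (simp add: norm_mult norm_power mult_left_mono)
qed

lemma coding_Stream: "i \<in> \<Lambda> \<Longrightarrow> coding (i ## \<omega>) = lam * coding \<omega> + a i"
  using suminf_split_head[OF summable_coding[of "i ## \<omega>"]] suminf_mult[OF summable_coding[of \<omega>], of lam]
  by (simp add: coding_def digit_def[of i] mult.assoc diff_eq_eq)

text \<open>A random stream is an independent first letter followed by a stream of the same law, and
  \<open>coding_Stream\<close> is the affine map attached to that letter. Letters outside \<Lambda>
  have probability 0.\<close>

lemma is_self_similar_coding:
  "is_self_similar_measure \<Lambda> lam a p (distr (stream_space (measure_pmf index_pmf)) borel coding)"
proof -
  let ?S = "stream_space (measure_pmf index_pmf)"
  interpret P: prob_space ?S by (rule prob_space.prob_space_stream_space[OF measure_pmf.prob_space_axioms])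
  let ?\<mu> = "distr ?S borel coding"
  interpret M: prob_space ?\<mu> by (rule P.prob_space_distr) measurable
  have "?\<mu> = distr (measure_pmf index_pmf \<Otimes>\<^sub>M ?\<mu>) borel (\<lambda>(i, z). lam * z + a i)"
  proof (rule measure_eqI)
    fix A assume "A \<in> sets ?\<mu>"
    then have [measurable]: "A \<in> sets borel" by simp
    have "emeasure ?\<mu> A = (\<integral>\<^sup>+\<omega>. indicator A (coding \<omega>) \<partial>?S)"
    proof -
      have "emeasure ?\<mu> A = (\<integral>\<^sup>+z. indicator A z \<partial>?\<mu>)" by simp
      also have "\<dots> = (\<integral>\<^sup>+\<omega>. indicator A (coding \<omega>) \<partial>?S)" by (rule nn_integral_distr) measurable
      finally show ?thesis .
    qed
    also have "\<dots> = (\<integral>\<^sup>+i. (\<integral>\<^sup>+\<omega>. indicator A (coding (i ## \<omega>)) \<partial>?S) \<partial>measure_pmf index_pmf)"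
      by (rule prob_space.nn_integral_stream_space[OF measure_pmf.prob_space_axioms]) measurable
    also have "\<dots> = (\<integral>\<^sup>+i. (\<integral>\<^sup>+\<omega>. indicator A (lam * coding \<omega> + a i) \<partial>?S) \<partial>measure_pmf index_pmf)"
      by (intro nn_integral_cong_AE) (auto simp: AE_measure_pmf_iff set_index_pmf coding_Stream)
    also have "\<dots> = (\<integral>\<^sup>+i. (\<integral>\<^sup>+z. indicator A (lam * z + a i) \<partial>?\<mu>) \<partial>measure_pmf index_pmf)"
      by (subst nn_integral_distr) auto
    also have "\<dots> = emeasure (distr (measure_pmf index_pmf \<Otimes>\<^sub>M ?\<mu>) borel (\<lambda>(i, z). lam * z + a i)) A"
      by (rule emeasure_mixture[symmetric]) (auto intro: M.prob_space_axioms)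
    finally show "emeasure ?\<mu> A = emeasure (distr (measure_pmf index_pmf \<Otimes>\<^sub>M ?\<mu>) borel (\<lambda>(i, z). lam * z + a i)) A" .
  qed simp
  then show ?thesis
    unfolding is_self_similar_iff_distr using M.prob_space_axioms by simp
qed

text \<open>The Fourier transform of the digit distribution. It does not involve \<open>lam\<close>,
  so bounds on it are uniform in the contraction.\<close>

definition mask :: "complex \<Rightarrow> complex" where
  "mask \<xi> = (\<Sum>i\<in>\<Lambda>. of_real (p i) * wave (a i) \<xi>)"

lemma fourier_self_similar:
  assumes "is_self_similar_measure \<Lambda> lam a p \<mu>"
  shows "fourier \<mu> \<xi> = mask \<xi> * fourier \<mu> (cnj lam * \<xi>)"
proof -
  have \<mu>: "prob_space \<mu>" "sets \<mu> = sets borel"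
    "\<mu> = distr (measure_pmf index_pmf \<Otimes>\<^sub>M \<mu>) borel (\<lambda>(i, z). lam * z + a i)"
    using assms unfolding is_self_similar_iff_distr by auto
  note [measurable_cong] = \<mu>(2)
  interpret M: prob_space \<mu> by fact
  interpret P: pair_prob_space "measure_pmf index_pmf" \<mu> ..
  have "fourier \<mu> \<xi> = (\<integral>x. wave (lam * snd x + a (fst x)) \<xi> \<partial>(measure_pmf index_pmf \<Otimes>\<^sub>M \<mu>))"
    unfolding fourier_wave by (subst \<mu>(3), subst integral_distr) (auto simp: case_prod_unfold)
  also have "\<dots> = (\<integral>i. (\<integral>z. wave (lam * z + a i) \<xi> \<partial>\<mu>) \<partial>measure_pmf index_pmf)"
    by (subst P.integral_fst'[symmetric]) (auto intro!: P.P.integrable_wave)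
  also have "\<dots> = (\<Sum>i\<in>\<Lambda>. p i *\<^sub>R (\<integral>z. wave (lam * z + a i) \<xi> \<partial>\<mu>))"
    by (subst integral_measure_pmf[OF finite_index]) (auto simp: set_index_pmf pmf_index)
  also have "\<dots> = mask \<xi> * fourier \<mu> (cnj lam * \<xi>)"
  proof -
    have "wave (lam * z + a i) \<xi> = wave z (cnj lam * \<xi>) * wave (a i) \<xi>" for z i
      by (simp only: wave_add wave_mult)
    then show ?thesis
      unfolding mask_def fourier_wave sum_distrib_right by (simp add: scaleR_conv_of_real mult_ac)
  qed
  finally show ?thesis .
qed

lemma fourier_self_similar_prod:
  assumes "is_self_similar_measure \<Lambda> lam a p \<mu>"
  shows "fourier \<mu> \<xi> = (\<Prod>n<N. mask (cnj lam ^ n * \<xi>)) * fourier \<mu> (cnj lam ^ N * \<xi>)"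
proof (induction N)
  case (Suc N)
  then show ?case
    using fourier_self_similar[OF assms, of "cnj lam ^ N * \<xi>"] by (simp add: mult_ac)
qed simp

lemma norm_mask_le_1: "norm (mask \<xi>) \<le> 1"
proof -
  have "norm (mask \<xi>) \<le> (\<Sum>i\<in>\<Lambda>. norm (of_real (p i) * wave (a i) \<xi>))"
    unfolding mask_def by (rule norm_sum)
  also have "\<dots> = 1" using p_pos by (simp add: norm_mult less_imp_le sum_p)
  finally show ?thesis .
qed

text \<open>Both transforms satisfy the same product formula with factors of modulus at most 1, so
  their difference at \<xi> is at most the difference at \<open>cnj lam ^ N * \<xi>\<close>. There
  both tend to 1.\<close>

lemma self_similar_unique:
  assumes "is_self_similar_measure \<Lambda> lam a p \<mu>" "is_self_similar_measure \<Lambda> lam a p \<nu>"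
  shows "\<mu> = \<nu>"
proof (rule fourier_unique)
  show \<mu>: "prob_space \<mu>" "sets \<mu> = sets borel" and \<nu>: "prob_space \<nu>" "sets \<nu> = sets borel"
    using assms by (auto simp: is_self_similar_measure_def)
  have lim: "(\<lambda>N. fourier \<mu> (cnj lam ^ N * \<xi>)) \<longlonglongrightarrow> 1"
    if "prob_space \<mu>" "sets \<mu> = sets borel" for \<mu> \<xi>
  proof -
    interpret prob_space \<mu> by fact
    note [measurable_cong] = that(2)
    have "(\<lambda>N. \<integral>z. wave z (cnj lam ^ N * \<xi>) \<partial>\<mu>) \<longlonglongrightarrow> (\<integral>z. 1 \<partial>\<mu>)"
    proof (rule integral_dominated_convergence[where w = "\<lambda>_. 1"])
      have "(\<lambda>N. cnj lam ^ N * \<xi>) \<longlonglongrightarrow> 0"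
        using contracting by (intro tendsto_mult_left_zero LIMSEQ_power_zero) simp
      then have "(\<lambda>N. wave z (cnj lam ^ N * \<xi>)) \<longlonglongrightarrow> wave z 0" for z
        using continuous_wave[of z]
        by (intro isCont_tendsto_compose[of 0 "wave z"]) (auto simp: continuous_on_eq_continuous_at)
      then show "AE z in \<mu>. (\<lambda>N. wave z (cnj lam ^ N * \<xi>)) \<longlonglongrightarrow> 1" by simp
    qed auto
    then show ?thesis by (simp add: fourier_wave prob_space)
  qed
  show "fourier \<mu> = fourier \<nu>"
  proof
    fix \<xi>
    have "norm (fourier \<mu> \<xi> - fourier \<nu> \<xi>) \<le> norm (fourier \<mu> (cnj lam ^ N * \<xi>) - fourier \<nu> (cnj lam ^ N * \<xi>))" for N
    proof -
      have "fourier \<mu> \<xi> - fourier \<nu> \<xi> = (\<Prod>n<N. mask (cnj lam ^ n * \<xi>)) *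
          (fourier \<mu> (cnj lam ^ N * \<xi>) - fourier \<nu> (cnj lam ^ N * \<xi>))"
        using fourier_self_similar_prod[OF assms(1), of \<xi> N] fourier_self_similar_prod[OF assms(2), of \<xi> N]
        by (simp add: algebra_simps)
      moreover have "norm (\<Prod>n<N. mask (cnj lam ^ n * \<xi>)) \<le> 1"
        by (simp add: prod_norm[symmetric] norm_mask_le_1 prod_le_1)
      ultimately show ?thesis by (simp add: norm_mult mult_left_le_one_le)
    qed
    moreover have "(\<lambda>N. norm (fourier \<mu> (cnj lam ^ N * \<xi>) - fourier \<nu> (cnj lam ^ N * \<xi>))) \<longlonglongrightarrow> norm (1 - 1 :: complex)"
      by (intro tendsto_intros lim \<mu> \<nu>)
    ultimately have "norm (fourier \<mu> \<xi> - fourier \<nu> \<xi>) \<le> norm (1 - 1 :: complex)"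
      by (intro LIMSEQ_le_const) auto
    then show "fourier \<mu> \<xi> = fourier \<nu> \<xi>" by simp
  qed
qed

abbreviation ssm :: "complex measure" where
  "ssm \<equiv> self_similar_measure \<Lambda> lam a p"

lemma ssm_self_similar: "is_self_similar_measure \<Lambda> lam a p ssm"
  unfolding self_similar_measure_def
  by (rule theI[where P = "is_self_similar_measure \<Lambda> lam a p", OF is_self_similar_coding]) (rule self_similar_unique[OF _ is_self_similar_coding])

lemma ssm_prob: "prob_space ssm" and ssm_sets: "sets ssm = sets borel"
  using ssm_self_similar by (auto simp: is_self_similar_measure_def)

lemma norm_fourier_ssm_le: "norm (fourier ssm \<xi>) \<le> (\<Prod>n<N. norm (mask (cnj lam ^ n * \<xi>)))"
  unfolding fourier_self_similar_prod[OF ssm_self_similar, of \<xi> N] norm_mult prod_norm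
  using norm_fourier_le_1[OF ssm_prob ssm_sets] by (intro mult_left_le) auto

text \<open>Two summands of the mask are out of phase when \<open>Re ((a j - a i) * cnj \<xi>)\<close> is away from the integers.\<close>

lemma norm_mask_le:
  assumes i: "i \<in> \<Lambda>" "j \<in> \<Lambda>" "i \<noteq> j" and \<rho>: "0 < \<rho>"
  shows "\<exists>q. 0 < q \<and> q < 1 \<and> (\<forall>\<xi>. \<rho> \<le> \<bar>Re ((a j - a i) * cnj \<xi>) - round (Re ((a j - a i) * cnj \<xi>))\<bar>
    \<longrightarrow> norm (mask \<xi>) \<le> q)"
proof -
  \<comment> \<open>A distance to the nearest integer is at most 1/2. The cap keeps 2 pi \<rho>' in
    [0, pi], where the cosine decreases.\<close>
  define \<rho>' where "\<rho>' = min \<rho> (1/2)"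
  have \<rho>': "0 < \<rho>'" "\<rho>' \<le> 1/2" "\<rho>' \<le> \<rho>" using \<rho> by (auto simp: \<rho>'_def)
  \<comment> \<open>By the law of cosines \<open>r\<close> is the modulus of p_i + p_j exp(2 pi i
    \<rho>'), the largest value two summands can reach when \<rho>' out of phase. The maximum with
    1/2 in \<open>q\<close> secures positivity, since 1 - p_i - p_j + r may vanish.\<close>
  define r where "r = sqrt ((p i + p j)\<^sup>2 - 2 * p i * p j * (1 - cos (2 * pi * \<rho>')))"
  define q where "q = max (1/2) (1 - p i - p j + r)"
  have "cos (2 * pi * \<rho>') < cos 0"
    using \<rho>' by (intro cos_monotone_0_pi) (auto simp: field_simps)
  then have "r < p i + p j"
    unfolding r_def using p_pos[OF i(1)] p_pos[OF i(2)] by (intro real_less_lsqrt) auto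
  then have q: "0 < q" "q < 1" by (auto simp: q_def)
  have "norm (mask \<xi>) \<le> q" if far: "\<rho> \<le> \<bar>Re ((a j - a i) * cnj \<xi>) - round (Re ((a j - a i) * cnj \<xi>))\<bar>" for \<xi>
  proof -
    define y where "y = Re ((a j - a i) * cnj \<xi>)"
    define d where "d = \<bar>y - round y\<bar>"
    have d: "\<rho>' \<le> d" "d \<le> 1/2"
      using far \<rho>'(3) of_int_round_abs_le[of y] by (auto simp: d_def y_def abs_minus_commute)
    have "cos (2 * pi * y) = cos (2 * pi * y - 2 * pi * real_of_int (round y))"
      by (simp add: cos_diff)
    also have "\<dots> = cos (2 * pi * (y - real_of_int (round y)))" by (simp add: algebra_simps)
    also have "\<dots> = cos (2 * pi * d)" 
    proof (cases "0 \<le> y - real_of_int (round y)")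
      case False
      then have "d = - (y - real_of_int (round y))" by (simp add: d_def)
      then have "2 * pi * d = - (2 * pi * (y - real_of_int (round y)))"
        by (simp only: mult_minus_right)
      then show ?thesis by (simp only: cos_minus)
    qed (simp add: d_def)
    also have "\<dots> \<le> cos (2 * pi * \<rho>')"
      using d \<rho>' by (intro cos_monotone_0_pi_le) (auto simp: field_simps)
    finally have cos: "cos (2 * pi * y) \<le> cos (2 * pi * \<rho>')" .
    have "wave (a j) \<xi> = wave (a i) \<xi> * iexp (2 * pi * y)"
      using wave_add[of "a i" "a j - a i" \<xi>] by (simp add: wave_iexp y_def)
    then have "of_real (p i) * wave (a i) \<xi> + of_real (p j) * wave (a j) \<xi> =
        wave (a i) \<xi> * (of_real (p i) + of_real (p j) * iexp (2 * pi * y))" by (simp add: algebra_simps)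
    then have "norm (of_real (p i) * wave (a i) \<xi> + of_real (p j) * wave (a j) \<xi>) =
        norm (of_real (p i) + of_real (p j) * iexp (2 * pi * y))" by (simp add: norm_mult)
    also have "\<dots> = sqrt ((p i + p j)\<^sup>2 - 2 * p i * p j * (1 - cos (2 * pi * y)))"
    proof -
      have "(p i + p j * cos t)\<^sup>2 + (p j * sin t)\<^sup>2 = (p i + p j)\<^sup>2 - 2 * p i * p j * (1 - cos t)" for t
        by (simp add: power_mult_distrib sin_squared_eq) (simp add: power2_eq_square algebra_simps)
      then show ?thesis by (simp add: cmod_def Re_exp Im_exp)
    qed
    also have "\<dots> \<le> r"
      unfolding r_def using p_pos[OF i(1)] p_pos[OF i(2)] cos
      by (intro real_sqrt_le_mono diff_left_mono mult_left_mono) auto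
    finally have two: "norm (of_real (p i) * wave (a i) \<xi> + of_real (p j) * wave (a j) \<xi>) \<le> r" .
    have split: "(\<Sum>k\<in>\<Lambda>. f k) = f i + f j + (\<Sum>k\<in>\<Lambda> - {i, j}. f k)" for f :: "'i \<Rightarrow> 'z::ab_group_add"
    proof -
      have "(\<Sum>k\<in>\<Lambda>. f k) = (\<Sum>k\<in>{i, j}. f k) + (\<Sum>k\<in>\<Lambda> - {i, j}. f k)"
        using finite_index i by (subst sum.subset_diff[of "{i, j}"]) (auto simp: add.commute)
      then show ?thesis using i by simp
    qed
    have "norm (mask \<xi>) \<le> norm (of_real (p i) * wave (a i) \<xi> + of_real (p j) * wave (a j) \<xi>) +
        norm (\<Sum>k\<in>\<Lambda> - {i, j}. of_real (p k) * wave (a k) \<xi>)"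
      unfolding mask_def split by (rule norm_triangle_ineq)
    also have "norm (\<Sum>k\<in>\<Lambda> - {i, j}. of_real (p k) * wave (a k) \<xi>) \<le> (\<Sum>k\<in>\<Lambda> - {i, j}. p k)"
      using p_pos by (intro sum_norm_le) (auto simp: norm_mult less_imp_le)
    also have "(\<Sum>k\<in>\<Lambda> - {i, j}. p k) = 1 - p i - p j"
      using sum_p split[of p] by simp
    finally show ?thesis using two by (simp add: q_def)
  qed
  then show ?thesis using q by blast
qed

end

section \<open>Sets of Hausdorff measure zero\<close>

(* its premise "suminf \<noteq> top" contains the redex, so the simplifier loops *)
declare suminf_ennreal [simp del]

text \<open>The mesh condition is automatic: a total weight of at most \<delta> powr s forces every
  single diameter below \<delta>. Null sets can thus be treated without the limit over
  meshes.\<close>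

lemma hausdorff_null_iff:
  fixes A :: "'a::metric_space set"
  assumes s: "0 < s"
  shows "hausdorff_measure s A = 0 \<longleftrightarrow>
    (\<forall>e>0. \<exists>U. (\<forall>i. bounded (U i)) \<and> A \<subseteq> (\<Union>i. U i) \<and>
       (\<Sum>i::nat. ennreal (diameter (U i) powr s)) \<le> ennreal e)" (is "?L \<longleftrightarrow> ?R")
proof -
  have w: "hausdorff_weight s U = ennreal (diameter U powr s)" for U :: "'a set"
    using s by (auto simp: hausdorff_weight_def)
  show ?thesis
  proof
    assume L: ?L
    show ?R
    proof (intro allI impI)
      fix e :: real assume "0 < e"
      have "hausdorff_premeasure s 1 A \<le> hausdorff_measure s A"
        unfolding hausdorff_measure_def by (rule SUP_upper) auto
      then have "hausdorff_premeasure s 1 A < ennreal e"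
        using L \<open>0 < e\<close> by (auto simp: ennreal_less_zero_iff)
      then show "\<exists>U. (\<forall>i. bounded (U i)) \<and> A \<subseteq> (\<Union>i. U i) \<and>
          (\<Sum>i::nat. ennreal (diameter (U i) powr s)) \<le> ennreal e"
        unfolding hausdorff_premeasure_def INF_less_iff w by (force simp: w)
    qed
  next
    assume R: ?R
    have "hausdorff_premeasure s \<delta> A \<le> ennreal e" if "0 < \<delta>" "0 < e" for \<delta> e
    proof -
      define e' where "e' = min e (\<delta> powr s)"
      have "0 < e'" using that by (simp add: e'_def)
      then obtain U :: "nat \<Rightarrow> 'a set" where U: "\<And>i. bounded (U i)" "A \<subseteq> (\<Union>i. U i)"
        "(\<Sum>i. ennreal (diameter (U i) powr s)) \<le> ennreal e'"
        using R[rule_format, of e'] by blast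
      have "diameter (U i) \<le> \<delta>" for i
      proof -
        have "ennreal (diameter (U i) powr s) \<le> (\<Sum>i. ennreal (diameter (U i) powr s))"
          using sum_le_suminf[OF summableI, of "{i}" "\<lambda>i. ennreal (diameter (U i) powr s)"]
          by (auto simp del: ennreal_le_iff)
        also have "\<dots> \<le> ennreal (\<delta> powr s)"
          using U(3) by (rule order_trans) (simp add: e'_def)
        finally have "diameter (U i) powr s \<le> \<delta> powr s"
          by (simp add: ennreal_le_iff)
        then show ?thesis
          using powr_less_mono2[of s \<delta> "diameter (U i)"] s that by force
      qed
      then have "hausdorff_premeasure s \<delta> A \<le> (\<Sum>i. ennreal (diameter (U i) powr s))"
        unfolding hausdorff_premeasure_def using U by (intro INF_lower2[of U]) (auto simp: w)
      also have "\<dots> \<le> ennreal e"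
        using U(3) by (rule order_trans) (simp add: e'_def ennreal_leI)
      finally show ?thesis .
    qed
    then have "hausdorff_premeasure s \<delta> A = 0" if "0 < \<delta>" for \<delta>
      using that by (metis ennreal_le_epsilon add_0 le_zero_eq)
    then show ?L by (simp add: hausdorff_measure_def)
  qed
qed

lemma hausdorff_null_double_cover:
  fixes A :: "'a::metric_space set"
  assumes s: "0 < s"
    and cover: "\<And>e. 0 < e \<Longrightarrow> \<exists>U. (\<forall>m n. bounded (U m n)) \<and> A \<subseteq> (\<Union>m n. U m n) \<and>
       (\<Sum>m. \<Sum>n. ennreal (diameter (U m n :: 'a set) powr s)) \<le> ennreal e"
  shows "hausdorff_measure s A = 0"
  unfolding hausdorff_null_iff[OF s]
proof (intro allI impI)
  fix e :: real assume "0 < e"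
  from cover[OF this] obtain U where U: "\<And>m n. bounded (U m n)" "A \<subseteq> (\<Union>m n. U m n)"
    "(\<Sum>m. \<Sum>n. ennreal (diameter (U m n) powr s)) \<le> ennreal e" by blast
  let ?V = "\<lambda>i. case_prod U (prod_decode i)"
  have "(\<Sum>i. ennreal (diameter (?V i) powr s)) = (\<Sum>m. \<Sum>n. ennreal (diameter (U m n) powr s))"
    by (rule suminf_ennreal_2dimen[of _ "\<lambda>p. ennreal (diameter (case_prod U p) powr s)"]) simp
  moreover have "A \<subseteq> (\<Union>i. ?V i)"
  proof
    fix x assume "x \<in> A"
    then obtain m n where "x \<in> U m n" using U by auto
    then show "x \<in> (\<Union>i. ?V i)" by (auto intro!: exI[of _ "prod_encode (m, n)"])
  qed
  ultimately show "\<exists>V. (\<forall>i. bounded (V i)) \<and> A \<subseteq> (\<Union>i. V i) \<and>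
      (\<Sum>i. ennreal (diameter (V i) powr s)) \<le> ennreal e"
    using U by (intro exI[of _ ?V]) (auto split: prod.split)
qed

lemma hausdorff_null_subset:
  assumes "0 < s" "hausdorff_measure s B = 0" "A \<subseteq> B"
  shows "hausdorff_measure s A = 0"
  using assms(2,3) unfolding hausdorff_null_iff[OF assms(1)] by (meson order_trans)

lemma hausdorff_null_UN:
  fixes A :: "nat \<Rightarrow> 'a::metric_space set"
  assumes s: "0 < s" and A: "\<And>m. hausdorff_measure s (A m) = 0"
  shows "hausdorff_measure s (\<Union>m. A m) = 0"
proof (rule hausdorff_null_double_cover[OF s])
  fix e :: real assume e: "0 < e"
  have "\<exists>U. (\<forall>i. bounded (U i)) \<and> A m \<subseteq> (\<Union>i. U i) \<and>
      (\<Sum>i. ennreal (diameter (U i) powr s)) \<le> ennreal (e * (1/2) ^ Suc m)" for m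
    using A[of m] e unfolding hausdorff_null_iff[OF s] by (simp add: zero_less_divide_iff)
  then obtain U where U: "\<And>m i. bounded (U m i)" "\<And>m. A m \<subseteq> (\<Union>i. U m i)"
      "\<And>m. (\<Sum>i. ennreal (diameter (U m i) powr s)) \<le> ennreal (e * (1/2) ^ Suc m)"
    by metis
  have "(\<Sum>m. \<Sum>i. ennreal (diameter (U m i) powr s)) \<le> (\<Sum>m. ennreal (e * (1/2) ^ Suc m))"
    by (intro suminf_le U) auto
  also have "\<dots> = ennreal e"
    using e sums_mult[OF power_half_series, of e] by (intro suminf_ennreal_eq) auto
  finally show "\<exists>U. (\<forall>m n. bounded (U m n)) \<and> (\<Union>m. A m) \<subseteq> (\<Union>m n. U m n) \<and>
       (\<Sum>m. \<Sum>n. ennreal (diameter (U m n) powr s)) \<le> ennreal e"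
    using U by (intro exI[of _ U] conjI) (fast | auto)+
qed

lemma hausdorff_null_countable_UN:
  assumes "0 < s" "countable I" "\<And>i. i \<in> I \<Longrightarrow> hausdorff_measure s (A i) = 0"
  shows "hausdorff_measure s (\<Union>i\<in>I. A i) = 0"
proof (cases "I = {}")
  case True
  then show ?thesis
    using hausdorff_null_iff[OF assms(1), of "{}"] by (auto intro!: exI[of _ "\<lambda>_. {}"])
next
  case False
  then have "hausdorff_measure s (\<Union>m. A (from_nat_into I m)) = 0"
    by (intro hausdorff_null_UN assms from_nat_into)
  then show ?thesis
    using hausdorff_null_subset[OF assms(1)] subset_range_from_nat_into[OF assms(2)]
    by (smt (verit) UN_iff image_iff subsetD subsetI)
qed

lemma hausdorff_null_Un:
  assumes "0 < s" "hausdorff_measure s A = 0" "hausdorff_measure s B = 0"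
  shows "hausdorff_measure s (A \<union> B) = 0"
  using hausdorff_null_countable_UN[of s "{A, B}" "\<lambda>X. X"] assms by auto

lemma diameter_le_dist:
  fixes S :: "'a::metric_space set"
  assumes "0 \<le> d" "\<And>x y. x \<in> S \<Longrightarrow> y \<in> S \<Longrightarrow> dist x y \<le> d"
  shows "diameter S \<le> d"
  using assms by (auto simp: diameter_def intro!: cSUP_least)

text \<open>Covers of \<open>B\<close> are pulled back to covers of \<open>S\<close>. The hypothesis
  is a Lipschitz bound for the inverse, so diameters grow at most by a constant factor.\<close>

lemma hausdorff_null_expanding_preimage:
  fixes f :: "'a::metric_space \<Rightarrow> 'b::metric_space"
  assumes s: "0 < s" and B: "hausdorff_measure s B = 0" and f: "f ` S \<subseteq> B"
    and c: "0 \<le> c" "\<And>x y. x \<in> S \<Longrightarrow> y \<in> S \<Longrightarrow> dist x y \<le> c * dist (f x) (f y)"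
  shows "hausdorff_measure s S = 0"
  unfolding hausdorff_null_iff[OF s]
proof (intro allI impI)
  fix e :: real assume e: "0 < e"
  \<comment> \<open>Using c + 1 instead of c keeps the factor positive, as e is divided by
    it.\<close>
  define k where "k = (c + 1) powr s"
  have k: "0 < k" using c by (simp add: k_def)
  obtain U where U: "\<And>i. bounded (U i)" "B \<subseteq> (\<Union>i. U i)"
      "(\<Sum>i. ennreal (diameter (U i) powr s)) \<le> ennreal (e / k)"
    using B e k unfolding hausdorff_null_iff[OF s] using divide_pos_pos[of e k] by (meson)
  define V where "V i = S \<inter> f -` U i" for i
  have d: "dist x y \<le> (c + 1) * diameter (U i)" if "x \<in> V i" "y \<in> V i" for x y i
  proof -
    have "dist x y \<le> c * dist (f x) (f y)" using c that by (auto simp: V_def)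
    also have "\<dots> \<le> (c + 1) * diameter (U i)"
      using that c U by (intro mult_mono diameter_bounded_bound) (auto simp: V_def)
    finally show ?thesis .
  qed
  have "bounded (V i)" for i
  proof (cases "V i = {}")
    case False
    then obtain x where "x \<in> V i" by auto
    then show ?thesis unfolding bounded_def using d by blast
  qed auto
  moreover have "S \<subseteq> (\<Union>i. V i)" using f U by (fastforce simp: V_def)
  moreover have "(\<Sum>i. ennreal (diameter (V i) powr s)) \<le> ennreal e"
  proof -
    have "diameter (V i) powr s \<le> k * diameter (U i) powr s" for i
    proof -
      have "diameter (V i) \<le> (c + 1) * diameter (U i)"
        using c d U by (intro diameter_le_dist) (auto simp: diameter_ge_0)
      then have "diameter (V i) powr s \<le> ((c + 1) * diameter (U i)) powr s"
        using \<open>\<And>i. bounded (V i)\<close> s by (intro powr_mono2) (auto simp: diameter_ge_0)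
      then show ?thesis using c U by (simp add: powr_mult k_def diameter_ge_0)
    qed
    then have "(\<Sum>i. ennreal (diameter (V i) powr s)) \<le> (\<Sum>i. ennreal k * ennreal (diameter (U i) powr s))"
      using k by (intro suminf_le) (auto simp flip: ennreal_mult intro!: ennreal_leI)
    also have "\<dots> = ennreal k * (\<Sum>i. ennreal (diameter (U i) powr s))"
      by simp
    also have "\<dots> \<le> ennreal k * ennreal (e / k)" by (intro mult_left_mono U) auto
    also have "\<dots> = ennreal e" using k e by (simp flip: ennreal_mult)
    finally show ?thesis .
  qed
  ultimately show "\<exists>V. (\<forall>i. bounded (V i)) \<and> S \<subseteq> (\<Union>i. V i) \<and>
      (\<Sum>i. ennreal (diameter (V i) powr s)) \<le> ennreal e" by blast
qed

text \<open>By the Lindelof property countably many of the neighbourhoods suffice, which removes the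
  need for a uniform constant.\<close>

lemma hausdorff_null_locally_expanding_preimage:
  fixes f :: "'a::{metric_space,second_countable_topology} \<Rightarrow> 'b::metric_space"
  assumes s: "0 < s" and B: "hausdorff_measure s B = 0" and f: "f ` S \<subseteq> B"
    and loc: "\<And>x. x \<in> S \<Longrightarrow> \<exists>V c. open V \<and> x \<in> V \<and> 0 \<le> c \<and>
      (\<forall>y\<in>S \<inter> V. \<forall>z\<in>S \<inter> V. dist y z \<le> c * dist (f y) (f z))"
  shows "hausdorff_measure s S = 0"
proof -
  from loc obtain V c where V: "\<And>x. x \<in> S \<Longrightarrow> open (V x) \<and> x \<in> V x \<and> 0 \<le> c x \<and>
      (\<forall>y\<in>S \<inter> V x. \<forall>z\<in>S \<inter> V x. dist y z \<le> c x * dist (f y) (f z))" by metis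
  have "\<exists>F. F \<subseteq> V ` S \<and> countable F \<and> \<Union>F = \<Union>(V ` S)"
    by (rule Lindelof[of "V ` S"]) (use V in auto)
  then obtain F where F: "F \<subseteq> V ` S" "countable F" "\<Union>F = \<Union>(V ` S)" by blast
  have "hausdorff_measure s (S \<inter> W) = 0" if "W \<in> F" for W
  proof -
    obtain x where "x \<in> S" "W = V x" using F \<open>W \<in> F\<close> by auto
    then show ?thesis
      using V[of x] f by (intro hausdorff_null_expanding_preimage[OF s B, of f _ "c x"]) auto
  qed
  then have "hausdorff_measure s (\<Union>W\<in>F. S \<inter> W) = 0"
    by (intro hausdorff_null_countable_UN s F)
  moreover have "S \<subseteq> (\<Union>W\<in>F. S \<inter> W)"
  proof
    fix x assume "x \<in> S"
    then have "x \<in> \<Union>F" using V F(3) by auto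
    with \<open>x \<in> S\<close> show "x \<in> (\<Union>W\<in>F. S \<inter> W)" by auto
  qed
  ultimately show ?thesis using hausdorff_null_subset[OF s] by blast
qed

text \<open>The convergence half of Borel-Cantelli: level N costs at most a constant times (R
  \<beta>^s)^N, a geometric sequence, and the levels beyond any n0 still cover a limsup set.\<close>

lemma hausdorff_null_limsup:
  fixes A :: "'a::metric_space set"
  assumes s: "0 < s" and cov: "\<And>N. N \<ge> N1 \<Longrightarrow> finite (\<U> N)"
    "\<And>N. N \<ge> N1 \<Longrightarrow> real (card (\<U> N)) \<le> L * R ^ N"
    "\<And>N U. N \<ge> N1 \<Longrightarrow> U \<in> \<U> N \<Longrightarrow> bounded U \<and> diameter U \<le> C * \<beta> ^ N"
    and nonneg: "0 \<le> L" "0 \<le> R" "0 \<le> C" "0 < \<beta>" and small: "R * \<beta> powr s < 1"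
    and A: "\<And>x. x \<in> A \<Longrightarrow> \<exists>\<^sub>\<infinity>N. x \<in> \<Union>(\<U> N)"
  shows "hausdorff_measure s A = 0"
proof (rule hausdorff_null_double_cover[OF s])
  fix e :: real assume e: "0 < e"
  define q where "q = R * \<beta> powr s"
  define K where "K = L * C powr s"
  have q: "0 \<le> q" "q < 1" and K: "0 \<le> K"
    using nonneg small by (auto simp: q_def K_def)
  have "(\<lambda>n. K * q ^ n * inverse (1 - q)) \<longlonglongrightarrow> K * 0 * inverse (1 - q)"
    using q by (intro tendsto_intros LIMSEQ_realpow_zero)
  then have "\<forall>\<^sub>F n in sequentially. K * q ^ n * inverse (1 - q) < e"
    using e by (intro order_tendstoD(2)[where y = "K * 0 * inverse (1 - q)"]) auto
  then obtain n1 where "\<forall>n\<ge>n1. K * q ^ n * inverse (1 - q) < e"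
    unfolding eventually_sequentially by blast
  then obtain n0 where n0: "n0 \<ge> N1" "K * q ^ n0 * inverse (1 - q) < e"
    using that[of "max n1 N1"] by auto
  \<comment> \<open>Finite levels are padded by empty sets, whose diameter is 0 and whose weight
    therefore vanishes for s > 0.\<close>
  define U where "U m n = (if n < card (\<U> (n0 + m)) then from_nat_into (\<U> (n0 + m)) n else {})" for m n
  have mem: "U m n \<in> \<U> (n0 + m)" if "n < card (\<U> (n0 + m))" for m n
    using that by (auto simp: U_def intro!: from_nat_into)
  have bdd: "bounded (U m n)" for m n
    using mem[of n m] cov(3)[of "n0 + m"] n0 by (cases "n < card (\<U> (n0 + m))") (auto simp: U_def)
  moreover have "A \<subseteq> (\<Union>m n. U m n)"
  proof
    fix x assume "x \<in> A"
    then obtain N where N: "N \<ge> n0" "x \<in> \<Union>(\<U> N)"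
      using A unfolding INFM_nat_le by blast
    then obtain W where W: "x \<in> W" "W \<in> \<U> N" by auto
    have fin: "finite (\<U> N)" using cov(1) N n0 by auto
    have "bij_betw (from_nat_into (\<U> N)) {..<card (\<U> N)} (\<U> N)"
      by (rule bij_betw_from_nat_into_finite[OF fin])
    then obtain n where "n < card (\<U> N)" "from_nat_into (\<U> N) n = W"
      using W(2) unfolding bij_betw_def by (metis imageE lessThan_iff)
    then have "x \<in> U (N - n0) n" using W N by (simp add: U_def)
    then show "x \<in> (\<Union>m n. U m n)" by blast
  qed
  moreover have "(\<Sum>m. \<Sum>n. ennreal (diameter (U m n) powr s)) \<le> ennreal e"
  proof -
    have row: "(\<Sum>n. ennreal (diameter (U m n) powr s)) \<le> ennreal (K * q ^ n0 * q ^ m)" for m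
    proof -
      let ?N = "n0 + m"
      have "(\<Sum>n. ennreal (diameter (U m n) powr s)) = (\<Sum>n<card (\<U> ?N). ennreal (diameter (U m n) powr s))"
        using s by (intro suminf_finite) (auto simp: U_def)
      also have "\<dots> \<le> (\<Sum>n<card (\<U> ?N). ennreal ((C * \<beta> ^ ?N) powr s))"
        using mem cov(3) s n0 bdd
        by (intro sum_mono ennreal_leI powr_mono2) (auto simp: diameter_ge_0)
      also have "\<dots> = ennreal (real (card (\<U> ?N)) * (C * \<beta> ^ ?N) powr s)"
        by (simp add: ennreal_of_nat_eq_real_of_nat ennreal_mult)
      also have "\<dots> \<le> ennreal (L * R ^ ?N * (C * \<beta> ^ ?N) powr s)"
        using n0 by (intro ennreal_leI mult_right_mono cov) auto
      finally have "(\<Sum>n. ennreal (diameter (U m n) powr s)) \<le> ennreal (L * R ^ ?N * (C * \<beta> ^ ?N) powr s)" .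
      moreover have "(\<beta> ^ i) powr s = \<beta> powr (real i * s)" for i
        using nonneg by (simp add: powr_powr flip: powr_realpow)
      then have "L * R ^ ?N * (C * \<beta> ^ ?N) powr s = K * q ^ n0 * q ^ m"
        using nonneg by (simp add: K_def q_def powr_mult power_mult_distrib power_add powr_power)
      ultimately show ?thesis by metis
    qed
    have "(\<Sum>m. \<Sum>n. ennreal (diameter (U m n) powr s)) \<le> (\<Sum>m. ennreal (K * q ^ n0 * q ^ m))"
      by (intro suminf_le row) auto
    also have "\<dots> = ennreal (K * q ^ n0 * inverse (1 - q))"
      using q K by (intro suminf_ennreal_eq sums_mult)
        (auto simp: geometric_sums inverse_eq_divide)
    also have "\<dots> \<le> ennreal e" using n0 by (intro ennreal_leI) auto
    finally show ?thesis .
  qed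
  ultimately show "\<exists>U. (\<forall>m n. bounded (U m n)) \<and> A \<subseteq> (\<Union>m n. U m n) \<and>
       (\<Sum>m. \<Sum>n. ennreal (diameter (U m n) powr s)) \<le> ennreal e" by blast
qed

lemma hausdorff_dim_le:
  assumes "0 \<le> s" "hausdorff_measure s A = 0"
  shows "hausdorff_dim A \<le> ennreal s"
  unfolding hausdorff_dim_def using assms by (intro Inf_lower) auto

lemma hausdorff_dim_eq_0:
  assumes "\<And>s. 0 < s \<Longrightarrow> hausdorff_measure s A = 0"
  shows "hausdorff_dim A = 0"
proof -
  have "hausdorff_dim A \<le> 0 + ennreal e" if "0 < e" for e
    using hausdorff_dim_le[of e A] assms[of e] that by simp
  then show ?thesis by (metis ennreal_le_epsilon le_zero_eq)
qed

section \<open>The Erdos-Kahane argument\<close>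

text \<open>In the application \<open>K \<tau> n\<close> is the integer nearest to the \<open>n\<close>-th term of the sequence with
  parameter \<open>\<tau>\<close>, and \<open>I \<tau>\<close> is the set of positions where the term is far from it.\<close>

locale coded_family =
  fixes T :: "'t set" and K :: "'t \<Rightarrow> nat \<Rightarrow> 'b" and I :: "'t \<Rightarrow> nat set" and L Q :: nat
  assumes init: "finite ((\<lambda>\<tau>. map (K \<tau>) [0..<4]) ` T)" "card ((\<lambda>\<tau>. map (K \<tau>) [0..<4]) ` T) \<le> L"
    and step: "\<And>n \<tau>. 4 \<le> n \<Longrightarrow> \<tau> \<in> T \<Longrightarrow>
      finite ((\<lambda>\<tau>'. K \<tau>' n) ` {\<tau>' \<in> T. \<forall>m<n. K \<tau>' m = K \<tau> m}) \<and>
      card ((\<lambda>\<tau>'. K \<tau>' n) ` {\<tau>' \<in> T. \<forall>m<n. K \<tau>' m = K \<tau> m}) \<le> Q"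
    and determined: "\<And>n \<tau> \<tau>'. 4 \<le> n \<Longrightarrow> \<tau> \<in> T \<Longrightarrow> \<tau>' \<in> T \<Longrightarrow> \<forall>m<n. K \<tau>' m = K \<tau> m \<Longrightarrow>
      {n - 4..n} \<inter> (I \<tau> \<union> I \<tau>') = {} \<Longrightarrow> K \<tau>' n = K \<tau> n"
    and Q: "1 \<le> Q"
begin

text \<open>J lists the permitted deviations below the horizon N. The horizon stays fixed while the
  length n grows, so that the count can go by induction on n.\<close>

definition prefixes :: "nat \<Rightarrow> nat set \<Rightarrow> nat \<Rightarrow> 'b list set" where
  "prefixes N J n = (\<lambda>\<tau>. map (K \<tau>) [0..<n]) ` {\<tau> \<in> T. I \<tau> \<inter> {..<N} \<subseteq> J}"

text \<open>A prefix has at most Q extensions at any position, and only one when the window of five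
  positions ending there misses J. The exponent counts the windows that meet J.\<close>

lemma card_prefixes_window:
  assumes "4 \<le> n" "n \<le> N"
  shows "finite (prefixes N J n) \<and>
    card (prefixes N J n) \<le> L * Q ^ card {m. m < n \<and> {m - 4..m} \<inter> J \<noteq> {}}"
  using assms
proof (induction n rule: nat_induct_at_least)
  case base
  have sub: "prefixes N J 4 \<subseteq> (\<lambda>\<tau>. map (K \<tau>) [0..<4]) ` T" unfolding prefixes_def by blast
  have "card (prefixes N J 4) \<le> L" using card_mono[OF init(1) sub] init(2) by linarith
  \<comment> \<open>Positions below 4 are counted in the exponent although L already accounts for
    them; this overcount is harmless because Q is at least 1.\<close>
  also have "\<dots> \<le> L * Q ^ card {m. m < 4 \<and> {m - 4..m} \<inter> J \<noteq> {}}" using Q by simp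
  finally show ?case using finite_subset[OF sub init(1)] by blast
next
  case (Suc n)
  let ?w = "\<lambda>n. card {m. m < n \<and> {m - 4..m} \<inter> J \<noteq> {}}"
  define V where "V w = (\<lambda>\<tau>. K \<tau> n) ` {\<tau> \<in> T. I \<tau> \<inter> {..<N} \<subseteq> J \<and> map (K \<tau>) [0..<n] = w}" for w
  define q where "q = (if {n - 4..n} \<inter> J = {} then 1 else Q)"
  have IH: "finite (prefixes N J n)" "card (prefixes N J n) \<le> L * Q ^ ?w n" using Suc by auto
  have V: "finite (V w) \<and> card (V w) \<le> q" if "w \<in> prefixes N J n" for w
  proof -
    obtain \<tau> where \<tau>: "\<tau> \<in> T" "I \<tau> \<inter> {..<N} \<subseteq> J" "w = map (K \<tau>) [0..<n]"
      using \<open>w \<in> prefixes N J n\<close> by (auto simp: prefixes_def)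
    have sub: "V w \<subseteq> (\<lambda>\<tau>'. K \<tau>' n) ` {\<tau>' \<in> T. \<forall>m<n. K \<tau>' m = K \<tau> m}"
      unfolding V_def \<tau>(3) by (intro image_mono) auto
    then have fin: "finite (V w)" and le: "card (V w) \<le> Q"
      using step[OF \<open>4 \<le> n\<close> \<tau>(1)] by (auto intro: finite_subset dest: card_mono[rotated])
    moreover have "card (V w) \<le> 1" if none: "{n - 4..n} \<inter> J = {}"
    proof -
      have "x = K \<tau> n" if "x \<in> V w" for x
      proof -
        obtain \<tau>' where \<tau>': "\<tau>' \<in> T" "I \<tau>' \<inter> {..<N} \<subseteq> J" "\<forall>m<n. K \<tau>' m = K \<tau> m" "x = K \<tau>' n"
          using \<open>x \<in> V w\<close> unfolding V_def \<tau>(3) by auto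
        have "{n - 4..n} \<subseteq> {..<N}" using Suc.prems by auto
        then have "{n - 4..n} \<inter> (I \<tau> \<union> I \<tau>') = {}" using none \<tau>(2) \<tau>'(2) by blast
        then show ?thesis using determined[OF \<open>4 \<le> n\<close> \<tau>(1) \<tau>'(1,3)] \<tau>'(4) by simp
      qed
      then have "V w \<subseteq> {K \<tau> n}" by blast
      then show ?thesis using card_mono[of "{K \<tau> n}"] by simp
    qed
    ultimately show ?thesis by (simp add: q_def)
  qed
  have sub: "prefixes N J (Suc n) \<subseteq> (\<Union>w\<in>prefixes N J n. (\<lambda>k. w @ [k]) ` V w)"
    by (auto simp: prefixes_def V_def)
  have fin: "finite (\<Union>w\<in>prefixes N J n. (\<lambda>k. w @ [k]) ` V w)"
    using IH V by blast
  have "card (prefixes N J (Suc n)) \<le> (\<Sum>w\<in>prefixes N J n. card ((\<lambda>k. w @ [k]) ` V w))"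
    using card_mono[OF fin sub] card_UN_le[OF IH(1), of "\<lambda>w. (\<lambda>k. w @ [k]) ` V w"] by linarith
  also have "\<dots> \<le> (\<Sum>w\<in>prefixes N J n. q)"
    using V by (intro sum_mono) (meson card_image_le le_trans)
  also have "\<dots> \<le> L * Q ^ ?w n * q" using IH(2) by simp
  also have "\<dots> = L * Q ^ ?w (Suc n)"
  proof (cases "{n - 4..n} \<inter> J = {}")
    case True
    then have "{m. m < Suc n \<and> {m - 4..m} \<inter> J \<noteq> {}} = {m. m < n \<and> {m - 4..m} \<inter> J \<noteq> {}}"
      using less_Suc_eq by blast
    with True show ?thesis by (simp add: q_def)
  next
    case False
    then have "{m. m < Suc n \<and> {m - 4..m} \<inter> J \<noteq> {}} = insert n {m. m < n \<and> {m - 4..m} \<inter> J \<noteq> {}}"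
      using less_Suc_eq by blast
    with False show ?thesis by (simp add: q_def)
  qed
  finally show ?case using finite_subset[OF sub fin] by blast
qed

text \<open>A position j in J lies only in the windows ending at j, ..., j + 4.\<close>

lemma card_prefixes:
  assumes "4 \<le> N" "J \<subseteq> {..<N}"
  shows "finite (prefixes N J N)" "card (prefixes N J N) \<le> L * Q ^ (5 * card J)"
proof -
  have finJ: "finite J" using assms finite_subset by blast
  have sub: "{m. m < N \<and> {m - 4..m} \<inter> J \<noteq> {}} \<subseteq> (\<Union>j\<in>J. {j..j + 4})" by (fastforce simp: le_diff_conv)
  have "card {m. m < N \<and> {m - 4..m} \<inter> J \<noteq> {}} \<le> card (\<Union>j\<in>J. {j..j + 4})"
    using finJ sub by (intro card_mono) auto
  also have "\<dots> \<le> (\<Sum>j\<in>J. card {j..j + 4})" by (rule card_UN_le[OF finJ])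
  also have "\<dots> = 5 * card J" by simp
  finally have "Q ^ card {m. m < N \<and> {m - 4..m} \<inter> J \<noteq> {}} \<le> Q ^ (5 * card J)"
    using Q by (intro power_increasing) auto
  then show "card (prefixes N J N) \<le> L * Q ^ (5 * card J)" "finite (prefixes N J N)"
    using card_prefixes_window[of N N J] assms by (auto intro: order_trans mult_le_mono2)
qed

text \<open>An exponential-moment estimate in place of binomial coefficients. With y = Q^5 / x >= 1
  one writes Q^(5 |J|) = y^|J| x^|J|; rarity bounds the first factor by y^(\<delta> N), and the
  second sums over all subsets J to (1 + x)^N.\<close>

lemma card_rare_prefixes:
  fixes x \<delta> :: real
  assumes N: "4 \<le> N" and x: "0 < x" "x \<le> 1" and \<delta>: "0 \<le> \<delta>"
  defines "W \<equiv> (\<lambda>\<tau>. map (K \<tau>) [0..<N]) ` {\<tau> \<in> T. real (card (I \<tau> \<inter> {..<N})) < \<delta> * real N}"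
  shows "finite W" "real (card W) \<le> real L * ((1 + x) * (real Q ^ 5 / x) powr \<delta>) ^ N"
proof -
  define \<J> where "\<J> = {J \<in> Pow {..<N}. real (card J) < \<delta> * real N}"
  have fin: "finite \<J>" by (simp add: \<J>_def)
  have sub: "W \<subseteq> (\<Union>J\<in>\<J>. prefixes N J N)"
  proof
    fix w assume "w \<in> W"
    then obtain \<tau> where \<tau>: "\<tau> \<in> T" "real (card (I \<tau> \<inter> {..<N})) < \<delta> * real N" "w = map (K \<tau>) [0..<N]"
      unfolding W_def by blast
    then have "I \<tau> \<inter> {..<N} \<in> \<J>" "w \<in> prefixes N (I \<tau> \<inter> {..<N}) N"
      by (auto simp: \<J>_def prefixes_def)
    then show "w \<in> (\<Union>J\<in>\<J>. prefixes N J N)" by blast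
  qed
  have finU: "finite (\<Union>J\<in>\<J>. prefixes N J N)"
    using fin card_prefixes(1)[OF N] by (auto simp: \<J>_def)
  then show "finite W" using sub finite_subset by blast
  define y where "y = real Q ^ 5 / x"
  have y: "1 \<le> y" using x Q by (simp add: y_def field_simps order_trans[OF _ one_le_power])
  have "card W \<le> (\<Sum>J\<in>\<J>. card (prefixes N J N))"
    using card_mono[OF finU sub] card_UN_le[OF fin, of "\<lambda>J. prefixes N J N"] by (rule order_trans)
  then have "real (card W) \<le> (\<Sum>J\<in>\<J>. real (card (prefixes N J N)))"
    by (metis of_nat_le_iff of_nat_sum)
  also have "\<dots> \<le> (\<Sum>J\<in>\<J>. real L * y powr (\<delta> * real N) * x ^ card J)"
  proof (rule sum_mono)
    fix J assume J: "J \<in> \<J>"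
    have "real (card (prefixes N J N)) \<le> real (L * Q ^ (5 * card J))"
      using card_prefixes(2)[OF N, of J] J unfolding of_nat_le_iff by (simp add: \<J>_def)
    also have "\<dots> = real L * (y ^ card J * x ^ card J)"
      using x by (simp add: y_def power_mult power_divide)
    also have "y ^ card J = y powr real (card J)" using y by (simp add: powr_realpow)
    also have "real L * (y powr real (card J) * x ^ card J) \<le> real L * (y powr (\<delta> * real N) * x ^ card J)"
      using J y x by (intro mult_left_mono mult_right_mono powr_mono) (auto simp: \<J>_def)
    finally show "real (card (prefixes N J N)) \<le> real L * y powr (\<delta> * real N) * x ^ card J"
      by (simp add: mult.assoc)
  qed
  also have "\<dots> = real L * y powr (\<delta> * real N) * (\<Sum>J\<in>\<J>. x ^ card J)"
    by (simp add: sum_distrib_left)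
  also have "\<dots> \<le> real L * y powr (\<delta> * real N) * (\<Sum>J\<in>Pow {..<N}. x ^ card J)"
    using x by (intro mult_left_mono sum_mono2) (auto simp: \<J>_def)
  also have "(\<Sum>J\<in>Pow {..<N}. x ^ card J) = (1 + x) ^ N"
    using prod_add[of "{..<N}" "\<lambda>_. x" "\<lambda>_. 1"] by (simp add: add.commute)
  also have "real L * y powr (\<delta> * real N) * (1 + x) ^ N = real L * ((1 + x) * y powr \<delta>) ^ N"
    using y by (simp add: power_mult_distrib powr_powr flip: powr_realpow)
  finally show "real (card W) \<le> real L * ((1 + x) * (real Q ^ 5 / x) powr \<delta>) ^ N"
    unfolding y_def .
qed

text \<open>Only the image under \<pi> must be determined by the code up to an exponentially small
  error; other components of \<tau> may vary freely and may change with N.\<close>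

lemma hausdorff_null_rare:
  fixes \<pi> :: "'t \<Rightarrow> 'c::metric_space"
  assumes s: "0 < s" and \<beta>: "0 < \<beta>" "\<beta> < 1" and C: "0 \<le> C"
    and loc: "\<And>N \<tau> \<tau>'. 4 \<le> N \<Longrightarrow> \<tau> \<in> T \<Longrightarrow> \<tau>' \<in> T \<Longrightarrow> \<forall>m<N. K \<tau>' m = K \<tau> m \<Longrightarrow>
      dist (\<pi> \<tau>) (\<pi> \<tau>') \<le> C * \<beta> ^ N"
  shows "\<exists>\<delta>>0. hausdorff_measure s
    {z. \<exists>\<^sub>\<infinity>N. \<exists>\<tau>\<in>T. \<pi> \<tau> = z \<and> real (card (I \<tau> \<inter> {..<N})) < \<delta> * real N} = 0"
proof -
  \<comment> \<open>The permitted growth rate is \<beta> powr (-s) = v * v. One factor v is spent on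
    1 + x, the other on y powr \<delta>.\<close>
  define v where "v = (1 / \<beta>) powr (s / 2)"
  have v: "1 < v" unfolding v_def using \<beta> s by (intro gr_one_powr) auto
  define x where "x = min 1 ((v - 1) / 2)"
  have x: "0 < x" "x \<le> 1" "1 + x < v" using v by (auto simp: x_def min_def field_simps)
  define y where "y = real Q ^ 5 / x"
  have y: "1 \<le> y" using x Q by (simp add: y_def field_simps order_trans[OF _ one_le_power])
  \<comment> \<open>Chosen so that \<delta> ln y <= (ln v) / 2; the added 1 covers the case y = 1,
    where ln y vanishes.\<close>
  define \<delta> where "\<delta> = ln v / (2 * (ln y + 1))"
  have lny: "0 \<le> ln y" using y by simp
  have \<delta>: "0 < \<delta>" using v lny by (simp add: \<delta>_def)
  have "\<delta> * ln y \<le> ln v / 2"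
    using lny v by (simp add: \<delta>_def divide_simps)
  also have "\<dots> < ln v" using v by simp
  finally have "y powr \<delta> < v"
    using y v by (simp add: powr_def) (metis exp_less_cancel_iff exp_ln less_trans zero_less_one)
  then have "(1 + x) * y powr \<delta> < v * v"
    using x v by (intro mult_strict_mono) auto
  moreover have "v * v * \<beta> powr s = 1"
    using \<beta> by (simp add: v_def powr_divide flip: powr_add)
  ultimately have small: "(1 + x) * y powr \<delta> * \<beta> powr s < 1"
    using \<beta> by (metis mult_strict_right_mono powr_gt_zero less_numeral_extra(3) less_irrefl)
  define W where "W N = (\<lambda>\<tau>. map (K \<tau>) [0..<N]) ` {\<tau> \<in> T. real (card (I \<tau> \<inter> {..<N})) < \<delta> * real N}" for N
  define cell where "cell N w = \<pi> ` {\<tau> \<in> T. map (K \<tau>) [0..<N] = w}" for N w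
  have W: "finite (W N)" "real (card (W N)) \<le> real L * ((1 + x) * y powr \<delta>) ^ N" if "4 \<le> N" for N
    unfolding W_def y_def using card_rare_prefixes[OF that x(1,2), of \<delta>] \<delta> by auto
  have cell: "dist a b \<le> C * \<beta> ^ N" if "4 \<le> N" and a: "a \<in> cell N w" and b: "b \<in> cell N w" for N w a b
  proof -
    obtain \<tau> where \<tau>: "\<tau> \<in> T" "a = \<pi> \<tau>" "map (K \<tau>) [0..<N] = w"
      using a unfolding cell_def by blast
    obtain \<tau>' where \<tau>': "\<tau>' \<in> T" "b = \<pi> \<tau>'" "map (K \<tau>') [0..<N] = w"
      using b unfolding cell_def by blast
    have "map (K \<tau>') [0..<N] = map (K \<tau>) [0..<N]" using \<tau> \<tau>' by simp
    then have "\<forall>m<N. K \<tau>' m = K \<tau> m" by simp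
    then show ?thesis using loc[OF \<open>4 \<le> N\<close> \<tau>(1) \<tau>'(1)] \<tau>(2) \<tau>'(2) by simp
  qed
  have "hausdorff_measure s
    {z. \<exists>\<^sub>\<infinity>N. \<exists>\<tau>\<in>T. \<pi> \<tau> = z \<and> real (card (I \<tau> \<inter> {..<N})) < \<delta> * real N} = 0"
  proof (rule hausdorff_null_limsup[where ?N1.0 = 4 and \<U> = "\<lambda>N. cell N ` W N" and L = "real L"
        and R = "(1 + x) * y powr \<delta>" and \<beta> = \<beta> and C = C])
    fix N :: nat assume N: "4 \<le> N"
    show "finite (cell N ` W N)" using W N by simp
    show "real (card (cell N ` W N)) \<le> real L * ((1 + x) * y powr \<delta>) ^ N"
      using W[OF N] card_image_le[OF W(1)[OF N], of "cell N"] by linarith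
    fix U assume "U \<in> cell N ` W N"
    then obtain w where w: "U = cell N w" by blast
    have "bounded U"
    proof (cases "U = {}")
      case False
      then obtain a where "a \<in> U" by blast
      then show ?thesis unfolding bounded_def using cell[OF N] w by blast
    qed simp
    moreover have "diameter U \<le> C * \<beta> ^ N"
      using cell[OF N] w C \<beta> by (intro diameter_le_dist) auto
    ultimately show "bounded U \<and> diameter U \<le> C * \<beta> ^ N" ..
  next
    fix z assume z: "z \<in> {z. \<exists>\<^sub>\<infinity>N. \<exists>\<tau>\<in>T. \<pi> \<tau> = z \<and> real (card (I \<tau> \<inter> {..<N})) < \<delta> * real N}"
    show "\<exists>\<^sub>\<infinity>N. z \<in> \<Union> (cell N ` W N)"
      by (rule INFM_mono[OF z[unfolded mem_Collect_eq]]) (auto simp: cell_def W_def)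
  qed (use s \<beta> C x small in auto)
  then show ?thesis using \<delta> by blast
qed

end

section \<open>Deviation frequencies and the recurrence behind an orbit\<close>

definition off_integer :: "real \<Rightarrow> complex \<Rightarrow> bool" where
  "off_integer \<rho> z \<longleftrightarrow> \<rho> \<le> \<bar>Re z - round (Re z)\<bar>"

text \<open>The vectors \<open>t\<close> range over a fundamental annulus of multiplication by \<open>\<theta>\<close>.\<close>

definition frequently_in :: "(complex \<Rightarrow> bool) \<Rightarrow> real \<Rightarrow> real \<Rightarrow> complex \<Rightarrow> bool" where
  "frequently_in P b \<delta> \<theta> \<longleftrightarrow> (\<exists>N0. \<forall>N\<ge>N0. \<forall>t. 1 \<le> norm t \<longrightarrow> norm t \<le> b \<longrightarrow>
     \<delta> * real N \<le> real (card {n. n < N \<and> P (\<theta> ^ n * t)}))"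

text \<open>The vector t is quantified inside: it depends on N. This is why t has to be part of the
  coded object although the exceptional set does not see it.\<close>

lemma not_frequently_in:
  assumes "\<not> frequently_in P b \<delta> \<theta>"
  shows "\<exists>\<^sub>\<infinity>N. \<exists>t. 1 \<le> norm t \<and> norm t \<le> b \<and> real (card ({n. P (\<theta> ^ n * t)} \<inter> {..<N})) < \<delta> * real N"
proof -
  have "{n. n < N \<and> P (\<theta> ^ n * t)} = {n. P (\<theta> ^ n * t)} \<inter> {..<N}" for N t by auto
  then show ?thesis
    using assms unfolding frequently_in_def INFM_nat_le by (auto simp: not_le)
qed

lemma Re_recurrence: "Re (\<theta> * (\<theta> * z)) = 2 * Re \<theta> * Re (\<theta> * z) - (norm \<theta>)\<^sup>2 * Re z"
  by (simp add: cmod_power2) (simp add: power2_eq_square algebra_simps)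

text \<open>The determinant of the linear system for the recurrence coefficients. It is the place
  where distance from the real axis enters.\<close>

lemma Re_casoratian: "(Re (\<theta> * z))\<^sup>2 - Re z * Re (\<theta> * (\<theta> * z)) = (norm z)\<^sup>2 * (Im \<theta>)\<^sup>2"
  by (simp add: cmod_power2) (simp add: power2_eq_square algebra_simps)

text \<open>The recurrence coefficients are recovered from four consecutive terms by Cramer's rule.\<close>

lemma recurrence_compare:
  fixes A B A' B' b r \<eta> d :: real
  assumes x: "x2 = A * x1 - B * x0" "x3 = A * x2 - B * x1" "x4 = A * x3 - B * x2"
    and y: "y2 = A' * y1 - B' * y0" "y3 = A' * y2 - B' * y1" "y4 = A' * y3 - B' * y2"
    and b: "\<bar>A'\<bar> \<le> 2 * b" "\<bar>B'\<bar> \<le> b\<^sup>2" "1 \<le> b"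
    and r: "0 < r" "\<bar>x0\<bar> \<le> r" "\<bar>x1\<bar> \<le> b * r" "\<bar>x2\<bar> \<le> b\<^sup>2 * r" "\<bar>x3\<bar> \<le> b ^ 3 * r"
    and \<eta>: "0 < \<eta>" "r\<^sup>2 * \<eta>\<^sup>2 \<le> x1\<^sup>2 - x0 * x2"
    and d: "\<bar>x0 - y0\<bar> \<le> d" "\<bar>x1 - y1\<bar> \<le> d" "\<bar>x2 - y2\<bar> \<le> d" "\<bar>x3 - y3\<bar> \<le> d"
  defines "S \<equiv> 1 + 2 * b + b\<^sup>2"
  defines "P \<equiv> S * (b + b\<^sup>2) / \<eta>\<^sup>2"
  shows "\<bar>A - A'\<bar> \<le> P * d / r" "\<bar>B - B'\<bar> \<le> P * d / r" "\<bar>x4 - y4\<bar> \<le> (P * (b ^ 3 + b\<^sup>2) + S) * d"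
proof -
  have d0: "0 \<le> d" using d(1) by linarith
  have S: "1 \<le> S" using b by (simp add: S_def)
  have lin: "\<bar>u - A' * v + B' * w\<bar> \<le> S * d" if "\<bar>u\<bar> \<le> d" "\<bar>v\<bar> \<le> d" "\<bar>w\<bar> \<le> d" for u v w
  proof -
    have "\<bar>A' * v\<bar> \<le> 2 * b * d" "\<bar>B' * w\<bar> \<le> b\<^sup>2 * d"
      using that b d0 by (auto simp: abs_mult intro!: mult_mono)
    then show ?thesis using that(1) unfolding S_def by (simp add: algebra_simps; linarith)
  qed
  \<comment> \<open>The defects of x - y under the recurrence of y. They are small because all
    differences are, and they equal linear expressions in A - A' and B - B' whose coefficients are
    terms of x; no size bound on y enters.\<close>
  define e1 e2 where "e1 = (x2 - y2) - A' * (x1 - y1) + B' * (x0 - y0)"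
    and "e2 = (x3 - y3) - A' * (x2 - y2) + B' * (x1 - y1)"
  have e: "\<bar>e1\<bar> \<le> S * d" "\<bar>e2\<bar> \<le> S * d" unfolding e1_def e2_def using lin d by auto
  have e1: "e1 = (A - A') * x1 - (B - B') * x0" unfolding e1_def x(1) y(1) by (simp add: algebra_simps)
  have e2: "e2 = (A - A') * x2 - (B - B') * x1" unfolding e2_def x(2) y(2) by (simp add: algebra_simps)
  define D where "D = x1\<^sup>2 - x0 * x2"
  have "0 < r\<^sup>2 * \<eta>\<^sup>2" using r \<eta> by simp
  then have D: "0 < D" using \<eta>(2) unfolding D_def by linarith
  have cramer: "(A - A') * D = e1 * x1 - e2 * x0" "(B - B') * D = e1 * x2 - e2 * x1"
    unfolding e1 e2 D_def by (simp_all add: power2_eq_square algebra_simps)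
  have solve: "\<bar>v\<bar> \<le> P * d / r" if v: "v * D = e1 * p - e2 * q" "\<bar>p\<bar> + \<bar>q\<bar> \<le> (b + b\<^sup>2) * r" for v p q
  proof -
    have "\<bar>v\<bar> * (r\<^sup>2 * \<eta>\<^sup>2) \<le> \<bar>v\<bar> * D" using \<eta> by (intro mult_left_mono) (auto simp: D_def)
    also have "\<dots> = \<bar>e1 * p - e2 * q\<bar>" using D v(1) by (metis abs_mult abs_of_pos)
    also have "\<dots> \<le> \<bar>e1\<bar> * \<bar>p\<bar> + \<bar>e2\<bar> * \<bar>q\<bar>" by (metis abs_mult abs_triangle_ineq4)
    also have "\<dots> \<le> S * d * \<bar>p\<bar> + S * d * \<bar>q\<bar>" using e by (intro add_mono mult_right_mono) auto
    also have "\<dots> = S * d * (\<bar>p\<bar> + \<bar>q\<bar>)" by (simp add: algebra_simps)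
    also have "\<dots> \<le> S * d * ((b + b\<^sup>2) * r)" using v(2) S d0 by (intro mult_left_mono) auto
    finally have "\<bar>v\<bar> \<le> S * d * ((b + b\<^sup>2) * r) / (r\<^sup>2 * \<eta>\<^sup>2)"
      using r \<eta> by (simp add: pos_le_divide_eq)
    also have "\<dots> = P * d / r" using r \<eta> by (simp add: P_def power2_eq_square field_simps)
    finally show ?thesis .
  qed
  have b2: "b \<le> b\<^sup>2" "1 \<le> b\<^sup>2" using b(3) self_le_power[of b 2] one_le_power[of b 2] by auto
  have br: "r \<le> b\<^sup>2 * r" using b2 r by (simp add: mult_le_cancel_right1)
  show A: "\<bar>A - A'\<bar> \<le> P * d / r"
    by (rule solve[OF cramer(1)]) (use r br in \<open>simp only: distrib_right\<close>)
  show B: "\<bar>B - B'\<bar> \<le> P * d / r"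
    by (rule solve[OF cramer(2)]) (use r br in \<open>simp only: distrib_right\<close>)
  have P: "0 \<le> P * d / r" using A by linarith
  \<comment> \<open>The coefficient errors are of order d / r and are multiplied by terms of order
    r, so the size of the orbit cancels from the prediction error.\<close>
  have "x4 - y4 = (A - A') * x3 - (B - B') * x2 - (0 - A' * (x3 - y3) + B' * (x2 - y2))"
    unfolding x(3) y(3) by (simp add: algebra_simps)
  then have "\<bar>x4 - y4\<bar> \<le> \<bar>A - A'\<bar> * \<bar>x3\<bar> + \<bar>B - B'\<bar> * \<bar>x2\<bar> + \<bar>0 - A' * (x3 - y3) + B' * (x2 - y2)\<bar>"
    by (simp add: abs_mult[symmetric])
  also have "\<dots> \<le> (P * d / r) * (b ^ 3 * r) + (P * d / r) * (b\<^sup>2 * r) + S * d"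
    using d d0 by (intro add_mono mult_mono[OF A r(5) P abs_ge_zero] mult_mono[OF B r(4) P abs_ge_zero] lin) auto
  also have "\<dots> = (P * (b ^ 3 + b\<^sup>2) + S) * d" using r by (simp add: field_simps)
  finally show "\<bar>x4 - y4\<bar> \<le> (P * (b ^ 3 + b\<^sup>2) + S) * d" .
qed

section \<open>Nearest integers along two orbits, and exceptional bases\<close>

lemma round_diff_bound: "\<bar>x - y\<bar> \<le> c \<Longrightarrow> \<bar>round x - round y\<bar> \<le> \<lceil>c\<rceil> + 1" for x y c :: real
  using of_int_round_abs_le[of x] of_int_round_abs_le[of y] by linarith

lemma round_eq_diff_le_1: "round x = round y \<Longrightarrow> \<bar>x - y\<bar> \<le> 1" for x y :: real
  using round_eq_imp_diff_1[of x y] by simp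

lemma near_integer_diff:
  assumes "\<not> off_integer \<rho> z" "\<not> off_integer \<rho> w" "round (Re z) = round (Re w)"
  shows "\<bar>Re z - Re w\<bar> \<le> 2 * \<rho>"
  using assms unfolding off_integer_def by linarith

lemma near_integer_eq:
  assumes "\<not> off_integer \<rho> z" "\<not> off_integer \<rho> w" "\<bar>Re z - Re w\<bar> \<le> c" "c + 2 * \<rho> < 1"
  shows "round (Re z) = round (Re w)"
proof -
  have "\<bar>real_of_int (round (Re z) - round (Re w))\<bar> < 1"
    using assms unfolding off_integer_def of_int_diff by linarith
  then show ?thesis by linarith
qed

lemma power_shift: "w ^ k * (w ^ n * v) = w ^ (n + k) * v" for w v :: complex
  by (simp add: power_add mult_ac)

lemma norm_power_shift_le:
  fixes z \<theta> :: complex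
  assumes "norm z \<le> r" "norm \<theta> \<le> b" "0 \<le> b"
  shows "norm (\<theta> ^ k * z) \<le> b ^ k * r"
  unfolding norm_mult norm_power using assms by (intro mult_mono power_mono) (auto intro: zero_le_power)

text \<open>The coefficients 2 Re \<theta> and |\<theta>|^2 are pinned down with error O(d / |z|),
  hence exponentially well late along an expanding orbit, while the error in predicting the next
  term is O(d) independently of |z|. The first serves localisation, the second the count of
  codes.\<close>

lemma orbit_compare:
  assumes \<theta>: "norm \<theta> \<le> b" "norm \<theta>' \<le> b" "1 \<le> b" "\<eta> < Im \<theta>" "0 < \<eta>" and z: "z \<noteq> 0"
    and d: "\<And>k. k < 4 \<Longrightarrow> \<bar>Re (\<theta> ^ k * z) - Re (\<theta>' ^ k * z')\<bar> \<le> d"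
  defines "S \<equiv> 1 + 2 * b + b\<^sup>2"
  defines "P \<equiv> S * (b + b\<^sup>2) / \<eta>\<^sup>2"
  shows "\<bar>2 * Re \<theta> - 2 * Re \<theta>'\<bar> \<le> P * d / norm z" "\<bar>(norm \<theta>)\<^sup>2 - (norm \<theta>')\<^sup>2\<bar> \<le> P * d / norm z"
    "\<bar>Re (\<theta> ^ 4 * z) - Re (\<theta>' ^ 4 * z')\<bar> \<le> (P * (b ^ 3 + b\<^sup>2) + S) * d"
proof -
  have rec: "Re (w ^ (k + 2) * v) = 2 * Re w * Re (w ^ (k + 1) * v) - (norm w)\<^sup>2 * Re (w ^ k * v)" for w v k
    using Re_recurrence[of w "w ^ k * v"] by (simp add: mult.assoc power2_eq_square)
  have recs: "Re (w ^ 2 * v) = 2 * Re w * Re (w * v) - (norm w)\<^sup>2 * Re v"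
    "Re (w ^ 3 * v) = 2 * Re w * Re (w ^ 2 * v) - (norm w)\<^sup>2 * Re (w * v)"
    "Re (w ^ 4 * v) = 2 * Re w * Re (w ^ 3 * v) - (norm w)\<^sup>2 * Re (w ^ 2 * v)" for w v
    using rec[of w 0 v] rec[of w 1 v] rec[of w 2 v] by (simp_all add: eval_nat_numeral)
  have bd: "\<bar>Re (\<theta> ^ k * z)\<bar> \<le> b ^ k * norm z" for k
    using norm_power_shift_le[of z "norm z" \<theta> b k] \<theta> by (intro order_trans[OF abs_Re_le_cmod]) auto
  have A: "\<bar>2 * Re \<theta>'\<bar> \<le> 2 * b" using \<theta>(2) abs_Re_le_cmod[of \<theta>'] by simp
  have B: "\<bar>(norm \<theta>')\<^sup>2\<bar> \<le> b\<^sup>2" using \<theta>(2) by (simp add: power_mono)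
  have "(norm z)\<^sup>2 * \<eta>\<^sup>2 \<le> (norm z)\<^sup>2 * (Im \<theta>)\<^sup>2"
    using \<theta> by (intro mult_left_mono power_mono) auto
  then have D: "(norm z)\<^sup>2 * \<eta>\<^sup>2 \<le> (Re (\<theta> * z))\<^sup>2 - Re z * Re (\<theta> ^ 2 * z)"
    using Re_casoratian[of \<theta> z] by (simp add: power2_eq_square mult.assoc)
  have x: "0 < norm z" "\<bar>Re z\<bar> \<le> norm z" "\<bar>Re (\<theta> * z)\<bar> \<le> b * norm z"
      "\<bar>Re (\<theta> ^ 2 * z)\<bar> \<le> b\<^sup>2 * norm z" "\<bar>Re (\<theta> ^ 3 * z)\<bar> \<le> b ^ 3 * norm z"
    using z bd[of 0] bd[of 1] bd[of 2] bd[of 3] by (simp_all only: power_0 power_one_right mult_1 zero_less_norm_iff not_False_eq_True)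
  have d': "\<bar>Re z - Re z'\<bar> \<le> d" "\<bar>Re (\<theta> * z) - Re (\<theta>' * z')\<bar> \<le> d"
      "\<bar>Re (\<theta> ^ 2 * z) - Re (\<theta>' ^ 2 * z')\<bar> \<le> d" "\<bar>Re (\<theta> ^ 3 * z) - Re (\<theta>' ^ 3 * z')\<bar> \<le> d"
    using d[of 0] d[of 1] d[of 2] d[of 3] by simp_all
  show "\<bar>2 * Re \<theta> - 2 * Re \<theta>'\<bar> \<le> P * d / norm z" "\<bar>(norm \<theta>)\<^sup>2 - (norm \<theta>')\<^sup>2\<bar> \<le> P * d / norm z"
    "\<bar>Re (\<theta> ^ 4 * z) - Re (\<theta>' ^ 4 * z')\<bar> \<le> (P * (b ^ 3 + b\<^sup>2) + S) * d"
    unfolding P_def S_def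
    by (rule recurrence_compare[OF recs[of \<theta> z] recs[of \<theta>' z'] A B \<theta>(3) x \<theta>(5) D d'])+
qed

text \<open>The order of quantifiers matters: \<rho> depends on the region only and \<delta> on s,
  so that one \<rho> can be kept while s tends to 0.\<close>

theorem Erdos_Kahane_bases:
  assumes b: "1 < b1" "b1 \<le> b2" and \<eta>: "0 < \<eta>"
  shows "\<exists>\<rho>>0. \<forall>s>0. \<exists>\<delta>>0.
    hausdorff_measure s {\<theta> \<in> region_H b1 b2 \<eta>. \<not> frequently_in (off_integer \<rho>) b2 \<delta> \<theta>} = 0"
proof -
  define S where "S = 1 + 2 * b2 + b2\<^sup>2"
  define P where "P = S * (b2 + b2\<^sup>2) / \<eta>\<^sup>2"
  define C where "C = P * (b2 ^ 3 + b2\<^sup>2) + S"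
  have P: "0 \<le> P" and C: "0 \<le> C" using b by (auto simp: P_def S_def C_def)
  \<comment> \<open>Equal codes without deviation put four terms within 2 \<rho> of each other,
    hence the next terms within 2 C \<rho>. If these are \<rho>-close to integers as well, the
    integers differ by at most 2 C \<rho> + 2 \<rho> = 1 - 2 \<rho>, so they agree.\<close>
  define \<rho> where "\<rho> = 1 / (2 * (C + 2))"
  have \<rho>: "0 < \<rho>" "C * (2 * \<rho>) + 2 * \<rho> < 1" 
  proof -
    show "0 < \<rho>" using C by (simp add: \<rho>_def)
    moreover have "2 * \<rho> * (C + 2) = 1" using C by (simp add: \<rho>_def)
    ultimately show "C * (2 * \<rho>) + 2 * \<rho> < 1" by (simp add: algebra_simps)
  qed
  define T where "T = region_H b1 b2 \<eta> \<times> {t :: complex. 1 \<le> norm t \<and> norm t \<le> b2}"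
  define K where "K = (\<lambda>(\<theta>, t) n. round (Re (\<theta> ^ n * t)))"
  define I where "I = (\<lambda>(\<theta>, t). {n. off_integer \<rho> (\<theta> ^ n * t)})"
  \<comment> \<open>Equal preceding codes only give differences of at most 1, so the next terms
    differ by at most C and, after rounding, their integers by at most \<lceil>C\<rceil> + 1; Q
    counts the integers in that range.\<close>
  define Q where "Q = nat (2 * (\<lceil>C\<rceil> + 1) + 1)"
  have close: "\<bar>Re (\<theta> ^ m * t) - Re (\<theta>' ^ m * t')\<bar> \<le> 1"
    if "\<forall>m<n. K (\<theta>', t') m = K (\<theta>, t) m" "m < n" for \<theta> \<theta>' t t' :: complex and m n :: nat
    using that by (intro round_eq_diff_le_1) (auto simp: K_def)
  have next_term: "\<bar>Re (\<theta> ^ n * t) - Re (\<theta>' ^ n * t')\<bar> \<le> C * d"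
    if T: "(\<theta>, t) \<in> T" "(\<theta>', t') \<in> T" and n: "4 \<le> n"
      and d: "\<And>m. m \<in> {n - 4..<n} \<Longrightarrow> \<bar>Re (\<theta> ^ m * t) - Re (\<theta>' ^ m * t')\<bar> \<le> d" for \<theta> \<theta>' t t' n d
  proof -
    have "\<bar>Re (\<theta> ^ 4 * (\<theta> ^ (n - 4) * t)) - Re (\<theta>' ^ 4 * (\<theta>' ^ (n - 4) * t'))\<bar> \<le> C * d"
      unfolding C_def P_def S_def
    proof (rule orbit_compare(3))
      fix k :: nat assume "k < 4"
      then show "\<bar>Re (\<theta> ^ k * (\<theta> ^ (n - 4) * t)) - Re (\<theta>' ^ k * (\<theta>' ^ (n - 4) * t'))\<bar> \<le> d"
        unfolding power_shift using n by (intro d) auto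
    qed (use T b \<eta> in \<open>auto simp: T_def region_H_def\<close>)
    then show ?thesis using n by (simp only: power_shift le_add_diff_inverse2)
  qed
  interpret coded_family T K I "card ((\<lambda>\<tau>. map (K \<tau>) [0..<4]) ` T)" Q
  proof
    \<comment> \<open>The first four terms have modulus at most b2 ^ (m + 1) <= b2 ^ 4; the added 1
      absorbs the rounding.\<close>
    let ?F = "{- \<lceil>b2 ^ 4 + 1\<rceil>..\<lceil>b2 ^ 4 + 1\<rceil>}"
    have "K \<tau> m \<in> ?F" if "\<tau> \<in> T" "m < 4" for \<tau> m
    proof -
      obtain \<theta> t where \<tau>: "\<tau> = (\<theta>, t)" by (cases \<tau>)
      have "\<bar>Re (\<theta> ^ m * t)\<bar> \<le> b2 ^ m * b2"
        using \<open>\<tau> \<in> T\<close> b unfolding \<tau>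
        by (intro order_trans[OF abs_Re_le_cmod] norm_power_shift_le) (auto simp: T_def region_H_def)
      also have "\<dots> = b2 ^ Suc m" by simp
      also have "\<dots> \<le> b2 ^ 4" using that b by (intro power_increasing) auto
      finally have "\<bar>Re (\<theta> ^ m * t)\<bar> \<le> b2 ^ 4" .
      then have "\<bar>real_of_int (round (Re (\<theta> ^ m * t)))\<bar> \<le> b2 ^ 4 + 1"
        using of_int_round_abs_le[of "Re (\<theta> ^ m * t)"] by linarith
      then show ?thesis unfolding \<tau> K_def by simp linarith
    qed
    then have "(\<lambda>\<tau>. map (K \<tau>) [0..<4]) ` T \<subseteq> {xs. set xs \<subseteq> ?F \<and> length xs = 4}"
      by (auto simp del: upt_rec_numeral)
    then show "finite ((\<lambda>\<tau>. map (K \<tau>) [0..<4]) ` T)"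
      by (rule finite_subset) (intro finite_lists_length_eq finite_atLeastAtMost_int)
    show "1 \<le> Q" using C by (simp add: Q_def) linarith
    fix n :: nat and \<tau> assume n: "4 \<le> n" and \<tau>: "\<tau> \<in> T"
    obtain \<theta> t where \<tau>_eq: "\<tau> = (\<theta>, t)" by (cases \<tau>)
    let ?V = "(\<lambda>\<tau>'. K \<tau>' n) ` {\<tau>' \<in> T. \<forall>m<n. K \<tau>' m = K \<tau> m}"
    have sub: "?V \<subseteq> {K \<tau> n - (\<lceil>C\<rceil> + 1)..K \<tau> n + (\<lceil>C\<rceil> + 1)}"
    proof
      fix v assume "v \<in> ?V"
      then obtain \<theta>' t' where \<tau>': "(\<theta>', t') \<in> T" "\<forall>m<n. K (\<theta>', t') m = K (\<theta>, t) m" "v = K (\<theta>', t') n"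
        unfolding \<tau>_eq by auto
      have "\<bar>Re (\<theta> ^ n * t) - Re (\<theta>' ^ n * t')\<bar> \<le> C * 1"
        using \<tau> close[OF \<tau>'(2)] unfolding \<tau>_eq by (intro next_term \<tau>' n) auto
      then have "\<bar>K (\<theta>, t) n - v\<bar> \<le> \<lceil>C\<rceil> + 1"
        unfolding \<tau>'(3) K_def using round_diff_bound by simp
      then show "v \<in> {K \<tau> n - (\<lceil>C\<rceil> + 1)..K \<tau> n + (\<lceil>C\<rceil> + 1)}" unfolding \<tau>_eq by (simp, linarith)
    qed
    have "card {K \<tau> n - (\<lceil>C\<rceil> + 1)..K \<tau> n + (\<lceil>C\<rceil> + 1)} = Q" by (simp add: Q_def)
    then show "finite ?V \<and> card ?V \<le> Q"
      using sub finite_subset[OF sub] card_mono[OF _ sub] by auto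
    fix \<tau>' assume \<tau>': "\<tau>' \<in> T" "\<forall>m<n. K \<tau>' m = K \<tau> m" "{n - 4..n} \<inter> (I \<tau> \<union> I \<tau>') = {}"
    obtain \<theta>' t' where \<tau>'_eq: "\<tau>' = (\<theta>', t')" by (cases \<tau>')
    have near: "\<not> off_integer \<rho> (\<theta> ^ m * t)" "\<not> off_integer \<rho> (\<theta>' ^ m * t')" if "m \<in> {n - 4..n}" for m
      using \<tau>'(3) that unfolding \<tau>_eq \<tau>'_eq I_def by auto
    have "\<bar>Re (\<theta> ^ n * t) - Re (\<theta>' ^ n * t')\<bar> \<le> C * (2 * \<rho>)"
    proof (rule next_term)
      fix m assume "m \<in> {n - 4..<n}"
      then show "\<bar>Re (\<theta> ^ m * t) - Re (\<theta>' ^ m * t')\<bar> \<le> 2 * \<rho>"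
        using \<tau>'(2) unfolding \<tau>_eq \<tau>'_eq by (intro near_integer_diff near) (auto simp: K_def)
    qed (use n \<tau> \<tau>' \<tau>_eq \<tau>'_eq in auto)
    then have "round (Re (\<theta> ^ n * t)) = round (Re (\<theta>' ^ n * t'))"
      using \<rho> by (intro near_integer_eq[OF near]) auto
    then show "K \<tau>' n = K \<tau> n" unfolding \<tau>_eq \<tau>'_eq K_def by simp
  qed simp
  \<comment> \<open>The system is solved from the last four terms, starting at index N - 4, where
    the orbit has modulus at least b1 ^ (N - 4). The bracket adds the error in Re \<theta> and the
    resulting error in Im \<theta>.\<close>
  define G where "G = P * b1 ^ 4 * (1 + (1 + b2) / \<eta>)"
  have loc: "dist (fst \<tau>) (fst \<tau>') \<le> G * (1 / b1) ^ N"
    if N: "4 \<le> N" and "\<tau> \<in> T" "\<tau>' \<in> T" and eq: "\<forall>m<N. K \<tau>' m = K \<tau> m" for N \<tau> \<tau>'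
  proof -
    obtain \<theta> t \<theta>' t' where \<tau>: "\<tau> = (\<theta>, t)" "\<tau>' = (\<theta>', t')" by (cases \<tau>, cases \<tau>')
    have T: "norm \<theta> \<le> b2" "b1 \<le> norm \<theta>" "\<eta> < Im \<theta>" "norm \<theta>' \<le> b2" "\<eta> < Im \<theta>'" "1 \<le> norm t" "t \<noteq> 0" "\<theta> \<noteq> 0"
      using that(2,3) b unfolding \<tau> by (auto simp: T_def region_H_def)
    define z where "z = \<theta> ^ (N - 4) * t"
    define c where "c = P * b1 ^ 4 * (1 / b1) ^ N"
    have d: "\<bar>Re (\<theta> ^ k * z) - Re (\<theta>' ^ k * (\<theta>' ^ (N - 4) * t'))\<bar> \<le> 1" if "k < 4" for k
      unfolding z_def power_shift by (rule close[OF eq[unfolded \<tau>]]) (use that N in auto)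
    have zb: "b1 ^ (N - 4) \<le> norm z"
    proof -
      have "b1 ^ (N - 4) * 1 \<le> norm \<theta> ^ (N - 4) * norm t"
        using T b by (intro mult_mono power_mono) auto
      then show ?thesis by (simp add: z_def norm_mult norm_power)
    qed
    have z0: "z \<noteq> 0" using T by (simp add: z_def)
    have "P * 1 / norm z \<le> P * 1 / b1 ^ (N - 4)"
      using P zb b z0 by (intro divide_left_mono mult_pos_pos) auto
    also have "\<dots> = c" using N b by (simp add: c_def power_diff power_one_over field_simps)
    finally have c: "P * 1 / norm z \<le> c" .
    note cmp = orbit_compare[OF T(1) T(4) _ T(3) \<eta> z0 d, folded S_def, folded P_def]
    have A: "\<bar>2 * Re \<theta> - 2 * Re \<theta>'\<bar> \<le> c" and B: "\<bar>(norm \<theta>)\<^sup>2 - (norm \<theta>')\<^sup>2\<bar> \<le> c"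
      using order_trans[OF cmp(1) c] order_trans[OF cmp(2) c] b by auto
    have c0: "0 \<le> c" using A by linarith
    have Re: "\<bar>Re \<theta> - Re \<theta>'\<bar> \<le> c" using A by linarith
    \<comment> \<open>Only the square of Im \<theta> is recovered from the coefficients. Both
      parameters lie in the upper half-plane, so the factor Im \<theta> + Im \<theta>' stays above
      \<eta> and can be divided out.\<close>
    have "(Im \<theta> - Im \<theta>') * (Im \<theta> + Im \<theta>') =
        ((norm \<theta>)\<^sup>2 - (norm \<theta>')\<^sup>2) - (Re \<theta> - Re \<theta>') * (Re \<theta> + Re \<theta>')"
      by (simp add: cmod_power2) (simp add: power2_eq_square algebra_simps)
    then have "\<bar>Im \<theta> - Im \<theta>'\<bar> * \<bar>Im \<theta> + Im \<theta>'\<bar> \<le> c + \<bar>Re \<theta> - Re \<theta>'\<bar> * \<bar>Re \<theta> + Re \<theta>'\<bar>"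
      using B by (simp add: abs_mult[symmetric])
    also have "\<dots> \<le> c + (c / 2) * (2 * b2)"
      using A T(1,4) abs_Re_le_cmod[of \<theta>] abs_Re_le_cmod[of \<theta>'] c0
      by (intro add_left_mono mult_mono) linarith+
    also have "\<dots> = c * (1 + b2)" by (simp add: algebra_simps)
    finally have "\<bar>Im \<theta> - Im \<theta>'\<bar> * \<eta> \<le> c * (1 + b2)"
      using T \<eta> by (smt (verit) mult_left_mono abs_ge_zero)
    then have Im: "\<bar>Im \<theta> - Im \<theta>'\<bar> \<le> c * (1 + b2) / \<eta>" using \<eta> by (simp add: pos_le_divide_eq)
    have "dist \<theta> \<theta>' \<le> \<bar>Re (\<theta> - \<theta>')\<bar> + \<bar>Im (\<theta> - \<theta>')\<bar>" unfolding dist_norm by (rule cmod_le)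
    also have "\<dots> \<le> c + c * (1 + b2) / \<eta>" using Re Im by simp
    also have "\<dots> = G * (1 / b1) ^ N" by (simp add: G_def c_def algebra_simps)
    finally show ?thesis by (simp add: \<tau>)
  qed
  have "\<exists>\<delta>>0. hausdorff_measure s {\<theta> \<in> region_H b1 b2 \<eta>. \<not> frequently_in (off_integer \<rho>) b2 \<delta> \<theta>} = 0"
    if s: "0 < s" for s
  proof -
    have "\<exists>\<delta>>0. hausdorff_measure s
        {z. \<exists>\<^sub>\<infinity>N. \<exists>\<tau>\<in>T. fst \<tau> = z \<and> real (card (I \<tau> \<inter> {..<N})) < \<delta> * real N} = 0"
    proof (rule hausdorff_null_rare[OF s])
      show "0 < 1 / b1" "1 / b1 < 1" "0 \<le> G" using b \<eta> P by (auto simp: G_def)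
    qed (rule loc)
    then obtain \<delta> where \<delta>: "0 < \<delta>" "hausdorff_measure s
        {z. \<exists>\<^sub>\<infinity>N. \<exists>\<tau>\<in>T. fst \<tau> = z \<and> real (card (I \<tau> \<inter> {..<N})) < \<delta> * real N} = 0"
      by blast
    have "{\<theta> \<in> region_H b1 b2 \<eta>. \<not> frequently_in (off_integer \<rho>) b2 \<delta> \<theta>} \<subseteq>
        {z. \<exists>\<^sub>\<infinity>N. \<exists>\<tau>\<in>T. fst \<tau> = z \<and> real (card (I \<tau> \<inter> {..<N})) < \<delta> * real N}"
    proof
      fix \<theta> assume \<theta>: "\<theta> \<in> {\<theta> \<in> region_H b1 b2 \<eta>. \<not> frequently_in (off_integer \<rho>) b2 \<delta> \<theta>}"
      then have "\<exists>\<^sub>\<infinity>N. \<exists>t. 1 \<le> norm t \<and> norm t \<le> b2 \<and>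
          real (card ({n. off_integer \<rho> (\<theta> ^ n * t)} \<inter> {..<N})) < \<delta> * real N"
        by (intro not_frequently_in) simp
      then have "\<exists>\<^sub>\<infinity>N. \<exists>\<tau>\<in>T. fst \<tau> = \<theta> \<and> real (card (I \<tau> \<inter> {..<N})) < \<delta> * real N"
        by (rule INFM_mono) (use \<theta> in \<open>force simp: T_def I_def\<close>)
      then show "\<theta> \<in> {z. \<exists>\<^sub>\<infinity>N. \<exists>\<tau>\<in>T. fst \<tau> = z \<and> real (card (I \<tau> \<inter> {..<N})) < \<delta> * real N}" by simp
    qed
    then show ?thesis using \<delta> hausdorff_null_subset[OF s] by blast
  qed
  then show ?thesis using \<rho>(1) by blast
qed

text \<open>For nonreal \<theta>, two consecutive real parts determine the point: Im \<theta> Im w =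
  Re \<theta> Re w - Re (\<theta> w).\<close>

lemma norm_le_of_Re_two_steps:
  assumes "norm \<theta> \<le> b" "Im \<theta> \<noteq> 0" "\<bar>Re w\<bar> \<le> 1" "\<bar>Re (\<theta> * w)\<bar> \<le> 1"
  shows "norm w \<le> 1 + (1 + b) / \<bar>Im \<theta>\<bar>"
proof -
  have "Im \<theta> * Im w = Re \<theta> * Re w - Re (\<theta> * w)" by simp
  then have "\<bar>Im \<theta>\<bar> * \<bar>Im w\<bar> \<le> \<bar>Re \<theta>\<bar> * \<bar>Re w\<bar> + \<bar>Re (\<theta> * w)\<bar>"
    unfolding abs_mult[symmetric] by (metis abs_triangle_ineq4)
  also have "\<dots> \<le> b * 1 + 1"
    using assms abs_Re_le_cmod[of \<theta>] by (intro add_mono mult_mono) auto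
  finally have "\<bar>Im w\<bar> \<le> (1 + b) / \<bar>Im \<theta>\<bar>"
    using assms(2) by (simp add: pos_le_divide_eq mult.commute)
  then show ?thesis using assms(3) cmod_le[of w] by linarith
qed

text \<open>With \<theta> fixed, the difference of two orbits is again an orbit of \<theta>, so the
  recurrence is known exactly. Two preceding terms predict the next, and the constant is just C = 2
  b + b^2. Again \<rho> precedes R and s, which allows an exhaustion by discs.\<close>

theorem Erdos_Kahane_ratios:
  assumes \<theta>: "1 < norm \<theta>" "Im \<theta> \<noteq> 0"
  shows "\<exists>\<rho>>0. \<forall>R s. 0 \<le> R \<longrightarrow> 0 < s \<longrightarrow> (\<exists>\<delta>>0.
    hausdorff_measure s {u \<in> cball 0 R.
      \<not> frequently_in (\<lambda>z. off_integer \<rho> z \<or> off_integer \<rho> (u * z)) (norm \<theta>) \<delta> \<theta>} = 0)"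
proof -
  define b where "b = norm \<theta>"
  define C where "C = 2 * b + b\<^sup>2"
  have b: "1 < b" using \<theta> by (simp add: b_def)
  have C: "0 \<le> C" using b by (simp add: C_def)
  define \<rho> where "\<rho> = 1 / (2 * (C + 2))"
  have \<rho>: "0 < \<rho>" "C * (2 * \<rho>) + 2 * \<rho> < 1"
  proof -
    show "0 < \<rho>" using C by (simp add: \<rho>_def)
    moreover have "2 * \<rho> * (C + 2) = 1" using C by (simp add: \<rho>_def)
    ultimately show "C * (2 * \<rho>) + 2 * \<rho> < 1" by (simp add: algebra_simps)
  qed
  have next_term: "\<bar>Re (\<theta> ^ n * z) - Re (\<theta> ^ n * w)\<bar> \<le> C * d"
    if "2 \<le> n" and d: "\<And>m. m \<in> {n - 2..<n} \<Longrightarrow> \<bar>Re (\<theta> ^ m * z) - Re (\<theta> ^ m * w)\<bar> \<le> d" for z w n d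
  proof -
    define v where "v = \<theta> ^ (n - 2) * (z - w)"
    have n: "\<theta> ^ n = \<theta> * (\<theta> * \<theta> ^ (n - 2))" "\<theta> ^ (n - 1) = \<theta> * \<theta> ^ (n - 2)"
    proof -
      have "Suc (Suc (n - 2)) = n" "Suc (n - 2) = n - 1" using \<open>2 \<le> n\<close> by auto
      then show "\<theta> ^ n = \<theta> * (\<theta> * \<theta> ^ (n - 2))" "\<theta> ^ (n - 1) = \<theta> * \<theta> ^ (n - 2)"
        by (metis power_Suc)+
    qed
    have diffs: "Re (\<theta> ^ n * z) - Re (\<theta> ^ n * w) = Re (\<theta> * (\<theta> * v))"
      "Re (\<theta> ^ (n - 1) * z) - Re (\<theta> ^ (n - 1) * w) = Re (\<theta> * v)"
      "Re (\<theta> ^ (n - 2) * z) - Re (\<theta> ^ (n - 2) * w) = Re v"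
      unfolding n v_def minus_complex.simps(1)[symmetric] by (simp_all add: algebra_simps)
    have "\<bar>Re (\<theta> * v)\<bar> \<le> d" "\<bar>Re v\<bar> \<le> d"
      using d[of "n - 1"] d[of "n - 2"] \<open>2 \<le> n\<close> unfolding diffs by auto
    moreover have "\<bar>Re (\<theta> * (\<theta> * v))\<bar> \<le> \<bar>2 * Re \<theta>\<bar> * \<bar>Re (\<theta> * v)\<bar> + \<bar>(norm \<theta>)\<^sup>2\<bar> * \<bar>Re v\<bar>"
      unfolding Re_recurrence abs_mult[symmetric] by (rule abs_triangle_ineq4)
    moreover have "\<bar>2 * Re \<theta>\<bar> \<le> 2 * b" using abs_Re_le_cmod[of \<theta>] by (simp add: b_def)
    ultimately have "\<bar>Re (\<theta> * (\<theta> * v))\<bar> \<le> (2 * b) * d + b\<^sup>2 * d"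
      using b by (elim order_trans) (intro add_mono mult_mono, auto simp: b_def)
    then show ?thesis unfolding diffs C_def by (simp add: algebra_simps)
  qed
  have "\<exists>\<delta>>0. hausdorff_measure s {u \<in> cball 0 R.
      \<not> frequently_in (\<lambda>z. off_integer \<rho> z \<or> off_integer \<rho> (u * z)) b \<delta> \<theta>} = 0"
    if R: "0 \<le> R" and s: "0 < s" for R s
  proof -
    define T where "T = cball (0::complex) R \<times> {t :: complex. 1 \<le> norm t \<and> norm t \<le> b}"
    define K where "K = (\<lambda>(u, t) n. (round (Re (\<theta> ^ n * t)), round (Re (\<theta> ^ n * (u * t)))))"
    define I where "I = (\<lambda>(u, t). {n. off_integer \<rho> (\<theta> ^ n * t) \<or> off_integer \<rho> (u * (\<theta> ^ n * t))})"
    define M where "M = \<lceil>C\<rceil> + 1"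
    \<comment> \<open>A code letter is a pair of integers, one for t and one for u t, with 2 M + 1
      choices in each component.\<close>
    define Q where "Q = nat (2 * M + 1) * nat (2 * M + 1)"
    have close: "\<bar>Re (\<theta> ^ m * t) - Re (\<theta> ^ m * t')\<bar> \<le> 1"
        "\<bar>Re (\<theta> ^ m * (u * t)) - Re (\<theta> ^ m * (u' * t'))\<bar> \<le> 1"
      if "\<forall>m<n. K (u', t') m = K (u, t) m" "m < n" for u u' t t' :: complex and m n :: nat
      using that by (auto intro!: round_eq_diff_le_1 simp: K_def)
    interpret coded_family T K I "card ((\<lambda>\<tau>. map (K \<tau>) [0..<4]) ` T)" Q
    proof
      let ?c = "\<lceil>b ^ 4 * (1 + R) + 1\<rceil>"
      define F where "F = {- ?c..?c} \<times> {- ?c..?c}"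
      have rd: "round (Re (\<theta> ^ m * v)) \<in> {- ?c..?c}" if "m < 4" "norm v \<le> b * (1 + R)" for m v
      proof -
        have "\<bar>Re (\<theta> ^ m * v)\<bar> \<le> b ^ m * (b * (1 + R))"
          using that b by (intro order_trans[OF abs_Re_le_cmod] norm_power_shift_le) (auto simp: b_def)
        also have "\<dots> = b ^ Suc m * (1 + R)" by simp
        also have "\<dots> \<le> b ^ 4 * (1 + R)" using that b R by (intro mult_right_mono power_increasing) auto
        finally have "\<bar>real_of_int (round (Re (\<theta> ^ m * v)))\<bar> \<le> b ^ 4 * (1 + R) + 1"
          using of_int_round_abs_le[of "Re (\<theta> ^ m * v)"] by linarith
        then show ?thesis unfolding atLeastAtMost_iff by linarith
      qed
      have "K \<tau> m \<in> F" if "\<tau> \<in> T" "m < 4" for \<tau> m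
      proof -
        obtain u t where \<tau>: "\<tau> = (u, t)" by (cases \<tau>)
        have t: "norm t \<le> b" "norm u \<le> R" using that by (auto simp: T_def \<tau>)
        then have "norm (u * t) \<le> R * b" unfolding norm_mult using R by (intro mult_mono) auto
        then have le: "norm t \<le> b * (1 + R)" "norm (u * t) \<le> b * (1 + R)"
          using t R b mult_nonneg_nonneg[of R b] unfolding distrib_left mult_1_right mult.commute[of b R]
          by linarith+
        show ?thesis
          unfolding \<tau> K_def F_def split mem_Times_iff fst_conv snd_conv by (intro conjI rd[OF that(2)] le)
      qed
      then have "(\<lambda>\<tau>. map (K \<tau>) [0..<4]) ` T \<subseteq> {xs. set xs \<subseteq> F \<and> length xs = 4}"
        by (auto simp del: upt_rec_numeral)
      then show "finite ((\<lambda>\<tau>. map (K \<tau>) [0..<4]) ` T)"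
        by (rule finite_subset) (intro finite_lists_length_eq, simp add: F_def)
      have M: "1 \<le> M" using C by (simp add: M_def)
      then show "1 \<le> Q" by (simp add: Q_def)
      fix n :: nat and \<tau> assume n: "4 \<le> n" and \<tau>: "\<tau> \<in> T"
      obtain u t where \<tau>_eq: "\<tau> = (u, t)" by (cases \<tau>)
      let ?V = "(\<lambda>\<tau>'. K \<tau>' n) ` {\<tau>' \<in> T. \<forall>m<n. K \<tau>' m = K \<tau> m}"
      let ?B = "{fst (K \<tau> n) - M..fst (K \<tau> n) + M} \<times> {snd (K \<tau> n) - M..snd (K \<tau> n) + M}"
      have sub: "?V \<subseteq> ?B"
      proof
        fix v assume "v \<in> ?V"
        then obtain u' t' where \<tau>': "\<forall>m<n. K (u', t') m = K (u, t) m" "v = K (u', t') n"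
          unfolding \<tau>_eq by auto
        have "\<bar>Re (\<theta> ^ n * t) - Re (\<theta> ^ n * t')\<bar> \<le> C * 1"
          using close[OF \<tau>'(1)] n by (intro next_term) auto
        then have 1: "\<bar>round (Re (\<theta> ^ n * t)) - round (Re (\<theta> ^ n * t'))\<bar> \<le> M"
          unfolding M_def using round_diff_bound by simp
        have "\<bar>Re (\<theta> ^ n * (u * t)) - Re (\<theta> ^ n * (u' * t'))\<bar> \<le> C * 1"
          using close[OF \<tau>'(1)] n by (intro next_term) auto
        then have 2: "\<bar>round (Re (\<theta> ^ n * (u * t))) - round (Re (\<theta> ^ n * (u' * t')))\<bar> \<le> M"
          unfolding M_def using round_diff_bound by simp
        show "v \<in> ?B" using 1 2 unfolding \<tau>_eq \<tau>'(2) K_def by (simp only: mem_Times_iff split fst_conv snd_conv atLeastAtMost_iff) linarith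
      qed
      have "card ?B = Q" "finite ?B" by (simp_all add: Q_def card_cartesian_product)
      then show "finite ?V \<and> card ?V \<le> Q"
        using sub finite_subset[OF sub] card_mono[OF _ sub] by auto
      fix \<tau>' assume \<tau>': "\<tau>' \<in> T" "\<forall>m<n. K \<tau>' m = K \<tau> m" "{n - 4..n} \<inter> (I \<tau> \<union> I \<tau>') = {}"
      obtain u' t' where \<tau>'_eq: "\<tau>' = (u', t')" by (cases \<tau>')
      have near: "\<not> off_integer \<rho> (\<theta> ^ m * t)" "\<not> off_integer \<rho> (\<theta> ^ m * t')"
          "\<not> off_integer \<rho> (\<theta> ^ m * (u * t))" "\<not> off_integer \<rho> (\<theta> ^ m * (u' * t'))"
        if "m \<in> {n - 4..n}" for m
        using \<tau>'(3) that unfolding \<tau>_eq \<tau>'_eq I_def by (auto simp: mult.left_commute)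
      have rounds: "round (Re (\<theta> ^ m * t)) = round (Re (\<theta> ^ m * t'))"
          "round (Re (\<theta> ^ m * (u * t))) = round (Re (\<theta> ^ m * (u' * t')))" if "m < n" for m
        using \<tau>'(2) that unfolding \<tau>_eq \<tau>'_eq K_def by auto
      have "\<bar>Re (\<theta> ^ n * t) - Re (\<theta> ^ n * t')\<bar> \<le> C * (2 * \<rho>)"
        using n by (intro next_term near_integer_diff near rounds) auto
      then have 1: "round (Re (\<theta> ^ n * t)) = round (Re (\<theta> ^ n * t'))"
        using \<rho> by (intro near_integer_eq[OF near(1,2)]) auto
      have "\<bar>Re (\<theta> ^ n * (u * t)) - Re (\<theta> ^ n * (u' * t'))\<bar> \<le> C * (2 * \<rho>)"
        using n by (intro next_term near_integer_diff near rounds) auto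
      then have 2: "round (Re (\<theta> ^ n * (u * t))) = round (Re (\<theta> ^ n * (u' * t')))"
        using \<rho> by (intro near_integer_eq[OF near(3,4)]) auto
      show "K \<tau>' n = K \<tau> n" unfolding \<tau>_eq \<tau>'_eq K_def using 1 2 by simp
    qed simp
    define G where "G = 1 + (1 + b) / \<bar>Im \<theta>\<bar>"
    have G: "0 \<le> G" using b by (simp add: G_def)
    have loc: "dist (fst \<tau>) (fst \<tau>') \<le> G * (1 + R) * b\<^sup>2 * (1 / b) ^ N"
      if N: "4 \<le> N" and "\<tau> \<in> T" "\<tau>' \<in> T" and eq: "\<forall>m<N. K \<tau>' m = K \<tau> m" for N \<tau> \<tau>'
    proof -
      obtain u t u' t' where \<tau>: "\<tau> = (u, t)" "\<tau>' = (u', t')" by (cases \<tau>, cases \<tau>')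
      have T: "norm u' \<le> R" "1 \<le> norm t" "t \<noteq> 0" "\<theta> \<noteq> 0"
        using that(2,3) \<theta> unfolding \<tau> by (auto simp: T_def)
      define p where "p = \<theta> ^ (N - 2)"
      have norm_p: "norm p = b ^ (N - 2)" by (simp add: p_def norm_power b_def)
      have p1: "\<theta> * p = \<theta> ^ (N - 1)"
      proof -
        have "Suc (N - 2) = N - 1" using N by simp
        then show ?thesis unfolding p_def by (metis power_Suc)
      qed
      have small: "norm (p * (v - w)) \<le> G"
        if "\<And>m. m < N \<Longrightarrow> \<bar>Re (\<theta> ^ m * v) - Re (\<theta> ^ m * w)\<bar> \<le> 1" for v w
        unfolding G_def
      proof (rule norm_le_of_Re_two_steps)
        show "\<bar>Re (p * (v - w))\<bar> \<le> 1"
          using that[of "N - 2"] N unfolding p_def right_diff_distrib minus_complex.simps by simp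
        show "\<bar>Re (\<theta> * (p * (v - w)))\<bar> \<le> 1"
          using that[of "N - 1"] N unfolding mult.assoc[symmetric] p1 right_diff_distrib minus_complex.simps by simp
      qed (use \<theta> in \<open>auto simp: b_def\<close>)
      have 1: "norm (p * (t - t')) \<le> G" and 2: "norm (p * (u * t - u' * t')) \<le> G"
        using close[OF eq[unfolded \<tau>]] by (auto intro!: small)
      \<comment> \<open>The codes localise t and u t separately, and u is their quotient. Cleared of
        denominators, the error in u is divided by |p t|, which grows like b ^ N.\<close>
      have "p * t * (u - u') = p * (u * t - u' * t') - u' * (p * (t - t'))"
        by (simp add: algebra_simps)
      then have "norm (p * t) * norm (u - u') \<le> norm (p * (u * t - u' * t')) + norm u' * norm (p * (t - t'))"
        unfolding norm_mult[symmetric] by (metis norm_triangle_ineq4)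
      also have "\<dots> \<le> G + R * G"
        using 1 2 T R G by (intro add_mono mult_mono) auto
      finally have a: "norm (p * t) * norm (u - u') \<le> G * (1 + R)" by (simp add: algebra_simps)
      have "b ^ (N - 2) * 1 \<le> norm (p * t)"
        unfolding norm_mult norm_p using T b by (intro mult_left_mono) auto
      then have "b ^ (N - 2) * norm (u - u') \<le> norm (p * t) * norm (u - u')"
        by (intro mult_right_mono) auto
      with a have "norm (u - u') \<le> G * (1 + R) / b ^ (N - 2)"
        using b by (simp add: pos_le_divide_eq mult.commute)
      also have "\<dots> = G * (1 + R) * b\<^sup>2 * (1 / b) ^ N"
        using N b by (simp add: power_diff power_one_over field_simps)
      finally show ?thesis by (simp add: \<tau> dist_norm)
    qed
    have "\<exists>\<delta>>0. hausdorff_measure s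
        {z. \<exists>\<^sub>\<infinity>N. \<exists>\<tau>\<in>T. fst \<tau> = z \<and> real (card (I \<tau> \<inter> {..<N})) < \<delta> * real N} = 0"
    proof (rule hausdorff_null_rare[OF s])
      show "0 < 1 / b" "1 / b < 1" "0 \<le> G * (1 + R) * b\<^sup>2" using b R G by auto
    qed (rule loc)
    then obtain \<delta> where \<delta>: "0 < \<delta>" "hausdorff_measure s
        {z. \<exists>\<^sub>\<infinity>N. \<exists>\<tau>\<in>T. fst \<tau> = z \<and> real (card (I \<tau> \<inter> {..<N})) < \<delta> * real N} = 0"
      by blast
    have "{u \<in> cball 0 R. \<not> frequently_in (\<lambda>z. off_integer \<rho> z \<or> off_integer \<rho> (u * z)) b \<delta> \<theta>} \<subseteq>
        {z. \<exists>\<^sub>\<infinity>N. \<exists>\<tau>\<in>T. fst \<tau> = z \<and> real (card (I \<tau> \<inter> {..<N})) < \<delta> * real N}"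
    proof
      fix u assume u: "u \<in> {u \<in> cball 0 R. \<not> frequently_in (\<lambda>z. off_integer \<rho> z \<or> off_integer \<rho> (u * z)) b \<delta> \<theta>}"
      then have "\<exists>\<^sub>\<infinity>N. \<exists>t. 1 \<le> norm t \<and> norm t \<le> b \<and>
          real (card ({n. off_integer \<rho> (\<theta> ^ n * t) \<or> off_integer \<rho> (u * (\<theta> ^ n * t))} \<inter> {..<N})) < \<delta> * real N"
        by (intro not_frequently_in) simp
      then have "\<exists>\<^sub>\<infinity>N. \<exists>\<tau>\<in>T. fst \<tau> = u \<and> real (card (I \<tau> \<inter> {..<N})) < \<delta> * real N"
        by (rule INFM_mono) (use u in \<open>force simp: T_def I_def\<close>)
      then show "u \<in> {z. \<exists>\<^sub>\<infinity>N. \<exists>\<tau>\<in>T. fst \<tau> = z \<and> real (card (I \<tau> \<inter> {..<N})) < \<delta> * real N}" by simp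
    qed
    then show ?thesis using \<delta> hausdorff_null_subset[OF s] by blast
  qed
  then show ?thesis using \<rho>(1) unfolding b_def by blast
qed

section \<open>From frequent deviations to Fourier decay\<close>

text \<open>Contracting y by \<theta>^-N brings it into the annulus 1 <= |t| < |\<theta>|, and the
  contracted orbit of y is the expanding orbit of t read backwards. The conclusion for all large K
  lets several orbits share one truncation.\<close>

lemma off_orbit_product_bound:
  fixes f :: "complex \<Rightarrow> real"
  assumes f: "\<And>z. 0 \<le> f z" "\<And>z. f z \<le> 1" "\<And>z. P z \<Longrightarrow> f z \<le> q" and q: "0 < q" "q < 1"
    and \<theta>: "1 < norm \<theta>" "norm \<theta> \<le> b" and \<delta>: "0 < \<delta>"
    and freq: "\<And>N t. N0 \<le> N \<Longrightarrow> 1 \<le> norm t \<Longrightarrow> norm t \<le> b \<Longrightarrow>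
      \<delta> * real N \<le> real (card {n. n < N \<and> P (\<theta> ^ n * t)})"
    and y: "b ^ Suc N0 \<le> norm y"
  shows "\<exists>N. \<forall>K>N. (\<Prod>k<K. f (inverse \<theta> ^ k * y)) \<le> q powr (\<delta> * (ln (norm y) / ln b - 1))"
proof -
  have b: "1 < b" using \<theta> by simp
  have y1: "1 \<le> norm y" using y one_le_power[of b "Suc N0"] b by linarith
  \<comment> \<open>N is about ln |y| / ln |\<theta>|, hence at least ln |y| / ln b - 1. The lower
    bound on |y| forces N0 <= N, so that the frequency hypothesis applies.\<close>
  define N where "N = (LEAST n. norm y < norm \<theta> ^ Suc n)"
  obtain n where "norm y < norm \<theta> ^ n" using real_arch_pow[OF \<theta>(1)] by blast
  also have "\<dots> \<le> norm \<theta> ^ Suc n" using \<theta> by (intro power_increasing) auto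
  finally have N: "norm y < norm \<theta> ^ Suc N" unfolding N_def by (rule LeastI)
  have N': "norm \<theta> ^ N \<le> norm y"
  proof (cases N)
    case (Suc k)
    then have "k < (LEAST n. norm y < norm \<theta> ^ Suc n)" by (simp add: N_def)
    from not_less_Least[OF this] show ?thesis by (simp add: Suc)
  qed (use y1 in simp)
  have yb: "norm y < b ^ Suc N" using N \<theta> power_mono[of "norm \<theta>" b "Suc N"] by linarith
  then have "b ^ Suc N0 < b ^ Suc N" using y by linarith
  then have "N0 \<le> N" using b by (simp add: power_strict_increasing_iff)
  define t where "t = inverse \<theta> ^ N * y"
  have "norm t = norm y / norm \<theta> ^ N" by (simp add: t_def norm_mult norm_power norm_inverse norm_divide field_simps)
  moreover have "0 < norm \<theta> ^ N" using \<theta> by (intro zero_less_power) linarith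
  ultimately have "1 \<le> norm t" "norm t < norm \<theta>"
    using N N' by (simp_all add: pos_le_divide_eq pos_divide_less_eq)
  then have t: "1 \<le> norm t" "norm t \<le> b" using \<theta> by auto
  have "ln (norm y) \<le> ln (b ^ Suc N)" using yb y1 b by (subst ln_le_cancel_iff) auto
  also have "\<dots> = (real N + 1) * ln b" using b by (subst ln_realpow) auto
  finally have "ln (norm y) / ln b \<le> real N + 1" using b by (simp add: pos_divide_le_eq)
  then have lnN: "ln (norm y) / ln b - 1 \<le> real N" by simp
  have "(\<Prod>k<K. f (inverse \<theta> ^ k * y)) \<le> q powr (\<delta> * (ln (norm y) / ln b - 1))" if "N < K" for K
  proof -
    \<comment> \<open>The reversal n -> N - n carries deviations of t to deviations of y. It lands
      in 1, ..., N, which explains the requirement N < K.\<close>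
    have "(\<lambda>n. N - n) ` {n. n < N \<and> P (\<theta> ^ n * t)} \<subseteq> {k. k < K \<and> P (inverse \<theta> ^ k * y)}"
    proof (intro image_subsetI CollectI conjI)
      fix n assume n: "n \<in> {n. n < N \<and> P (\<theta> ^ n * t)}"
      show "N - n < K" using \<open>N < K\<close> by simp
      have "N = n + (N - n)" using n by simp
      then have "inverse \<theta> ^ N = inverse \<theta> ^ n * inverse \<theta> ^ (N - n)" by (metis power_add)
      moreover have "\<theta> \<noteq> 0" using \<theta> by auto
      then have "\<theta> ^ n * inverse \<theta> ^ n = 1" unfolding power_mult_distrib[symmetric] by simp
      ultimately have "\<theta> ^ n * t = inverse \<theta> ^ (N - n) * y"
        by (simp add: t_def mult.assoc[symmetric])
      then show "P (inverse \<theta> ^ (N - n) * y)" using n by simp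
    qed
    moreover have "inj_on (\<lambda>n. N - n) {n. n < N \<and> P (\<theta> ^ n * t)}"
      by (auto simp: inj_on_def)
    ultimately have card: "card {n. n < N \<and> P (\<theta> ^ n * t)} \<le> card {k. k < K \<and> P (inverse \<theta> ^ k * y)}"
      by (intro card_inj_on_le[of "\<lambda>n. N - n"]) auto
    have "(\<Prod>k<K. f (inverse \<theta> ^ k * y)) \<le> (\<Prod>k<K. if P (inverse \<theta> ^ k * y) then q else 1)"
      using f by (intro prod_mono) auto
    also have "\<dots> = q ^ card {k. k < K \<and> P (inverse \<theta> ^ k * y)}"
      by (simp add: prod.If_cases Int_def Collect_conj_eq[symmetric] lessThan_def)
    also have "\<dots> = q powr real (card {k. k < K \<and> P (inverse \<theta> ^ k * y)})"
      using q by (simp add: powr_realpow)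
    also have "\<dots> \<le> q powr (\<delta> * (ln (norm y) / ln b - 1))"
    proof (rule powr_mono')
      have "\<delta> * (ln (norm y) / ln b - 1) \<le> \<delta> * real N" using lnN \<delta> by (intro mult_left_mono) auto
      also have "\<dots> \<le> real (card {n. n < N \<and> P (\<theta> ^ n * t)})" by (rule freq[OF \<open>N0 \<le> N\<close> t])
      also have "\<dots> \<le> real (card {k. k < K \<and> P (inverse \<theta> ^ k * y)})" using card by simp
      finally show "\<delta> * (ln (norm y) / ln b - 1) \<le> real (card {k. k < K \<and> P (inverse \<theta> ^ k * y)})" .
    qed (use q in auto)
    finally show ?thesis .
  qed
  then show ?thesis by blast
qed

lemma prod_lessThan_add:
  fixes f :: "nat \<Rightarrow> 'a::comm_monoid_mult"
  shows "(\<Prod>n<a + c. f n) = (\<Prod>n<a. f n) * (\<Prod>j<c. f (a + j))"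
  by (induction c) (auto simp: mult.assoc)

lemma prod_lessThan_mult:
  fixes f :: "nat \<Rightarrow> 'a::comm_monoid_mult"
  shows "(\<Prod>n<m * K. f n) = (\<Prod>j<m. \<Prod>k<K. f (m * k + j))"
  by (induction K) (simp_all add: add.commute[of m] prod_lessThan_add prod.distrib)

context ifs_weights
begin

text \<open>The first m K factors split by residues modulo m into m contracted orbits of \<theta> =
  lam^-m, starting at lam^j x with j < m. Each yields the same saving, so the exponent gains the
  factor m: this is the product form of the convolution of m rescaled copies.\<close>

lemma fourier_decay_if_frequently:
  fixes P :: "complex \<Rightarrow> bool"
  assumes D: "D \<noteq> 0" and P: "\<And>\<xi>. P (D * cnj \<xi>) \<Longrightarrow> norm (mask \<xi>) \<le> q" and q: "0 < q" "q < 1"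
    and m: "1 \<le> m" and lam: "lam \<noteq> 0" and b: "norm (inverse lam ^ m) \<le> b"
    and \<delta>: "0 < \<delta>" and freq: "frequently_in P b \<delta> (inverse lam ^ m)"
  shows "\<exists>C>0. fourier_decay ssm C (real m * (\<delta> * ln (1 / q) / ln b))"
proof -
  define \<theta> where "\<theta> = inverse lam ^ m"
  have \<theta>: "1 < norm \<theta>"
    unfolding \<theta>_def norm_power norm_inverse using lam contracting m
    by (intro one_less_power one_less_inverse) auto
  have b1: "1 < b" using \<theta> b by (simp add: \<theta>_def)
  obtain N0 where N0: "\<And>N t. N0 \<le> N \<Longrightarrow> 1 \<le> norm t \<Longrightarrow> norm t \<le> b \<Longrightarrow>
      \<delta> * real N \<le> real (card {n. n < N \<and> P (\<theta> ^ n * t)})"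
    using freq unfolding frequently_in_def \<theta>_def by blast
  define \<gamma> where "\<gamma> = real m * (\<delta> * ln (1 / q) / ln b)"
  have \<gamma>: "0 \<le> \<gamma>" using q b1 \<delta> by (simp add: \<gamma>_def)
  \<comment> \<open>In the variable z = D cnj \<xi> the conjugates disappear: the points
    \<open>cnj lam ^ n * \<xi>\<close> become \<open>lam ^ n * x\<close>.\<close>
  define f where "f z = norm (mask (cnj (z / D)))" for z
  have f: "0 \<le> f z" "f z \<le> 1" "P z \<Longrightarrow> f z \<le> q" for z
    using norm_mask_le_1 P[of "cnj (z / D)"] D by (auto simp: f_def)
  \<comment> \<open>\<open>C1\<close> absorbs the loss of 2 in the exponent \<open>e\<close> below;
    \<open>C2\<close> covers small frequencies, where the transform is only bounded by 1.\<close>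
  define C1 where "C1 = q powr (- 2 * real m * \<delta>)"
  define C2 where "C2 = (b ^ (N0 + 2)) powr \<gamma>"
  have C12: "0 < C1" "0 < C2" using q b1 by (auto simp: C1_def C2_def)
  have main: "norm (fourier ssm \<xi>) \<le> (C1 + C2) * norm (D * cnj \<xi>) powr (- \<gamma>)" if "\<xi> \<noteq> 0" for \<xi>
  proof -
    define x where "x = D * cnj \<xi>"
    have x0: "x \<noteq> 0" using D that by (simp add: x_def)
    show ?thesis
    proof (cases "b ^ (N0 + 2) \<le> norm x")
      case False
      have "norm (fourier ssm \<xi>) \<le> 1" by (rule norm_fourier_le_1[OF ssm_prob ssm_sets])
      also have "1 = norm x powr \<gamma> * norm x powr (- \<gamma>)" using x0 by (simp flip: powr_add)
      also have "\<dots> \<le> C2 * norm x powr (- \<gamma>)"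
        unfolding C2_def using False \<gamma> by (intro mult_right_mono powr_mono2) auto
      also have "\<dots> \<le> (C1 + C2) * norm x powr (- \<gamma>)" using C12 by (intro mult_right_mono) auto
      finally show ?thesis by (simp add: x_def)
    next
      case True
      \<comment> \<open>One unit is lost in the length of the orbit, the other because lam^j x may
        be smaller than x by a factor of up to b. The latter also explains N0 + 2 against Suc
        N0.\<close>
      define e where "e = \<delta> * (ln (norm x) / ln b - 2)"
      have "\<exists>N. \<forall>K>N. (\<Prod>k<K. f (inverse \<theta> ^ k * (lam ^ j * x))) \<le> q powr e" if "j < m" for j
      proof -
        define y where "y = lam ^ j * x"
        have "norm x / b \<le> norm y"
        proof -
          have "inverse b \<le> inverse (norm \<theta>)" using b[folded \<theta>_def] \<theta> by (intro le_imp_inverse_le) auto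
          also have "\<dots> = norm lam ^ m" by (simp add: \<theta>_def norm_power norm_inverse power_inverse)
          also have "\<dots> \<le> norm lam ^ j" using contracting \<open>j < m\<close> by (intro power_decreasing) auto
          finally have "inverse b * norm x \<le> norm lam ^ j * norm x" by (intro mult_right_mono) auto
          then show ?thesis by (simp add: y_def norm_mult norm_power divide_inverse mult.commute)
        qed
        moreover have "b ^ Suc N0 \<le> norm x / b" using True b1 by (simp add: le_divide_eq mult_ac)
        ultimately have yb: "b ^ Suc N0 \<le> norm y" by linarith
        have "\<exists>N. \<forall>K>N. (\<Prod>k<K. f (inverse \<theta> ^ k * y)) \<le> q powr (\<delta> * (ln (norm y) / ln b - 1))"
          by (rule off_orbit_product_bound[where P = P and ?N0.0 = N0])
            (rule f q \<theta> b[folded \<theta>_def] \<delta> N0 yb | assumption)+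
        then obtain N where N: "\<forall>K>N. (\<Prod>k<K. f (inverse \<theta> ^ k * y)) \<le> q powr (\<delta> * (ln (norm y) / ln b - 1))"
          by blast
        have "ln (norm x / b) \<le> ln (norm y)"
          using \<open>norm x / b \<le> norm y\<close> x0 b1 by (intro ln_mono) (auto intro: divide_pos_pos)
        then have "ln (norm x) / ln b - 1 \<le> ln (norm y) / ln b"
        proof -
          have "(ln (norm x) - ln b) / ln b \<le> ln (norm y) / ln b"
            using \<open>ln (norm x / b) \<le> ln (norm y)\<close> x0 b1 by (intro divide_right_mono) (auto simp: ln_div)
          then show ?thesis using b1 by (simp add: diff_divide_distrib)
        qed
        then have "e \<le> \<delta> * (ln (norm y) / ln b - 1)"
          unfolding e_def using \<delta> by (intro mult_left_mono) auto
        then have "q powr (\<delta> * (ln (norm y) / ln b - 1)) \<le> q powr e"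
          using q by (intro powr_mono') auto
        then show ?thesis using N unfolding y_def by (meson order_trans)
      qed
      then obtain N where N: "\<And>j K. j < m \<Longrightarrow> N j < K \<Longrightarrow> (\<Prod>k<K. f (inverse \<theta> ^ k * (lam ^ j * x))) \<le> q powr e"
        by metis
      define K where "K = Suc (\<Sum>j<m. N j)"
      have K: "N j < K" if "j < m" for j
        using member_le_sum[of j "{..<m}" N] that by (simp add: K_def)
      have "norm (fourier ssm \<xi>) \<le> (\<Prod>n<m * K. norm (mask (cnj lam ^ n * \<xi>)))"
        by (rule norm_fourier_ssm_le)
      also have "\<dots> = (\<Prod>n<m * K. f (lam ^ n * x))"
        using D by (simp add: f_def x_def)
      also have "\<dots> = (\<Prod>j<m. \<Prod>k<K. f (inverse \<theta> ^ k * (lam ^ j * x)))"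
        unfolding prod_lessThan_mult using lam
        by (intro prod.cong refl arg_cong[of _ _ f]) (simp add: \<theta>_def power_add power_mult power_inverse)
      also have "\<dots> \<le> (\<Prod>j<m. q powr e)"
        using N K f by (intro prod_mono) (auto intro: prod_nonneg)
      also have "\<dots> = q powr (real m * e)" using q by (simp add: powr_powr mult.commute flip: powr_realpow)
      also have "\<dots> = C1 * norm x powr (- \<gamma>)"
      proof -
        have "real m * e * ln q = - 2 * real m * \<delta> * ln q + - \<gamma> * ln (norm x)"
          using q b1 by (simp add: e_def \<gamma>_def ln_div field_simps)
        then show ?thesis using q x0 by (simp add: C1_def powr_def flip: exp_add)
      qed
      also have "\<dots> \<le> (C1 + C2) * norm x powr (- \<gamma>)" using C12 by (intro mult_right_mono) auto
      finally show ?thesis by (simp add: x_def)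
    qed
  qed
  have "fourier_decay ssm ((C1 + C2) * norm D powr (- \<gamma>)) \<gamma>"
    unfolding fourier_decay_def using main by (simp add: norm_mult powr_mult mult.assoc)
  moreover have "0 < (C1 + C2) * norm D powr (- \<gamma>)" using C12 D by simp
  ultimately show ?thesis unfolding \<gamma>_def by blast
qed

end

text \<open>The exponent \<gamma> is fixed before \<open>lam\<close> and m; C comes after them
  because it absorbs the threshold N0 in \<open>frequently_in\<close>.\<close>

lemma uniform_fourier_decay:
  assumes \<Lambda>: "finite \<Lambda>" "p \<in> prob_vectors \<Lambda>" "i \<in> \<Lambda>" "j \<in> \<Lambda>" "a i \<noteq> a j"
    and pos: "0 < \<rho>" "0 < \<delta>" "1 < b"
  shows "\<exists>\<gamma>>0. \<forall>lam m. lam \<noteq> 0 \<longrightarrow> norm lam < 1 \<longrightarrow> 1 \<le> m \<longrightarrow> norm (inverse lam ^ m) \<le> b \<longrightarrow>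
    frequently_in (off_integer \<rho>) b \<delta> (inverse lam ^ m) \<longrightarrow>
    (\<exists>C>0. fourier_decay (self_similar_measure \<Lambda> lam a p) C (real m * \<gamma>))"
proof -
  \<comment> \<open>The contraction 0 is a placeholder: \<open>mask\<close> does not depend on it,
    so the bound q found here holds for every \<open>lam\<close>.\<close>
  interpret Z: ifs_weights \<Lambda> 0 a p by unfold_locales (use \<Lambda> in auto)
  obtain q where q: "0 < q" "q < 1"
      "\<And>\<xi>. off_integer \<rho> ((a j - a i) * cnj \<xi>) \<Longrightarrow> norm (Z.mask \<xi>) \<le> q"
    using Z.norm_mask_le[OF \<Lambda>(3,4) _ pos(1)] \<Lambda>(5) unfolding off_integer_def by blast
  have "\<exists>C>0. fourier_decay (self_similar_measure \<Lambda> lam a p) C (real m * (\<delta> * ln (1 / q) / ln b))"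
    if "lam \<noteq> 0" "norm lam < 1" "1 \<le> m" "norm (inverse lam ^ m) \<le> b"
      "frequently_in (off_integer \<rho>) b \<delta> (inverse lam ^ m)" for lam m
  proof -
    interpret ifs_weights \<Lambda> lam a p by unfold_locales (use \<Lambda> that in auto)
    show ?thesis
      by (rule fourier_decay_if_frequently[where P = "off_integer \<rho>" and D = "a j - a i"])
        (use q that pos \<Lambda> in auto)
  qed
  moreover have "0 < \<delta> * ln (1 / q) / ln b" using q pos by (intro divide_pos_pos mult_pos_pos) auto
  ultimately show ?thesis by blast
qed

text \<open>Conjugation preserves real parts and the annulus of t. Results for the upper half-plane
  thereby reach the lower one.\<close>

lemma frequently_in_off_integer_cnj:
  "frequently_in (off_integer \<rho>) b \<delta> (cnj \<theta>) \<longleftrightarrow> frequently_in (off_integer \<rho>) b \<delta> \<theta>"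
proof -
  have imp: "frequently_in (off_integer \<rho>) b \<delta> (cnj \<theta>)" if "frequently_in (off_integer \<rho>) b \<delta> \<theta>" for \<theta>
  proof -
    have "off_integer \<rho> (cnj \<theta> ^ n * t) \<longleftrightarrow> off_integer \<rho> (\<theta> ^ n * cnj t)" for n t
    proof -
      have "cnj \<theta> ^ n * t = cnj (\<theta> ^ n * cnj t)" by simp
      then have "Re (cnj \<theta> ^ n * t) = Re (\<theta> ^ n * cnj t)" by (metis cnj.simps(1))
      then show ?thesis unfolding off_integer_def by (simp only:)
    qed
    note eq = this
    from that obtain N0 where N0: "\<And>N t. N0 \<le> N \<Longrightarrow> 1 \<le> norm t \<Longrightarrow> norm t \<le> b \<Longrightarrow>
        \<delta> * real N \<le> real (card {n. n < N \<and> off_integer \<rho> (\<theta> ^ n * t)})"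
      unfolding frequently_in_def by blast
    show ?thesis
      unfolding frequently_in_def eq using N0[of _ "cnj t" for t] by (intro exI[of _ N0]) simp
  qed
  from imp[of \<theta>] imp[of "cnj \<theta>"] show ?thesis by auto
qed

lemma hausdorff_null_inverse_power_preimage:
  assumes s: "0 < s" and B: "hausdorff_measure s B = 0" and m: "1 \<le> m"
  shows "hausdorff_measure s {lam :: complex. lam \<noteq> 0 \<and> inverse lam ^ m \<in> B} = 0"
proof (rule hausdorff_null_locally_expanding_preimage[OF s B, of "\<lambda>z. inverse z ^ m"])
  fix x :: complex assume "x \<in> {lam. lam \<noteq> 0 \<and> inverse lam ^ m \<in> B}"
  then have x: "x \<noteq> 0" by simp
  \<comment> \<open>The divided difference: (y - z) h(y, z) = z^-m - y^-m. On the diagonal it equals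
    m / x^(m + 1), which is nonzero, so continuity bounds it below near (x, x).\<close>
  define h :: "complex \<times> complex \<Rightarrow> complex" where
    "h w = (\<Sum>i<m. snd w ^ (m - Suc i) * fst w ^ i) / (fst w ^ m * snd w ^ m)" for w
  have "isCont h (x, x)" unfolding h_def using x by (intro continuous_intros) auto
  moreover have hx: "h (x, x) \<noteq> 0"
  proof -
    have "(\<Sum>i<m. x ^ (m - Suc i) * x ^ i) = (\<Sum>i<m. x ^ (m - 1))"
      by (intro sum.cong refl) (simp flip: power_add)
    then show ?thesis using x m by (simp add: h_def)
  qed
  ultimately obtain d where d: "0 < d" "\<And>w. dist w (x, x) < d \<Longrightarrow> dist (h w) (h (x, x)) < norm (h (x, x)) / 2"
    unfolding continuous_at_eps_delta by (metis half_gt_zero zero_less_norm_iff)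
  define c where "c = 2 / norm (h (x, x))"
  have "dist y z \<le> c * dist (inverse y ^ m) (inverse z ^ m)"
    if "y \<noteq> 0" "z \<noteq> 0" "y \<in> ball x (d / 2)" "z \<in> ball x (d / 2)" for y z
  proof -
    have "dist (y, z) (x, x) \<le> dist y x + dist z x"
      unfolding dist_Pair_Pair by (rule sqrt_sum_squares_le_sum) auto
    also have "\<dots> < d" using that by (simp add: dist_commute)
    finally have "norm (h (y, z)) \<ge> norm (h (x, x)) / 2"
      using d(2)[of "(y, z)"] norm_triangle_ineq2[of "h (x, x)" "h (x, x) - h (y, z)"]
      by (simp add: dist_norm norm_minus_commute)
    then have "norm (y - z) * (norm (h (x, x)) / 2) \<le> norm (y - z) * norm (h (y, z))"
      by (intro mult_left_mono) auto
    also have "\<dots> = norm ((y - z) * h (y, z))" by (simp add: norm_mult)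
    also have "(y - z) * h (y, z) = (y ^ m - z ^ m) / (y ^ m * z ^ m)"
      unfolding h_def power_diff_sumr2 by simp
    also have "\<dots> = inverse z ^ m - inverse y ^ m" using that by (simp add: field_simps power_inverse)
    finally show ?thesis using hx by (simp add: c_def dist_norm norm_minus_commute field_simps)
  qed
  then show "\<exists>V c. open V \<and> x \<in> V \<and> 0 \<le> c \<and>
      (\<forall>y\<in>{lam. lam \<noteq> 0 \<and> inverse lam ^ m \<in> B} \<inter> V. \<forall>z\<in>{lam. lam \<noteq> 0 \<and> inverse lam ^ m \<in> B} \<inter> V.
        dist y z \<le> c * dist (inverse y ^ m) (inverse z ^ m))"
    using d(1) by (intro exI[of _ "ball x (d / 2)"] exI[of _ c]) (auto simp: c_def)
qed auto

lemma hausdorff_null_cnj_preimage: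
  assumes s: "0 < s" and B: "hausdorff_measure s B = 0"
  shows "hausdorff_measure s {z. cnj z \<in> B} = 0"
  by (rule hausdorff_null_expanding_preimage[OF s B, of cnj _ 1])
    (auto simp: dist_norm simp flip: complex_cnj_diff)

text \<open>Powers of lam^-1 may come close to the real axis, but not twice in a row. The first
  power of modulus at least 2 has modulus at most 4; if its imaginary part is small, its real part
  is at least 3/2, and one more factor lam^-1 turns it away from the axis while the modulus stays
  below 8.\<close>

lemma obtain_expanding_power:
  assumes lam: "norm lam < 1" "1/2 \<le> norm lam" and \<eta>: "0 < \<eta>" "\<eta> < \<bar>Im lam\<bar>"
  shows "\<exists>m\<ge>1. 2 \<le> norm (inverse lam ^ m) \<and> norm (inverse lam ^ m) \<le> 8 \<and> \<eta> / 2 < \<bar>Im (inverse lam ^ m)\<bar>"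
proof -
  have lam0: "lam \<noteq> 0" using lam by auto
  define r where "r = norm (inverse lam)"
  have r: "1 < r" "r \<le> 2"
  proof -
    have "1 < inverse (norm lam)" by (rule one_less_inverse) (use lam lam0 in auto)
    moreover have "inverse (norm lam) \<le> inverse (1/2)" by (rule le_imp_inverse_le) (use lam in auto)
    ultimately show "1 < r" "r \<le> 2" unfolding r_def norm_inverse by auto
  qed
  define m where "m = (LEAST n. 2 \<le> r ^ n)"
  obtain n where "2 < r ^ n" using real_arch_pow[OF r(1)] by blast
  then have m: "2 \<le> r ^ m" unfolding m_def using LeastI[of "\<lambda>n. 2 \<le> r ^ n" n] by simp
  have m1: "1 \<le> m" using m by (cases m) auto
  then obtain k where k: "m = Suc k" by (cases m) auto
  have "r ^ k < 2"
    using not_less_Least[of k "\<lambda>n. 2 \<le> r ^ n"] k unfolding m_def by simp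
  then have "r ^ m \<le> 2 * 2" using r unfolding k power_Suc by (intro mult_mono) auto
  define w where "w = inverse lam ^ m"
  have w: "2 \<le> norm w" "norm w \<le> 4" using m \<open>r ^ m \<le> 2 * 2\<close> by (auto simp: w_def norm_power r_def)
  show ?thesis
  proof (cases "\<eta> / 2 < \<bar>Im w\<bar>")
    case True
    then show ?thesis using w m1 unfolding w_def by (intro exI[of _ m]) auto
  next
    case False
    define v where "v = inverse lam ^ Suc m"
    have nv: "norm v = r * norm w" by (simp add: v_def w_def norm_mult r_def)
    have "1 * 2 \<le> r * norm w" "r * norm w \<le> 2 * 4" using w r by (intro mult_mono; simp)+
    then have "2 \<le> norm v" "norm v \<le> 8" using nv by auto
    moreover have "\<eta> / 2 < \<bar>Im v\<bar>"
    proof -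
      have \<eta>1: "\<eta> < 1" using \<eta> lam abs_Im_le_cmod[of lam] by linarith
      have "norm w \<le> \<bar>Re w\<bar> + \<bar>Im w\<bar>" by (rule cmod_le)
      then have "3/2 \<le> \<bar>Re w\<bar>" using w False \<eta>1 by linarith
      then have "3/2 * \<eta> < \<bar>Re w\<bar> * \<bar>Im lam\<bar>" using \<eta> by (intro mult_le_less_imp_less) auto
      moreover have "\<bar>Im w\<bar> * \<bar>Re lam\<bar> \<le> \<eta> / 2 * 1"
        using False lam abs_Re_le_cmod[of lam] by (intro mult_mono) auto
      moreover have "\<bar>Im w * Re lam - Re w * Im lam\<bar> \<ge> \<bar>Re w\<bar> * \<bar>Im lam\<bar> - \<bar>Im w\<bar> * \<bar>Re lam\<bar>"
        unfolding abs_mult[symmetric] by linarith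
      ultimately have big: "\<eta> / 2 < \<bar>Im w * Re lam - Re w * Im lam\<bar>" using \<eta> by linarith
      have "v * (norm lam)\<^sup>2 = w * cnj lam"
        using lam0 by (simp add: v_def w_def complex_norm_square field_simps del: of_real_power)
      then have "Im v * (norm lam)\<^sup>2 = Im w * Re lam - Re w * Im lam"
        using arg_cong[of "v * (norm lam)\<^sup>2" "w * cnj lam" Im]
        unfolding times_complex.simps cnj.simps Re_complex_of_real Im_complex_of_real by simp
      then have "\<eta> / 2 < \<bar>Im v * (norm lam)\<^sup>2\<bar>" using big by simp
      then have "\<eta> / 2 < \<bar>Im v\<bar> * (norm lam)\<^sup>2" by (simp add: abs_mult)
      also have "\<dots> \<le> \<bar>Im v\<bar> * 1" using lam by (intro mult_left_mono) (auto simp: power_le_one)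
      finally show ?thesis by simp
    qed
    ultimately show ?thesis unfolding v_def by (intro exI[of _ "Suc m"]) auto
  qed
qed

section \<open>Exceptional sets\<close>

text \<open>Every base in the open upper half-plane outside the closed unit disc lies in some region
  of a countable exhaustion, and the lower half-plane is reached by conjugation. Neither the
  exhaustion nor the exceptional set refers to the digits or weights.\<close>

lemma decay_off_exceptional_set:
  "\<exists>E :: complex set. E \<subseteq> ball 0 1 - \<real> \<and> hausdorff_dim E = 0 \<and>
     (\<forall>(\<Lambda> :: 'i set) a p lam.
        finite \<Lambda> \<longrightarrow> (\<exists>i\<in>\<Lambda>. \<exists>j\<in>\<Lambda>. a i \<noteq> a j) \<longrightarrow> p \<in> prob_vectors \<Lambda> \<longrightarrow>
        lam \<in> ball 0 1 - (E \<union> \<real>) \<longrightarrow>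
        (\<exists>C>0. \<exists>\<gamma>>0. fourier_decay (self_similar_measure \<Lambda> lam a p) C \<gamma>))"
proof -
  define H where "H n = region_H (1 + 1 / real (Suc n)) (real n + 2) (1 / real (Suc n))" for n
  have "\<exists>\<rho>>0. \<forall>s>0. \<exists>\<delta>>0.
      hausdorff_measure s {\<theta> \<in> H n. \<not> frequently_in (off_integer \<rho>) (real n + 2) \<delta> \<theta>} = 0" for n
    unfolding H_def by (rule Erdos_Kahane_bases) (auto simp: field_simps)
  then obtain \<rho> where \<rho>: "\<And>n. 0 < \<rho> n"
      "\<And>n s. 0 < s \<Longrightarrow> \<exists>\<delta>>0.
        hausdorff_measure s {\<theta> \<in> H n. \<not> frequently_in (off_integer (\<rho> n)) (real n + 2) \<delta> \<theta>} = 0"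
    by metis
  \<comment> \<open>A base is exceptional only if it fails for every \<delta>. For each s this set
    is contained in the one for the \<delta> belonging to s, hence null in every positive
    dimension.\<close>
  define B where "B n = {\<theta> \<in> H n. \<forall>\<delta>>0. \<not> frequently_in (off_integer (\<rho> n)) (real n + 2) \<delta> \<theta>}" for n
  have B_null: "hausdorff_measure s (B n) = 0" if s: "0 < s" for s n
  proof -
    obtain \<delta> where "0 < \<delta>"
      "hausdorff_measure s {\<theta> \<in> H n. \<not> frequently_in (off_integer (\<rho> n)) (real n + 2) \<delta> \<theta>} = 0"
      using \<rho>(2)[OF s] by blast
    then show ?thesis by (rule_tac hausdorff_null_subset[OF s]) (auto simp: B_def)
  qed
  define E where "E = {lam \<in> ball 0 1 - \<real>. \<exists>n. inverse lam \<in> B n \<or> cnj (inverse lam) \<in> B n}"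
  have "hausdorff_measure s E = 0" if s: "0 < s" for s
  proof -
    have "hausdorff_measure s (\<Union>n. {lam. lam \<noteq> 0 \<and> inverse lam ^ 1 \<in> B n} \<union>
        {lam. lam \<noteq> 0 \<and> inverse lam ^ 1 \<in> {z. cnj z \<in> B n}}) = 0"
      by (intro hausdorff_null_UN hausdorff_null_Un hausdorff_null_inverse_power_preimage
        hausdorff_null_cnj_preimage B_null s) auto
    then show ?thesis
      by (rule hausdorff_null_subset[OF s]) (auto simp: E_def)
  qed
  then have dim: "hausdorff_dim E = 0" by (rule hausdorff_dim_eq_0)
  have "\<exists>C>0. \<exists>\<gamma>>0. fourier_decay (self_similar_measure \<Lambda> lam a p) C \<gamma>"
    if fin: "finite \<Lambda>" and ij: "i \<in> \<Lambda>" "j \<in> \<Lambda>" "a i \<noteq> a j" and p: "p \<in> prob_vectors \<Lambda>"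
      and lam: "lam \<in> ball 0 1 - (E \<union> \<real>)" for \<Lambda> :: "'i set" and a p lam i j
  proof -
    have lam1: "lam \<noteq> 0" "norm lam < 1" "Im lam \<noteq> 0"
      using lam by (auto simp: complex_is_Real_iff)
    define \<theta> where "\<theta> = (if 0 < Im (inverse lam) then inverse lam else cnj (inverse lam))"
    have Im: "Im (inverse lam) \<noteq> 0" using lam1 by (auto simp: Im_divide inverse_eq_divide)
    have "0 < Im (if 0 < Im w then w else cnj w)" if "Im w \<noteq> 0" for w using that by auto
    from this[OF Im] have \<theta>Im: "0 < Im \<theta>" unfolding \<theta>_def .
    have norm\<theta>: "norm \<theta> = norm (inverse lam)"
      unfolding \<theta>_def by (simp only: if_distrib[of norm] complex_mod_cnj if_cancel)
    then have \<theta>: "1 < norm \<theta>" unfolding norm_inverse using lam1 by (simp add: one_less_inverse)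
    obtain n :: nat where "max (norm \<theta>) (max (1 / (norm \<theta> - 1)) (1 / Im \<theta>)) < real n"
      using reals_Archimedean2 by blast
    then have n: "norm \<theta> < real n" "1 / (norm \<theta> - 1) < real (Suc n)" "1 / Im \<theta> < real (Suc n)" by auto
    have "1 / real (Suc n) < norm \<theta> - 1" "1 / real (Suc n) < Im \<theta>"
      using n(2,3) \<theta> \<theta>Im by (simp_all add: divide_less_eq mult.commute)
    then have "\<theta> \<in> H n" using n(1) by (simp add: H_def region_H_def)
    moreover have "\<theta> \<notin> B n" using lam unfolding E_def \<theta>_def by (auto split: if_splits)
    ultimately obtain \<delta> where \<delta>: "0 < \<delta>" "frequently_in (off_integer (\<rho> n)) (real n + 2) \<delta> \<theta>"
      by (auto simp: B_def)
    then have freq: "frequently_in (off_integer (\<rho> n)) (real n + 2) \<delta> (inverse lam ^ 1)"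
      unfolding \<theta>_def by (auto simp: frequently_in_off_integer_cnj split: if_splits simp del: complex_cnj_inverse)
    obtain \<gamma> where \<gamma>: "0 < \<gamma>" and decay: "\<And>lam m. lam \<noteq> 0 \<Longrightarrow> norm lam < 1 \<Longrightarrow> 1 \<le> m \<Longrightarrow>
        norm (inverse lam ^ m) \<le> real n + 2 \<Longrightarrow>
        frequently_in (off_integer (\<rho> n)) (real n + 2) \<delta> (inverse lam ^ m) \<Longrightarrow>
        \<exists>C>0. fourier_decay (self_similar_measure \<Lambda> lam a p) C (real m * \<gamma>)"
      using uniform_fourier_decay[OF fin p ij \<rho>(1) \<delta>(1), of "real n + 2" n] by auto
    have "norm (inverse lam ^ 1) \<le> real n + 2" using n(1) norm\<theta> by simp
    from decay[OF lam1(1,2) order_refl this freq] \<gamma> show ?thesis by auto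
  qed
  then show ?thesis using dim by (intro exI[of _ E]) (auto simp: E_def)
qed

text \<open>A single \<delta>, belonging to s = \<epsilon> / 2, is used on the whole region; this
  makes \<gamma> uniform in \<open>lam\<close>. Halving \<epsilon> gives the strict inequality for
  the dimension.\<close>

lemma uniform_decay_on_region:
  assumes "0 < \<epsilon>" "1 < b1" "b1 < b2" "0 < \<eta>"
  shows "\<exists>E \<subseteq> region_H b1 b2 \<eta>. hausdorff_dim E < ennreal \<epsilon> \<and>
     (\<forall>(\<Lambda> :: 'i set) a p.
        finite \<Lambda> \<longrightarrow> (\<exists>i\<in>\<Lambda>. \<exists>j\<in>\<Lambda>. a i \<noteq> a j) \<longrightarrow> p \<in> prob_vectors \<Lambda> \<longrightarrow>
        (\<exists>\<gamma>>0. \<forall>lam. inverse lam \<in> region_H b1 b2 \<eta> - E \<longrightarrow>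
           (\<exists>C>0. fourier_decay (self_similar_measure \<Lambda> lam a p) C \<gamma>)))"
proof -
  obtain \<rho> where \<rho>: "0 < \<rho>" "\<And>s. 0 < s \<Longrightarrow> \<exists>\<delta>>0.
      hausdorff_measure s {\<theta> \<in> region_H b1 b2 \<eta>. \<not> frequently_in (off_integer \<rho>) b2 \<delta> \<theta>} = 0"
    using Erdos_Kahane_bases[of b1 b2 \<eta>] assms by auto
  obtain \<delta> where \<delta>: "0 < \<delta>"
      "hausdorff_measure (\<epsilon> / 2) {\<theta> \<in> region_H b1 b2 \<eta>. \<not> frequently_in (off_integer \<rho>) b2 \<delta> \<theta>} = 0"
    using \<rho>(2)[of "\<epsilon> / 2"] assms by auto
  define E where "E = {\<theta> \<in> region_H b1 b2 \<eta>. \<not> frequently_in (off_integer \<rho>) b2 \<delta> \<theta>}"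
  have "hausdorff_dim E \<le> ennreal (\<epsilon> / 2)"
    using \<delta>(2) assms by (intro hausdorff_dim_le) (auto simp: E_def)
  also have "\<dots> < ennreal \<epsilon>" using assms by (intro ennreal_lessI) auto
  finally have dim: "hausdorff_dim E < ennreal \<epsilon>" .
  have "\<exists>\<gamma>>0. \<forall>lam. inverse lam \<in> region_H b1 b2 \<eta> - E \<longrightarrow>
      (\<exists>C>0. fourier_decay (self_similar_measure \<Lambda> lam a p) C \<gamma>)"
    if fin: "finite \<Lambda>" and ij: "i \<in> \<Lambda>" "j \<in> \<Lambda>" "a i \<noteq> a j" and p: "p \<in> prob_vectors \<Lambda>"
    for \<Lambda> :: "'i set" and a p i j
  proof -
    have b2: "1 < b2" using assms by simp
    obtain \<gamma> where \<gamma>: "0 < \<gamma>" and decay: "\<And>lam m. lam \<noteq> 0 \<Longrightarrow> norm lam < 1 \<Longrightarrow> 1 \<le> m \<Longrightarrow>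
        norm (inverse lam ^ m) \<le> b2 \<Longrightarrow> frequently_in (off_integer \<rho>) b2 \<delta> (inverse lam ^ m) \<Longrightarrow>
        \<exists>C>0. fourier_decay (self_similar_measure \<Lambda> lam a p) C (real m * \<gamma>)"
      using uniform_fourier_decay[OF fin p ij \<rho>(1) \<delta>(1) b2] by blast
    have "\<exists>C>0. fourier_decay (self_similar_measure \<Lambda> lam a p) C \<gamma>"
      if lam: "inverse lam \<in> region_H b1 b2 \<eta> - E" for lam
    proof -
      have r: "b1 \<le> norm (inverse lam)" "norm (inverse lam) \<le> b2"
        using lam by (simp_all add: region_H_def)
      then have inv: "1 < inverse (norm lam)" using assms unfolding norm_inverse by linarith
      then have "lam \<noteq> 0" "norm lam < 1" using one_less_inverse_iff[of "norm lam"] by auto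
      moreover have "frequently_in (off_integer \<rho>) b2 \<delta> (inverse lam ^ 1)"
        using lam by (simp add: E_def)
      ultimately show ?thesis using decay[of lam 1] r by simp
    qed
    then show ?thesis using \<gamma> by blast
  qed
  then show ?thesis using dim by (intro exI[of _ E]) (auto simp: E_def)
qed

lemma decay_off_exceptional_ratios:
  assumes lam: "lam \<in> ball 0 1 - \<real>"
  shows "\<exists>E :: complex set. hausdorff_dim E = 0 \<and>
     (\<forall>(\<Lambda> :: 'i set) a p.
        finite \<Lambda> \<longrightarrow> 3 \<le> card \<Lambda> \<longrightarrow> p \<in> prob_vectors \<Lambda> \<longrightarrow>
        (\<exists>i\<in>\<Lambda>. \<exists>j\<in>\<Lambda>. \<exists>k\<in>\<Lambda>. i \<noteq> j \<and> i \<noteq> k \<and> j \<noteq> k \<and>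
           a j \<noteq> a i \<and> (a k - a i) / (a j - a i) \<notin> E) \<longrightarrow>
        (\<exists>C>0. \<exists>\<gamma>>0. fourier_decay (self_similar_measure \<Lambda> lam a p) C \<gamma>))"
proof -
  have lam1: "lam \<noteq> 0" "norm lam < 1" "Im lam \<noteq> 0"
    using lam by (auto simp: complex_is_Real_iff)
  define \<theta> where "\<theta> = inverse lam"
  have \<theta>: "1 < norm \<theta>" unfolding \<theta>_def norm_inverse using lam1 by (simp add: one_less_inverse)
  have Im: "Im \<theta> \<noteq> 0" unfolding \<theta>_def using lam1 by (auto simp: Im_divide inverse_eq_divide)
  obtain \<rho> where \<rho>: "0 < \<rho>" "\<And>R s. 0 \<le> R \<Longrightarrow> 0 < s \<Longrightarrow> \<exists>\<delta>>0. hausdorff_measure s {u \<in> cball 0 R.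
      \<not> frequently_in (\<lambda>z. off_integer \<rho> z \<or> off_integer \<rho> (u * z)) (norm \<theta>) \<delta> \<theta>} = 0"
    using Erdos_Kahane_ratios[OF \<theta> Im] by blast
  define B where "B R = {u \<in> cball 0 (real R). \<forall>\<delta>>0.
      \<not> frequently_in (\<lambda>z. off_integer \<rho> z \<or> off_integer \<rho> (u * z)) (norm \<theta>) \<delta> \<theta>}" for R :: nat
  define E where "E = (\<Union>R. B R)"
  have "hausdorff_measure s E = 0" if s: "0 < s" for s
    unfolding E_def
  proof (rule hausdorff_null_UN[OF s])
    fix R :: nat
    obtain \<delta> where "0 < \<delta>" "hausdorff_measure s {u \<in> cball 0 (real R).
      \<not> frequently_in (\<lambda>z. off_integer \<rho> z \<or> off_integer \<rho> (u * z)) (norm \<theta>) \<delta> \<theta>} = 0"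
      using \<rho>(2)[OF _ s, of "real R"] by auto
    then show "hausdorff_measure s (B R) = 0"
      by (rule_tac hausdorff_null_subset[OF s]) (auto simp: B_def)
  qed
  then have dim: "hausdorff_dim E = 0" by (rule hausdorff_dim_eq_0)
  have "\<exists>C>0. \<exists>\<gamma>>0. fourier_decay (self_similar_measure \<Lambda> lam a p) C \<gamma>"
    if fin: "finite \<Lambda>" and p: "p \<in> prob_vectors \<Lambda>" and ijk: "i \<in> \<Lambda>" "j \<in> \<Lambda>" "k \<in> \<Lambda>" "i \<noteq> j" "i \<noteq> k"
      and a: "a j \<noteq> a i" "(a k - a i) / (a j - a i) \<notin> E" for \<Lambda> :: "'i set" and a p i j k
  proof -
    interpret ifs_weights \<Lambda> lam a p by unfold_locales (use fin p lam1 in auto)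
    define u where "u = (a k - a i) / (a j - a i)"
    \<comment> \<open>With D = a j - a i, a deviation of z separates the phases of i and j, and one
      of u z those of i and k. Either bounds the mask, so one of the two per position is
      enough.\<close>
    define P where "P z \<longleftrightarrow> off_integer \<rho> z \<or> off_integer \<rho> (u * z)" for z
    obtain R :: nat where "norm u < real R" using reals_Archimedean2 by blast
    moreover have "u \<notin> B R" using a(2) by (auto simp: E_def u_def)
    ultimately obtain \<delta> where \<delta>: "0 < \<delta>" "frequently_in P (norm \<theta>) \<delta> (inverse lam ^ 1)"
      by (auto simp: B_def P_def[abs_def] \<theta>_def)
    obtain q1 where q1: "0 < q1" "q1 < 1"
        "\<And>\<xi>. off_integer \<rho> ((a j - a i) * cnj \<xi>) \<Longrightarrow> norm (mask \<xi>) \<le> q1"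
      using norm_mask_le[OF ijk(1,2,4) \<rho>(1)] unfolding off_integer_def by blast
    obtain q2 where q2: "0 < q2" "q2 < 1"
        "\<And>\<xi>. off_integer \<rho> ((a k - a i) * cnj \<xi>) \<Longrightarrow> norm (mask \<xi>) \<le> q2"
      using norm_mask_le[OF ijk(1,3,5) \<rho>(1)] unfolding off_integer_def by blast
    define q where "q = max q1 q2"
    have q: "0 < q" "q < 1" using q1 q2 by (auto simp: q_def)
    have mask: "norm (mask \<xi>) \<le> q" if "P ((a j - a i) * cnj \<xi>)" for \<xi>
    proof -
      have "u * ((a j - a i) * cnj \<xi>) = (a k - a i) * cnj \<xi>" using a(1) by (simp add: u_def)
      then have "norm (mask \<xi>) \<le> q1 \<or> norm (mask \<xi>) \<le> q2"
        using that q1(3)[of \<xi>] q2(3)[of \<xi>] unfolding P_def by metis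
      then show ?thesis by (auto simp: q_def)
    qed
    have "\<exists>C>0. fourier_decay ssm C (real 1 * (\<delta> * ln (1 / q) / ln (norm \<theta>)))"
      by (rule fourier_decay_if_frequently[OF _ mask q _ lam1(1) _ \<delta>]) (use a(1) in \<open>auto simp: \<theta>_def\<close>)
    moreover have "0 < real 1 * (\<delta> * ln (1 / q) / ln (norm \<theta>))" using q \<theta> \<delta>(1) by (intro mult_pos_pos divide_pos_pos ln_gt_zero) auto
    ultimately show ?thesis by blast
  qed
  then show ?thesis using dim by (intro exI[of _ E]) blast
qed

text \<open>One set S, null in dimension s, contains the nonsmooth parameters for all sufficiently
  small widths of the annulus.\<close>

lemma dim_nonsmooth_tendsto_0:
  fixes \<Lambda> :: "'i set"
  assumes fin: "finite \<Lambda>" and card: "2 \<le> card \<Lambda>" and \<eta>: "0 < \<eta>" and p: "p \<in> prob_vectors \<Lambda>"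
    and inj: "inj_on a \<Lambda>"
  shows "((\<lambda>\<delta>. hausdorff_dim {lam :: complex. lam \<notin> \<real> \<and> norm lam \<in> {1 - \<delta><..<1} \<and> \<bar>Im lam\<bar> > \<eta> \<and>
      \<not> has_C_k_density k (self_similar_measure \<Lambda> lam a p)}) \<longlongrightarrow> 0) (at_right 0)"
proof (rule order_tendstoI)
  fix \<epsilon> :: ennreal assume "0 < \<epsilon>"
  then obtain s where s: "0 < s" "ennreal s < \<epsilon>"
    by (metis dense ennreal_less_zero_iff less_top_ennreal order_less_trans top.not_eq_extremum)
  obtain i j where ij: "i \<in> \<Lambda>" "j \<in> \<Lambda>" "a i \<noteq> a j"
    using card inj by (metis One_nat_def Suc_1 card_le_Suc0_iff_eq fin inj_on_eq_iff not_less_eq_eq)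
  define H where "H = region_H 2 8 (\<eta> / 2)"
  obtain \<rho> \<delta> where \<rho>: "0 < \<rho>" and \<delta>: "0 < \<delta>"
      "hausdorff_measure s {\<theta> \<in> H. \<not> frequently_in (off_integer \<rho>) 8 \<delta> \<theta>} = 0"
    using Erdos_Kahane_bases[of 2 8 "\<eta> / 2"] \<eta> s(1) unfolding H_def by force
  define B where "B = {\<theta> \<in> H. \<not> frequently_in (off_integer \<rho>) 8 \<delta> \<theta>}"
  obtain \<gamma> where \<gamma>: "0 < \<gamma>" and decay: "\<And>lam m. lam \<noteq> 0 \<Longrightarrow> norm lam < 1 \<Longrightarrow> 1 \<le> m \<Longrightarrow>
      norm (inverse lam ^ m) \<le> 8 \<Longrightarrow> frequently_in (off_integer \<rho>) 8 \<delta> (inverse lam ^ m) \<Longrightarrow>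
      \<exists>C>0. fourier_decay (self_similar_measure \<Lambda> lam a p) C (real m * \<gamma>)"
    using uniform_fourier_decay[OF fin p ij \<rho> \<delta>(1), of 8] by auto
  \<comment> \<open>The exponent m depends on \<open>lam\<close>, so the bad set of bases is pulled
    back along all inverse powers, together with its conjugate.\<close>
  define S where "S = (\<Union>m. {lam. lam \<noteq> 0 \<and> inverse lam ^ Suc m \<in> B} \<union>
      {lam. lam \<noteq> 0 \<and> inverse lam ^ Suc m \<in> {z. cnj z \<in> B}})"
  have S: "hausdorff_measure s S = 0"
    unfolding S_def
    by (intro hausdorff_null_UN hausdorff_null_Un hausdorff_null_inverse_power_preimage
      hausdorff_null_cnj_preimage s(1)) (use \<delta>(2) in \<open>auto simp: B_def\<close>)
  obtain m0 :: nat where m0: "(real k + 5) / \<gamma> < real m0" using reals_Archimedean2 by blast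
  \<comment> \<open>By Bernoulli's inequality |lam|^m0 is at least 3/4 this close to the unit
    circle, whereas |lam|^m is at most 1/2; hence m exceeds m0, and m \<gamma> reaches k +
    5.\<close>
  define \<delta>0 where "\<delta>0 = 1 / (4 * (real m0 + 1))"
  have \<delta>0: "0 < \<delta>0" "\<delta>0 \<le> 1/4" "real m0 * \<delta>0 \<le> 1/4" by (auto simp: \<delta>0_def field_simps)
  have sub: "{lam :: complex. lam \<notin> \<real> \<and> norm lam \<in> {1 - d<..<1} \<and> \<bar>Im lam\<bar> > \<eta> \<and>
      \<not> has_C_k_density k (self_similar_measure \<Lambda> lam a p)} \<subseteq> S" if d: "d < \<delta>0" for d
  proof
    fix lam assume "lam \<in> {lam :: complex. lam \<notin> \<real> \<and> norm lam \<in> {1 - d<..<1} \<and> \<bar>Im lam\<bar> > \<eta> \<and>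
      \<not> has_C_k_density k (self_similar_measure \<Lambda> lam a p)}"
    then have lam: "1 - \<delta>0 < norm lam" "norm lam < 1" "\<eta> < \<bar>Im lam\<bar>"
        and rough: "\<not> has_C_k_density k (self_similar_measure \<Lambda> lam a p)" using d by auto
    have lam0: "lam \<noteq> 0" using lam \<eta> by auto
    obtain m where m: "1 \<le> m" "2 \<le> norm (inverse lam ^ m)" "norm (inverse lam ^ m) \<le> 8"
        "\<eta> / 2 < \<bar>Im (inverse lam ^ m)\<bar>"
      using obtain_expanding_power[OF lam(2) _ \<eta> lam(3)] lam(1) \<delta>0(2) by auto
    have "m0 \<le> m"
    proof (rule ccontr)
      assume "\<not> m0 \<le> m"
      have "3/4 \<le> 1 + real m0 * (- \<delta>0)" using \<delta>0 by simp
      also have "\<dots> \<le> (1 + - \<delta>0) ^ m0" using \<delta>0 by (intro Bernoulli_inequality) auto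
      also have "\<dots> \<le> norm lam ^ m0" using lam \<delta>0 by (intro power_mono) auto
      also have "\<dots> \<le> norm lam ^ m" using \<open>\<not> m0 \<le> m\<close> lam by (intro power_decreasing) auto
      finally have "3/4 * 2 \<le> norm lam ^ m * norm (inverse lam ^ m)"
        using m(2) by (intro mult_mono) auto
      also have "\<dots> = 1" using lam0 by (simp add: norm_power norm_inverse power_mult_distrib[symmetric])
      finally show False by simp
    qed
    show "lam \<in> S"
    proof (rule ccontr)
      assume "lam \<notin> S"
      obtain m' where m': "m = Suc m'" using m(1) by (cases m) auto
      have notB: "inverse lam ^ m \<notin> B" "cnj (inverse lam ^ m) \<notin> B"
        using \<open>lam \<notin> S\<close> lam0 unfolding S_def m' by blast+
      have "inverse lam ^ m \<in> H \<or> cnj (inverse lam ^ m) \<in> H"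
        using m unfolding H_def region_H_def mem_Collect_eq complex_mod_cnj cnj.simps by linarith
      then have "frequently_in (off_integer \<rho>) 8 \<delta> (inverse lam ^ m)"
        using notB frequently_in_off_integer_cnj[of \<rho> 8 \<delta> "inverse lam ^ m"] unfolding B_def by blast
      then obtain C where C: "0 < C" "fourier_decay (self_similar_measure \<Lambda> lam a p) C (real m * \<gamma>)"
        using decay[OF lam0 lam(2) m(1,3)] by blast
      have "real k + 5 \<le> real m0 * \<gamma>" using m0 \<gamma> by (simp add: divide_less_eq)
      also have "\<dots> \<le> real m * \<gamma>" using \<open>m0 \<le> m\<close> \<gamma> by (intro mult_right_mono) auto
      finally have exponent: "real k + 5 \<le> real m * \<gamma>" .
      interpret ifs_weights \<Lambda> lam a p by unfold_locales (use fin p lam in auto)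
      have "has_C_k_density k ssm"
        using C exponent by (intro fourier_decay_imp_C_k_density[OF ssm_prob ssm_sets]) auto
      then show False using rough by contradiction
    qed
  qed
  have small: "hausdorff_dim {lam :: complex. lam \<notin> \<real> \<and> norm lam \<in> {1 - d<..<1} \<and> \<bar>Im lam\<bar> > \<eta> \<and>
      \<not> has_C_k_density k (self_similar_measure \<Lambda> lam a p)} < \<epsilon>" if d: "d < \<delta>0" for d
    using hausdorff_dim_le[OF less_imp_le[OF s(1)] hausdorff_null_subset[OF s(1) S sub[OF d]]] s(2)
    by (rule le_less_trans)
  have "\<forall>\<^sub>F d in at_right 0. d < \<delta>0"
    using \<delta>0(1) eventually_at_right_real[of 0 \<delta>0] by (auto elim: eventually_mono)
  then show "\<forall>\<^sub>F d in at_right 0. hausdorff_dim {lam :: complex. lam \<notin> \<real> \<and> norm lam \<in> {1 - d<..<1} \<and>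
      \<bar>Im lam\<bar> > \<eta> \<and> \<not> has_C_k_density k (self_similar_measure \<Lambda> lam a p)} < \<epsilon>"
    by (rule eventually_mono) (rule small)
qed simp

text \<open>The guard \<open>a j \<noteq> a i\<close> keeps the ratio from taking the default value
  0 of division by zero. A single index would give a point mass, which has no density for any
  \<open>lam\<close>; hence the lower bound on \<open>card \<Lambda>\<close> in the smoothness
  part.\<close>

theorem theorem4:
  shows
    "(\<exists>E :: complex set. E \<subseteq> ball 0 1 - \<real> \<and> hausdorff_dim E = 0 \<and>
        (\<forall>(\<Lambda> :: 'i set) a p lam.
           finite \<Lambda> \<longrightarrow> (\<exists>i\<in>\<Lambda>. \<exists>j\<in>\<Lambda>. a i \<noteq> a j) \<longrightarrow> p \<in> prob_vectors \<Lambda> \<longrightarrow>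
           lam \<in> ball 0 1 - (E \<union> \<real>) \<longrightarrow>
           (\<exists>C>0. \<exists>\<gamma>>0. fourier_decay (self_similar_measure \<Lambda> lam a p) C \<gamma>)))
     \<and>
     (\<forall>\<epsilon>>0. \<forall>b1 b2 \<eta>. 1 < b1 \<longrightarrow> b1 < b2 \<longrightarrow> 0 < \<eta> \<longrightarrow>
        (\<exists>E \<subseteq> region_H b1 b2 \<eta>. hausdorff_dim E < ennreal \<epsilon> \<and>
           (\<forall>(\<Lambda> :: 'i set) a p.
              finite \<Lambda> \<longrightarrow> (\<exists>i\<in>\<Lambda>. \<exists>j\<in>\<Lambda>. a i \<noteq> a j) \<longrightarrow> p \<in> prob_vectors \<Lambda> \<longrightarrow>
              (\<exists>\<gamma>>0. \<forall>lam. inverse lam \<in> region_H b1 b2 \<eta> - E \<longrightarrow>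
                 (\<exists>C>0. fourier_decay (self_similar_measure \<Lambda> lam a p) C \<gamma>)))))
     \<and>
     (\<forall>lam \<in> ball 0 1 - \<real>. \<exists>E :: complex set. hausdorff_dim E = 0 \<and>
        (\<forall>(\<Lambda> :: 'i set) a p.
           finite \<Lambda> \<longrightarrow> 3 \<le> card \<Lambda> \<longrightarrow> p \<in> prob_vectors \<Lambda> \<longrightarrow>
           (\<exists>i\<in>\<Lambda>. \<exists>j\<in>\<Lambda>. \<exists>k\<in>\<Lambda>. i \<noteq> j \<and> i \<noteq> k \<and> j \<noteq> k \<and>
              a j \<noteq> a i \<and> (a k - a i) / (a j - a i) \<notin> E) \<longrightarrow>
           (\<exists>C>0. \<exists>\<gamma>>0. fourier_decay (self_similar_measure \<Lambda> lam a p) C \<gamma>)))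
     \<and>
     (\<forall>(\<Lambda> :: 'i set) a p (k :: nat) \<eta>.
        finite \<Lambda> \<longrightarrow> 2 \<le> card \<Lambda> \<longrightarrow> 0 < \<eta> \<longrightarrow> p \<in> prob_vectors \<Lambda> \<longrightarrow> inj_on a \<Lambda> \<longrightarrow>
        ((\<lambda>\<delta>. hausdorff_dim {lam :: complex. lam \<notin> \<real> \<and> norm lam \<in> {1 - \<delta><..<1} \<and> \<bar>Im lam\<bar> > \<eta> \<and>
                 \<not> has_C_k_density k (self_similar_measure \<Lambda> lam a p)}) \<longlongrightarrow> 0) (at_right 0))"
  by (intro conjI allI impI ballI decay_off_exceptional_set uniform_decay_on_region
      decay_off_exceptional_ratios dim_nonsmooth_tendsto_0)

end
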